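(* Let $\alpha=1$ and let $\zeta$ and $V(x)=V_0\sin^2(kx)$ satisfy the hypotheses of the context. For every $k>0$, every nonlocality parameter $\epsilon>0$ and every $n\in\mathbb N$, the solution $\phi_\omega(x)e^{-i\omega t}$ of the nonlocal Gross-Pitaevskii equation is spectrally stable with respect to perturbations of period $\frac{2\pi n}{k}$ for sufficiently large offset size $B$, $V_0<0$ and $|V_0|$ sufficiently small. That is: there is $B^*>0$ such that for every $B>B^*$ there is $v^*>0$ such that for all $V_0\in(-v^*,0)$ every $\lambda\in\sigma(JL)$ satisfies $\mathrm{Re}(\lambda)\le0$, where $\sigma(JL)$ is the spectrum of $JL$ as an operator on $L^2(S_{2\pi n})\times L^2(S_{2\pi n})$ with domain $H_2(S_{2\pi n})\times H_2(S_{2\pi n})$.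
   Context: $S_T$ is the circle of circumference $T$; $L^2(S_T)$ and the Sobolev spaces $H_s(S_T)$ consist of $T$-periodic complex-valued functions. Fourier transform: $\hat h(\tilde s)=\int_{\mathbb R}e^{-i\tilde sx}h(x)dx$. Hypotheses: $V(x)=V_0\sin^2(kx)$; $\zeta\ge0$ is even with $\|\zeta\|_{L^1(\mathbb R)}=1$; $\hat\zeta>0$ on $\mathbb R$; and $\hat\zeta(\tilde s)\le(1+|\tilde s|)^{-1/2-\tilde\epsilon}$ for all $\tilde s$, for some $\tilde\epsilon>0$. Kernel: $R(x;\epsilon)=\frac1\epsilon\zeta(\frac x\epsilon)$. Nonlocal Gross-Pitaevskii equation: $i\partial_t\psi=-\frac12\partial_x^2\psi+\alpha\psi(x)\int_{-\infty}^\infty R(x-y;\epsilon)|\psi(y)|^2dy+V(x)\psi$. With $\beta(k;\epsilon)=\int_{\mathbb R}R(x;\epsilon)\cos(2kx)dx$, $A=\frac{-V_0}{\alpha\beta(k;\epsilon)}$ and offset size $B\ge\max\{-A,0\}$, it has the explicit solution $\psi=\phi_\omega(x)e^{-i\omega t}$, $\phi_\omega(x)=\sqrt B\cos(kx)+i\sqrt{B+A}\sin(kx)$, $\omega=\frac{V_0+k^2}{2}+\alpha B-\frac{V_0}{2\beta(k;\epsilon)}$. Linearizing about this solution in the rotating frame, separating real and imaginary parts and rescaling $x\to kx$ gives (for $\alpha=1$) the operator $JL$ with $J=\begin{pmatrix} 0 & 1 \\ -1 & 0 \end{pmatrix}$ and $$L\begin{pmatrix} w \\ z \end{pmatrix}=\begin{pmatrix}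 -\frac{k^2}{2}(\partial_x^2+1)w+2u_\omega\,R_{k,\epsilon}*(u_\omega w+v_\omega z) \\ -\frac{k^2}{2}(\partial_x^2+1)z+2v_\omega\,R_{k,\epsilon}*(u_\omega w+v_\omega z) \end{pmatrix},$$ where $u_\omega=\sqrt B\cos x$, $v_\omega=\sqrt{B+A}\sin x$, $R_{k,\epsilon}(x)=\frac1kR(\frac xk;\epsilon)$ and $*$ is convolution over $\mathbb R$. Perturbations of period $2\pi n/k$ in the original variable correspond to period $2\pi n$ after rescaling. *)

theory Defs
  imports "HOL-Analysis.Analysis"
begin

section \<open>Function spaces on the circle of circumference T\<close>

text \<open>
  Elements of \<open>L\<^sup>2(S\<^sub>T)\<close> are represented by everywhere-defined, everywhere \<open>T\<close>-periodic Borel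
  functions. Representatives that agree almost everywhere denote the same element, so every
  equation between elements below is an almost-everywhere equation.
\<close>

definition L2_circle :: "real \<Rightarrow> (real \<Rightarrow> complex) set" where
  "L2_circle T = {f. f \<in> borel_measurable borel \<and> (\<forall>x. f (x + T) = f x) \<and>
     set_integrable lborel {0..T} (\<lambda>x. (cmod (f x))\<^sup>2)}"

definition smooth_periodic :: "real \<Rightarrow> (real \<Rightarrow> real) \<Rightarrow> bool" where
  "smooth_periodic T \<phi> \<longleftrightarrow>
     (\<forall>x. \<phi> (x + T) = \<phi> x) \<and> (\<forall>j x. (deriv ^^ j) \<phi> differentiable (at x))"

text \<open>
  Distributional derivative on the circle. Real test functions suffice for complex-valued \<open>f\<close>,
  since the pairing is bilinear.
\<close>

definition has_weak_deriv :: "real \<Rightarrow> (real \<Rightarrow> complex) \<Rightarrow> (real \<Rightarrow> complex) \<Rightarrow> bool" where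
  "has_weak_deriv T f g \<longleftrightarrow>
     (\<forall>\<phi>. smooth_periodic T \<phi> \<longrightarrow>
        (LINT x:{0..T}|lborel. f x * complex_of_real (deriv \<phi> x)) =
        - (LINT x:{0..T}|lborel. g x * complex_of_real (\<phi> x)))"

primrec sobolev_circle :: "nat \<Rightarrow> real \<Rightarrow> (real \<Rightarrow> complex) set" where
  "sobolev_circle 0 T = L2_circle T"
| "sobolev_circle (Suc s) T = {f \<in> L2_circle T. \<exists>g \<in> sobolev_circle s T. has_weak_deriv T f g}"

text \<open>
  The weak derivative is determined only up to null sets; \<open>weak_deriv\<close> selects a representative.
  It is meaningful only for \<open>f\<close> in the first-order Sobolev space.
\<close>

definition weak_deriv :: "real \<Rightarrow> (real \<Rightarrow> complex) \<Rightarrow> (real \<Rightarrow> complex)" where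
  "weak_deriv T f = (SOME g. g \<in> L2_circle T \<and> has_weak_deriv T f g)"


section \<open>Spectrum of an unbounded operator on the product space\<close>

type_synonym cfun_pair = "(real \<Rightarrow> complex) \<times> (real \<Rightarrow> complex)"

definition pair_norm :: "real \<Rightarrow> cfun_pair \<Rightarrow> real" where
  "pair_norm T U = sqrt ((LINT x:{0..T}|lborel. (cmod (fst U x))\<^sup>2) +
                         (LINT x:{0..T}|lborel. (cmod (snd U x))\<^sup>2))"

definition pair_eq :: "cfun_pair \<Rightarrow> cfun_pair \<Rightarrow> bool" where
  "pair_eq U W \<longleftrightarrow> (AE x in lborel. fst U x = fst W x \<and> snd U x = snd W x)"

definition shifted :: "(cfun_pair \<Rightarrow> cfun_pair) \<Rightarrow> complex \<Rightarrow> cfun_pair \<Rightarrow> cfun_pair" where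
  "shifted \<A> \<mu> U = ((\<lambda>x. fst (\<A> U) x - \<mu> * fst U x), (\<lambda>x. snd (\<A> U) x - \<mu> * snd U x))"

text \<open>
  \<open>\<mu>\<close> is in the resolvent set of \<open>\<A>\<close> with domain \<open>D\<close> if \<open>\<A> - \<mu>\<close> is a bijection from \<open>D\<close> onto
  \<open>L\<^sup>2 \<times> L\<^sup>2\<close> whose inverse is bounded in the \<open>L\<^sup>2\<close>-norm.
\<close>

definition resolvent_set ::
    "real \<Rightarrow> cfun_pair set \<Rightarrow> (cfun_pair \<Rightarrow> cfun_pair) \<Rightarrow> complex set" where
  "resolvent_set T D \<A> = {\<mu>.
     (\<forall>U\<in>D. \<forall>W\<in>D. pair_eq (shifted \<A> \<mu> U) (shifted \<A> \<mu> W) \<longrightarrow> pair_eq U W) \<and>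
     (\<forall>F \<in> L2_circle T \<times> L2_circle T. \<exists>U\<in>D. pair_eq (shifted \<A> \<mu> U) F) \<and>
     (\<exists>C. \<forall>U\<in>D. pair_norm T U \<le> C * pair_norm T (shifted \<A> \<mu> U))}"

definition spectrum ::
    "real \<Rightarrow> cfun_pair set \<Rightarrow> (cfun_pair \<Rightarrow> cfun_pair) \<Rightarrow> complex set" where
  "spectrum T D \<A> = - resolvent_set T D \<A>"


section \<open>The kernel, the stationary solution and its linearization\<close>

definition fourier :: "(real \<Rightarrow> real) \<Rightarrow> real \<Rightarrow> complex" where
  "fourier h s = (LINT x|lborel. exp (- \<i> * complex_of_real (s * x)) * complex_of_real (h x))"

definition kernel :: "(real \<Rightarrow> real) \<Rightarrow> real \<Rightarrow> real \<Rightarrow> real" where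
  "kernel \<zeta> \<epsilon> x = 1 / \<epsilon> * \<zeta> (x / \<epsilon>)"

definition scaled_kernel :: "(real \<Rightarrow> real) \<Rightarrow> real \<Rightarrow> real \<Rightarrow> real \<Rightarrow> real" where
  "scaled_kernel \<zeta> k \<epsilon> x = 1 / k * kernel \<zeta> \<epsilon> (x / k)"

definition beta :: "(real \<Rightarrow> real) \<Rightarrow> real \<Rightarrow> real \<Rightarrow> real" where
  "beta \<zeta> k \<epsilon> = (LINT x|lborel. kernel \<zeta> \<epsilon> x * cos (2 * k * x))"

definition amplitude :: "(real \<Rightarrow> real) \<Rightarrow> real \<Rightarrow> real \<Rightarrow> real \<Rightarrow> real \<Rightarrow> real" where
  "amplitude \<zeta> k \<epsilon> \<alpha> V0 = - V0 / (\<alpha> * beta \<zeta> k \<epsilon>)"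

definition phi_omega ::
    "(real \<Rightarrow> real) \<Rightarrow> real \<Rightarrow> real \<Rightarrow> real \<Rightarrow> real \<Rightarrow> real \<Rightarrow> real \<Rightarrow> complex" where
  "phi_omega \<zeta> k \<epsilon> \<alpha> V0 B x =
     complex_of_real (sqrt B * cos (k * x)) +
     \<i> * complex_of_real (sqrt (B + amplitude \<zeta> k \<epsilon> \<alpha> V0) * sin (k * x))"

text \<open>
  Real and imaginary parts of the profile for \<open>\<alpha> = 1\<close>, in the rescaled variable: for \<open>k \<noteq> 0\<close> these
  are \<open>sqrt B * cos x\<close> and \<open>sqrt (B + A) * sin x\<close>.
\<close>

definition u_omega :: "(real \<Rightarrow> real) \<Rightarrow> real \<Rightarrow> real \<Rightarrow> real \<Rightarrow> real \<Rightarrow> real \<Rightarrow> real" where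
  "u_omega \<zeta> k \<epsilon> V0 B x = Re (phi_omega \<zeta> k \<epsilon> 1 V0 B (x / k))"

definition v_omega :: "(real \<Rightarrow> real) \<Rightarrow> real \<Rightarrow> real \<Rightarrow> real \<Rightarrow> real \<Rightarrow> real \<Rightarrow> real" where
  "v_omega \<zeta> k \<epsilon> V0 B x = Im (phi_omega \<zeta> k \<epsilon> 1 V0 B (x / k))"

text \<open>
  Convolution over the whole real line. For an integrable kernel and a periodic, locally integrable
  \<open>f\<close> the integral converges for almost every \<open>x\<close>.
\<close>

definition conv :: "(real \<Rightarrow> real) \<Rightarrow> (real \<Rightarrow> complex) \<Rightarrow> real \<Rightarrow> complex" where
  "conv K f x = (LINT y|lborel. complex_of_real (K (x - y)) * f y)"

definition J_op :: "cfun_pair \<Rightarrow> cfun_pair" where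
  "J_op U = (snd U, (\<lambda>x. - fst U x))"

definition L_op :: "real \<Rightarrow> (real \<Rightarrow> real) \<Rightarrow> real \<Rightarrow> real \<Rightarrow> real \<Rightarrow> real \<Rightarrow> cfun_pair \<Rightarrow> cfun_pair"
  where
  "L_op T \<zeta> k \<epsilon> V0 B U =
    (let w = fst U; z = snd U;
         u = (\<lambda>x. complex_of_real (u_omega \<zeta> k \<epsilon> V0 B x));
         v = (\<lambda>x. complex_of_real (v_omega \<zeta> k \<epsilon> V0 B x));
         c = conv (scaled_kernel \<zeta> k \<epsilon>) (\<lambda>y. u y * w y + v y * z y)
     in ((\<lambda>x. - complex_of_real (k\<^sup>2 / 2) * (weak_deriv T (weak_deriv T w) x + w x)
               + 2 * u x * c x),
         (\<lambda>x. - complex_of_real (k\<^sup>2 / 2) * (weak_deriv T (weak_deriv T z) x + z x)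
               + 2 * v x * c x)))"

definition JL_op :: "real \<Rightarrow> (real \<Rightarrow> real) \<Rightarrow> real \<Rightarrow> real \<Rightarrow> real \<Rightarrow> real \<Rightarrow> cfun_pair \<Rightarrow> cfun_pair"
  where
  "JL_op T \<zeta> k \<epsilon> V0 B U = J_op (L_op T \<zeta> k \<epsilon> V0 B U)"

text \<open>
  Spectral stability of \<open>phi_omega\<close> under perturbations of period \<open>2 * pi * n / k\<close>; in the rescaled
  variable the period is \<open>2 * pi * n\<close>.
\<close>

definition spectrally_stable ::
    "(real \<Rightarrow> real) \<Rightarrow> real \<Rightarrow> real \<Rightarrow> nat \<Rightarrow> real \<Rightarrow> real \<Rightarrow> bool" where
  "spectrally_stable \<zeta> k \<epsilon> n V0 B \<longleftrightarrow>
     (let T = 2 * pi * real n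
      in \<forall>\<mu> \<in> spectrum T (sobolev_circle 2 T \<times> sobolev_circle 2 T) (JL_op T \<zeta> k \<epsilon> V0 B). Re \<mu> \<le> 0)"

end

theory Submission
  imports Defs "HOL-Complex_Analysis.Great_Picard"
begin

text \<open>
  Write \<open>a\<^sub>m\<close>, \<open>b\<^sub>m\<close> for the Fourier coefficients of \<open>w\<close>, \<open>z\<close> at frequency \<open>m / n\<close> and pass to the
  co-rotating variables \<open>X\<^sub>m = a\<^sub>m\<^sub>+\<^sub>n + \<i> b\<^sub>m\<^sub>+\<^sub>n\<close> and \<open>Y\<^sub>m = a\<^sub>m\<^sub>-\<^sub>n - \<i> b\<^sub>m\<^sub>-\<^sub>n\<close>. At \<open>V\<^sub>0 = 0\<close> the profile is a plane wave
  and the quadratic form of \<open>L\<close> splits into \<open>2 \<times> 2\<close> blocks, which for large \<open>B\<close> are uniformly positive,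
  except for the phase mode \<open>(- v\<^sub>\<omega>, u\<^sub>\<omega>)\<close> in the kernel. This mode stays in the kernel of \<open>L\<close> for every
  \<open>V\<^sub>0\<close>, so \<open>L \<ge> 0\<close> persists for small \<open>\<bar>V\<^sub>0\<bar>\<close>, with a gap above its one-dimensional kernel.

  If \<open>Re \<mu> > 0\<close> and \<open>(J L - \<mu>) U = F\<close>, pairing with \<open>J U\<close> and multiplying by \<open>cnj \<mu>\<close> gives
  \<open>Re \<mu> \<langle>L U, U\<rangle> \<le> \<bar>\<mu>\<bar> \<parallel>F\<parallel> \<parallel>U\<parallel>\<close>, which controls the part of \<open>U\<close> transversal to the phase mode; the
  rows at \<open>m = 0\<close> control the rest. The resulting bound \<open>\<parallel>U\<parallel> \<le> C \<parallel>F\<parallel>\<close> holds uniformly for all Galerkin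
  truncations, so solutions are obtained as coordinatewise limits of truncated ones, and \<open>\<mu>\<close> is in the
  resolvent set.
\<close>

text \<open>The energy alone cannot bound the resolvent: the phase mode has zero energy, so its
  amplitude in \<open>U\<close> is invisible to the quadratic form. What closes the argument is that
  the nonlocal term is blind to this mode as well, so that its amplitude can be read off the
  equation itself, at the price of a factor \<open>1 / \<bar>\<mu>\<bar>\<close>.

  In the rescaled variable the profile is 2 \<sigma> exp(ix) - 2 \<delta> exp(-ix), with \<sigma>
  and \<delta> a quarter of the sum and of the difference of sqrt(B + A) and sqrt B. The part in
  \<sigma> produces the blocks; the part in \<delta> couples indices at distance 2n and is treated
  as a perturbation.

  The kinetic part of a block can be negative only for |m| < 2n. Hence the nonlocal term has to
  dominate at finitely many frequencies only, where the positive Fourier transform of \<zeta> has a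
  positive minimum; this fixes the threshold for B. The coercivity constant of the blocks is of
  order (k/n)^2, its size at the frequencies next to 0, and \<delta>^2 is at most A/16. Together
  these give a threshold for |V0| that shrinks like 1/n^2 and does not depend on B.\<close>

section \<open>Fourier coefficients and absolutely convergent Fourier series\<close>

text \<open>The notation \<open>abs_summable_on\<close> is ambiguous between \<open>Infinite_Sum\<close> and \<open>Infinite_Set_Sum\<close>.\<close>

abbreviation abs_summable :: "(int \<Rightarrow> complex) \<Rightarrow> bool" where
  "abs_summable a \<equiv> (\<lambda>m. cmod (a m)) summable_on UNIV"

locale circle =
  fixes T :: real
  assumes T_pos: "T > 0"
begin

definition chr :: "int \<Rightarrow> real \<Rightarrow> complex" where
  "chr m x = cis (2 * pi * of_int m * x / T)"

definition coef :: "(real \<Rightarrow> complex) \<Rightarrow> int \<Rightarrow> complex" where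
  "coef f m = (LINT x:{0..T}|lborel. f x * chr (- m) x) / of_real T"

definition series :: "(int \<Rightarrow> complex) \<Rightarrow> real \<Rightarrow> complex" where
  "series a x = (\<Sum>\<^sub>\<infinity>m. a m * chr m x)"

lemma norm_chr [simp]: "cmod (chr m x) = 1"
  by (simp add: chr_def)

lemma chr_mult: "chr m x * chr l x = chr (m + l) x"
  by (simp add: chr_def cis_mult ring_distribs add_divide_distrib)

lemma chr_zero [simp]: "chr 0 x = 1"
  by (simp add: chr_def)

lemma cnj_chr: "cnj (chr m x) = chr (- m) x"
  by (simp add: chr_def cis_cnj)

lemma chr_diff: "chr m (x - y) = chr m x * chr (- m) y"
  by (simp add: chr_def cis_mult ring_distribs diff_divide_distrib)

lemma chr_period [simp]: "chr m (x + T) = chr m x"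
proof -
  have "2 * pi * of_int m * (x + T) / T = 2 * pi * of_int m * x / T + 2 * pi * of_int m"
    using T_pos by (simp add: field_simps)
  then have "chr m (x + T) = chr m x * cis (2 * pi * of_int m)"
    unfolding chr_def by (simp only: cis_mult [symmetric])
  also have "cis (2 * pi * of_int m) = 1"
    by (rule cis_multiple_2pi) auto
  finally show ?thesis by simp
qed

lemma continuous_on_chr [continuous_intros]: "continuous_on A (chr m)"
proof -
  have "chr m = (\<lambda>x. cis (2 * pi * of_int m * x / T))" by (auto simp: chr_def)
  then show ?thesis by (auto intro!: continuous_intros simp: T_pos less_imp_neq[symmetric])
qed

lemma borel_measurable_chr [measurable]: "chr m \<in> borel_measurable borel"
  using continuous_on_chr by (rule borel_measurable_continuous_onI)

lemma series_uniform_limit: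
  assumes "abs_summable a"
  shows "uniform_limit UNIV (\<lambda>X x. \<Sum>m\<in>X. a m * chr m x) (series a) (finite_subsets_at_top UNIV)"
  unfolding series_def
  by (rule Weierstrass_m_test_general[where M = "\<lambda>m. cmod (a m)"]) (use assms in \<open>auto simp: norm_mult\<close>)

lemma continuous_on_series:
  assumes "abs_summable a"
  shows "continuous_on UNIV (series a)"
  by (rule uniform_limit_theorem[OF _ series_uniform_limit[OF assms]])
     (auto intro!: always_eventually continuous_intros)

lemma borel_measurable_series:
  "abs_summable a \<Longrightarrow> series a \<in> borel_measurable borel"
  using continuous_on_series by (rule borel_measurable_continuous_onI)

lemma series_period [simp]: "series a (x + T) = series a x"
  by (simp add: series_def)

lemma norm_series_le:
  assumes "abs_summable a"
  shows "cmod (series a x) \<le> (\<Sum>\<^sub>\<infinity>m. cmod (a m))"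
  unfolding series_def
  by (rule order_trans[OF norm_infsum_bound]) (use assms in \<open>auto simp: norm_mult\<close>)

lemma integrable_mult_bounded:
  fixes f g :: "real \<Rightarrow> complex"
  assumes "integrable lborel f" "g \<in> borel_measurable borel" "\<And>x. cmod (g x) \<le> C"
  shows "integrable lborel (\<lambda>x. f x * g x)"
proof (rule Bochner_Integration.integrable_bound)
  show "integrable lborel (\<lambda>x. C * norm (f x))" using assms by auto
  show "(\<lambda>x. f x * g x) \<in> borel_measurable lborel" using assms by auto
  show "AE x in lborel. norm (f x * g x) \<le> norm (C * norm (f x))"
    using assms(3) by (auto simp: norm_mult abs_mult mult.commute[of C]
      intro!: AE_I2 mult_left_mono order_trans[OF assms(3)])
qed

text \<open>Uniform convergence on the whole line permits the exchange against any integrable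
  \<open>f\<close>. The domain is the line rather than one period because the statement serves both
  coefficient integrals, with an indicator inside \<open>f\<close>, and convolution
  integrals.\<close>

lemma has_sum_integral_series:
  fixes f :: "real \<Rightarrow> complex"
  assumes f: "integrable lborel f" and a: "abs_summable a"
  shows "((\<lambda>m. a m * (LINT x|lborel. f x * chr m x)) has_sum (LINT x|lborel. f x * series a x)) UNIV"
  unfolding has_sum_def tendsto_iff
proof safe
  fix e :: real assume e: "e > 0"
  define I where "I = (LINT x|lborel. cmod (f x))"
  have I: "I \<ge> 0" unfolding I_def by simp
  define d where "d = e / (I + 1)"
  have d: "d > 0" using e I by (simp add: d_def)
  have int: "integrable lborel (\<lambda>x. f x * chr m x)" for m
    by (rule integrable_mult_bounded[OF f, where C=1]) auto
  have int2: "integrable lborel (\<lambda>x. f x * series a x)"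
    by (rule integrable_mult_bounded[OF f borel_measurable_series[OF a] norm_series_le[OF a]])
  have "\<forall>\<^sub>F X in finite_subsets_at_top UNIV. \<forall>x\<in>UNIV. dist (\<Sum>m\<in>X. a m * chr m x) (series a x) < d"
    using series_uniform_limit[OF a] d unfolding uniform_limit_iff by blast
  then show "\<forall>\<^sub>F X in finite_subsets_at_top UNIV.
     dist (\<Sum>m\<in>X. a m * (LINT x|lborel. f x * chr m x)) (LINT x|lborel. f x * series a x) < e"
  proof eventually_elim
    case (elim X)
    have "(\<Sum>m\<in>X. a m * (LINT x|lborel. f x * chr m x)) = (LINT x|lborel. (\<Sum>m\<in>X. a m * (f x * chr m x)))"
      using int by (subst Bochner_Integration.integral_sum) auto
    then have "(\<Sum>m\<in>X. a m * (LINT x|lborel. f x * chr m x)) - (LINT x|lborel. f x * series a x)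
      = (LINT x|lborel. (\<Sum>m\<in>X. a m * (f x * chr m x)) - f x * series a x)"
      using int int2 by (subst Bochner_Integration.integral_diff) auto
    also have "\<dots> = (LINT x|lborel. f x * ((\<Sum>m\<in>X. a m * chr m x) - series a x))"
      by (rule Bochner_Integration.integral_cong) (auto simp: sum_distrib_left algebra_simps)
    also have "cmod \<dots> \<le> (LINT x|lborel. d * cmod (f x))"
    proof (rule order_trans[OF integral_norm_bound integral_mono])
      have "integrable lborel (\<lambda>x. (\<Sum>m\<in>X. a m * (f x * chr m x)) - f x * series a x)"
        using int int2 by auto
      moreover have "(\<lambda>x. (\<Sum>m\<in>X. a m * (f x * chr m x)) - f x * series a x)
        = (\<lambda>x. f x * ((\<Sum>m\<in>X. a m * chr m x) - series a x))"
        by (auto simp: sum_distrib_left algebra_simps)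
      ultimately show "integrable lborel (\<lambda>x. cmod (f x * ((\<Sum>m\<in>X. a m * chr m x) - series a x)))"
        by (simp add: integrable_norm)
      show "integrable lborel (\<lambda>x. d * cmod (f x))" using f by auto
      show "cmod (f x * ((\<Sum>m\<in>X. a m * chr m x) - series a x)) \<le> d * cmod (f x)" for x
        using elim[rule_format, of x] mult_left_mono[of "cmod ((\<Sum>m\<in>X. a m * chr m x) - series a x)" d "cmod (f x)"]
        by (auto simp: norm_mult dist_norm mult.commute)
    qed
    also have "\<dots> = d * I" by (simp add: I_def)
    also have "\<dots> < e" using e I by (simp add: d_def field_simps)
    finally show ?case by (simp add: dist_norm)
  qed
qed

section \<open>Square-integrable periodic functions\<close>

lemma set_integrable_one: "set_integrable lborel {0..T} (\<lambda>x. 1 :: real)"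
  using T_pos by (simp add: set_integrable_def integrable_real_indicator)

text \<open>A period has finite measure, and |f| is dominated by 1 + |f|^2.\<close>

lemma L2_integrable:
  assumes "f \<in> L2_circle T"
  shows "set_integrable lborel {0..T} f"
proof -
  have m[measurable]: "f \<in> borel_measurable borel" and i: "set_integrable lborel {0..T} (\<lambda>x. (cmod (f x))\<^sup>2)"
    using assms by (auto simp: L2_circle_def)
  have "set_integrable lborel {0..T} (\<lambda>x. 1 + (cmod (f x))\<^sup>2)"
    using i set_integrable_one by (intro set_integral_add) auto
  then show ?thesis
    unfolding set_integrable_def
  proof (rule Bochner_Integration.integrable_bound)
    have "t \<le> 1 + t\<^sup>2" for t :: real using zero_le_power2[of "t - 1/2"] by (simp add: power2_eq_square algebra_simps)
    then show "AE x in lborel. norm (indicat_real {0..T} x *\<^sub>R f x) \<le> norm (indicat_real {0..T} x *\<^sub>R (1 + (cmod (f x))\<^sup>2))"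
      by (auto simp: indicator_def)
  qed simp
qed

lemma L2_add:
  assumes "f \<in> L2_circle T" "g \<in> L2_circle T"
  shows "(\<lambda>x. f x + g x) \<in> L2_circle T"
proof -
  have m[measurable]: "f \<in> borel_measurable borel" "g \<in> borel_measurable borel"
    and i: "set_integrable lborel {0..T} (\<lambda>x. (cmod (f x))\<^sup>2)" "set_integrable lborel {0..T} (\<lambda>x. (cmod (g x))\<^sup>2)"
    using assms by (auto simp: L2_circle_def)
  have "set_integrable lborel {0..T} (\<lambda>x. 2 * (cmod (f x))\<^sup>2 + 2 * (cmod (g x))\<^sup>2)"
    using i by (intro set_integral_add set_integrable_mult_right) auto
  then have "set_integrable lborel {0..T} (\<lambda>x. (cmod (f x + g x))\<^sup>2)"
    unfolding set_integrable_def
  proof (rule Bochner_Integration.integrable_bound)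
    have "(cmod (f x + g x))\<^sup>2 \<le> 2 * (cmod (f x))\<^sup>2 + 2 * (cmod (g x))\<^sup>2" for x
      using power_mono[OF norm_triangle_ineq[of "f x" "g x"], of 2]
        zero_le_power2[of "cmod (f x) - cmod (g x)"] by (simp add: power2_eq_square algebra_simps)
    then show "AE x in lborel. norm (indicat_real {0..T} x *\<^sub>R (cmod (f x + g x))\<^sup>2)
       \<le> norm (indicat_real {0..T} x *\<^sub>R (2 * (cmod (f x))\<^sup>2 + 2 * (cmod (g x))\<^sup>2))"
      by (auto simp: indicator_def)
  qed simp
  then show ?thesis using assms by (auto simp: L2_circle_def)
qed

lemma L2_mult_bounded:
  assumes "f \<in> L2_circle T" "g \<in> borel_measurable borel" "\<And>x. g (x + T) = g x" "\<And>x. cmod (g x) \<le> C"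
  shows "(\<lambda>x. g x * f x) \<in> L2_circle T"
proof -
  have m[measurable]: "f \<in> borel_measurable borel" "g \<in> borel_measurable borel"
    and i: "set_integrable lborel {0..T} (\<lambda>x. (cmod (f x))\<^sup>2)"
    using assms by (auto simp: L2_circle_def)
  have "set_integrable lborel {0..T} (\<lambda>x. C\<^sup>2 * (cmod (f x))\<^sup>2)"
    using i by (intro set_integrable_mult_right) auto
  then have "set_integrable lborel {0..T} (\<lambda>x. (cmod (g x * f x))\<^sup>2)"
    unfolding set_integrable_def
  proof (rule Bochner_Integration.integrable_bound)
    have "(cmod (g x * f x))\<^sup>2 \<le> C\<^sup>2 * (cmod (f x))\<^sup>2" for x
      using assms(4)[of x] by (auto simp: norm_mult power_mult_distrib intro!: mult_right_mono power_mono)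
    then show "AE x in lborel. norm (indicat_real {0..T} x *\<^sub>R (cmod (g x * f x))\<^sup>2)
       \<le> norm (indicat_real {0..T} x *\<^sub>R (C\<^sup>2 * (cmod (f x))\<^sup>2))"
      by (auto simp: indicator_def)
  qed simp
  then show ?thesis using assms by (auto simp: L2_circle_def)
qed

lemma L2_cmult: "f \<in> L2_circle T \<Longrightarrow> (\<lambda>x. c * f x) \<in> L2_circle T"
  by (rule L2_mult_bounded[where C = "cmod c"]) auto

lemma L2_diff: "f \<in> L2_circle T \<Longrightarrow> g \<in> L2_circle T \<Longrightarrow> (\<lambda>x. f x - g x) \<in> L2_circle T"
  using L2_add[OF _ L2_cmult[of g "-1"]] by simp

lemma L2_chr_mult: "f \<in> L2_circle T \<Longrightarrow> (\<lambda>x. chr m x * f x) \<in> L2_circle T"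
  by (rule L2_mult_bounded[where C = 1]) auto

lemma L2_one: "(\<lambda>x. 1) \<in> L2_circle T"
  using set_integrable_one by (auto simp: L2_circle_def)

lemma L2_bounded:
  assumes "g \<in> borel_measurable borel" "\<And>x. g (x + T) = g x" "\<And>x. cmod (g x) \<le> C"
  shows "g \<in> L2_circle T"
  using L2_mult_bounded[OF L2_one assms] by simp

lemma L2_series: "abs_summable a \<Longrightarrow> series a \<in> L2_circle T"
  by (rule L2_bounded[OF borel_measurable_series _ norm_series_le]) auto

lemma L2_chr: "chr m \<in> L2_circle T"
  by (rule L2_bounded[where C=1]) auto

lemma set_integrable_mult_bounded:
  fixes f g :: "real \<Rightarrow> complex"
  assumes "set_integrable lborel {0..T} f" "g \<in> borel_measurable borel" "\<And>x. cmod (g x) \<le> C"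
  shows "set_integrable lborel {0..T} (\<lambda>x. f x * g x)"
  using integrable_mult_bounded[OF assms(1)[unfolded set_integrable_def] assms(2,3)]
  by (simp add: set_integrable_def)

lemma set_integrable_mult_chr:
  "set_integrable lborel {0..T} f \<Longrightarrow> set_integrable lborel {0..T} (\<lambda>x. f x * chr m x)"
  by (rule set_integrable_mult_bounded[where C = 1]) auto

section \<open>Calculus of Fourier coefficients\<close>

lemma coef_add:
  assumes "f \<in> L2_circle T" "g \<in> L2_circle T"
  shows "coef (\<lambda>x. f x + g x) m = coef f m + coef g m"
  unfolding coef_def using set_integrable_mult_chr[OF L2_integrable[OF assms(1)], of "-m"]
    set_integrable_mult_chr[OF L2_integrable[OF assms(2)], of "-m"]
  by (simp add: ring_distribs add_divide_distrib set_integral_add)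

lemma coef_cmult: "coef (\<lambda>x. c * f x) m = c * coef f m"
  unfolding coef_def by (simp add: mult.assoc)

lemma coef_diff:
  assumes "f \<in> L2_circle T" "g \<in> L2_circle T"
  shows "coef (\<lambda>x. f x - g x) m = coef f m - coef g m"
  using coef_add[OF assms(1) L2_cmult[OF assms(2)], of "-1" m] coef_cmult[of "-1" g m] by simp

text \<open>This index shift is how multiplication by the cosine and sine of the profile acts on
  coefficients.\<close>

lemma coef_chr_mult: "coef (\<lambda>x. chr l x * f x) m = coef f (m - l)"
proof -
  have "chr l x * f x * chr (- m) x = f x * chr (- (m - l)) x" for x
    using chr_mult[of l x "-m"] by (simp add: mult_ac)
  then show ?thesis unfolding coef_def by presburger
qed

lemma coef_cong_AE:
  assumes "AE x in lborel. f x = g x" "f \<in> borel_measurable borel" "g \<in> borel_measurable borel"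
  shows "coef f m = coef g m"
proof -
  have "(LINT x:{0..T}|lborel. f x * chr (- m) x) = (LINT x:{0..T}|lborel. g x * chr (- m) x)"
    by (rule set_lebesgue_integral_cong_AE) (use assms in \<open>auto\<close>)
  then show ?thesis by (simp add: coef_def)
qed

lemma has_sum_set_integral_series:
  assumes f: "set_integrable lborel {0..T} f" and a: "abs_summable a"
  shows "((\<lambda>m. a m * (of_real T * coef f (- m))) has_sum (LINT x:{0..T}|lborel. f x * series a x)) UNIV"
  using has_sum_integral_series[OF f[unfolded set_integrable_def] a] T_pos
  by (simp add: coef_def set_lebesgue_integral_def)

lemma integral_chr: "(LINT x:{0..T}|lborel. chr m x) = (if m = 0 then of_real T else 0)"
proof (cases "m = 0")
  case True
  then show ?thesis using T_pos by (simp add: set_lebesgue_integral_def scaleR_conv_of_real)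
next
  case False
  define c where "c = 2 * pi * of_int m / T"
  have c: "c \<noteq> 0" using False T_pos by (simp add: c_def)
  have ch: "chr m = (\<lambda>x. exp (\<i> * of_real c * of_real x))"
    by (auto simp: chr_def c_def cis_conv_exp mult_ac)
  have "(LINT x:{0..T}|lborel. chr m x) = chr m T / (\<i> * of_real c) - chr m 0 / (\<i> * of_real c)"
    unfolding set_lebesgue_integral_def
  proof (rule integral_FTC_atLeastAtMost)
    show "continuous_on {0..T} (chr m)" by (intro continuous_intros)
    show "((\<lambda>x. chr m x / (\<i> * complex_of_real c)) has_vector_derivative chr m x) (at x within {0..T})" for x
      unfolding ch
      by (rule has_vector_derivative_real_field) (use c in \<open>auto intro!: derivative_eq_intros\<close>)
  qed (use T_pos in auto)
  also have "chr m T = chr m 0" using chr_period[of m 0] by simp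
  finally show ?thesis using False by simp
qed

lemma coef_chr: "coef (chr l) m = (if l = m then 1 else 0)"
  using integral_chr[of "l - m"] T_pos by (simp add: coef_def chr_mult)

lemma coef_series:
  assumes "abs_summable a"
  shows "coef (series a) m = a m"
proof -
  have "((\<lambda>l. a l * (of_real T * coef (chr (-m)) (- l))) has_sum (LINT x:{0..T}|lborel. chr (-m) x * series a x)) UNIV"
    by (rule has_sum_set_integral_series[OF L2_integrable[OF L2_chr] assms])
  moreover have "((\<lambda>l. a l * (of_real T * coef (chr (-m)) (- l))) has_sum (a m * of_real T)) UNIV"
    by (rule has_sum_finite_neutralI[of "{m}"]) (auto simp: coef_chr)
  ultimately have "(LINT x:{0..T}|lborel. chr (-m) x * series a x) = a m * of_real T"
    by (rule has_sum_unique)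
  then show ?thesis using T_pos by (simp add: coef_def mult.commute[of "series a _"])
qed

end

section \<open>Bessel's inequality and uniqueness of Fourier coefficients\<close>

context circle begin

lemma cnj_series: "cnj (series a x) = series (\<lambda>m. cnj (a (- m))) x"
proof -
  have "cnj (series a x) = (\<Sum>\<^sub>\<infinity>m. cnj (a m) * chr (- m) x)"
    unfolding series_def infsum_cnj [symmetric] by (simp add: cnj_chr)
  also have "\<dots> = (\<Sum>\<^sub>\<infinity>m. cnj (a (- m)) * chr m x)"
    by (rule infsum_reindex_bij_witness[of _ uminus uminus]) auto
  finally show ?thesis by (simp add: series_def)
qed

lemma abs_summable_reindex_uminus: "abs_summable a \<Longrightarrow> abs_summable (\<lambda>m. cnj (a (- m)))"
  using summable_on_reindex_bij_witness[of UNIV uminus uminus UNIV "\<lambda>m. cmod (a (-m))" "\<lambda>m. cmod (a m)"] by simp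

lemma has_sum_inner_series:
  assumes f: "set_integrable lborel {0..T} f" and a: "abs_summable a"
  shows "((\<lambda>m. cnj (a m) * coef f m) has_sum (LINT x:{0..T}|lborel. f x * cnj (series a x)) / of_real T) UNIV"
proof -
  have "((\<lambda>m. cnj (a (- m)) * (of_real T * coef f (- m))) has_sum (LINT x:{0..T}|lborel. f x * cnj (series a x))) UNIV"
    unfolding cnj_series using f a by (intro has_sum_set_integral_series abs_summable_reindex_uminus)
  then have "((\<lambda>m. cnj (a m) * (of_real T * coef f m)) has_sum (LINT x:{0..T}|lborel. f x * cnj (series a x))) UNIV"
    by (subst has_sum_reindex_bij_witness[of UNIV uminus uminus UNIV]) auto
  from has_sum_cmult_left[OF this, of "1 / of_real T"] show ?thesis
    using T_pos by simp
qed

lemma parseval_series: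
  assumes a: "abs_summable a"
  shows "((\<lambda>m. (cmod (a m))\<^sup>2) has_sum (LINT x:{0..T}|lborel. (cmod (series a x))\<^sup>2) / T) UNIV"
proof -
  have "((\<lambda>m. cnj (a m) * a m) has_sum (LINT x:{0..T}|lborel. series a x * cnj (series a x)) / of_real T) UNIV"
    using has_sum_inner_series[OF L2_integrable[OF L2_series[OF a]] a] coef_series[OF a] by simp
  moreover have "cnj z * z = of_real ((cmod z)\<^sup>2)" "z * cnj z = of_real ((cmod z)\<^sup>2)" for z
    by (simp_all add: complex_norm_square mult.commute del: of_real_power)
  ultimately have "((\<lambda>m. complex_of_real ((cmod (a m))\<^sup>2)) has_sum of_real ((LINT x:{0..T}|lborel. (cmod (series a x))\<^sup>2) / T)) UNIV"
    by (simp only: set_integral_complex_of_real of_real_divide)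
  then show ?thesis by (simp only: has_sum_of_real_iff)
qed

lemma L2_norm_sq_integrable: "f \<in> L2_circle T \<Longrightarrow> set_integrable lborel {0..T} (\<lambda>x. (cmod (f x))\<^sup>2)"
  by (simp add: L2_circle_def)

text \<open>Arbitrary square-integrable data enter the argument through this inequality. Equality is
  used for elements of the operator domain, whose series converge absolutely.\<close>

lemma bessel:
  assumes f: "f \<in> L2_circle T" and X: "finite X"
  shows "(\<Sum>m\<in>X. (cmod (coef f m))\<^sup>2) \<le> (LINT x:{0..T}|lborel. (cmod (f x))\<^sup>2) / T"
proof -
  define a where "a m = (if m \<in> X then coef f m else 0)" for m
  have "(\<lambda>m. cmod (a m)) summable_on X" using X by simp
  then have a: "abs_summable a"
    by (subst summable_on_cong_neutral[of X _ _ "\<lambda>m. cmod (a m)"]) (auto simp: a_def)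
  have fi: "set_integrable lborel {0..T} f" by (rule L2_integrable[OF f])
  have sm[measurable]: "series a \<in> borel_measurable borel" by (rule borel_measurable_series[OF a])
  define S where "S = (\<Sum>m\<in>X. (cmod (coef f m))\<^sup>2)"
  have "((\<lambda>m. cnj (a m) * coef f m) has_sum of_real S) UNIV"
    by (rule has_sum_finite_neutralI[OF X]) (auto simp: a_def S_def complex_norm_square mult.commute simp del: of_real_power)
  from has_sum_unique[OF this has_sum_inner_series[OF fi a]]
  have 1: "(LINT x:{0..T}|lborel. f x * cnj (series a x)) = of_real (T * S)"
    using T_pos by (simp add: field_simps)
  have "((\<lambda>m. (cmod (a m))\<^sup>2) has_sum S) UNIV"
    by (rule has_sum_finite_neutralI[OF X]) (auto simp: a_def S_def)
  from has_sum_unique[OF this parseval_series[OF a]]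
  have 2: "(LINT x:{0..T}|lborel. (cmod (series a x))\<^sup>2) = T * S"
    using T_pos by (simp add: field_simps)
  have i3: "set_integrable lborel {0..T} (\<lambda>x. f x * cnj (series a x))"
    by (rule set_integrable_mult_bounded[OF fi, where C="\<Sum>\<^sub>\<infinity>m. cmod (a m)"]) (use norm_series_le[OF a] in \<open>auto intro!: borel_measurable_continuous_onI continuous_intros continuous_on_series[OF a]\<close>)
  have i4: "set_integrable lborel {0..T} (\<lambda>x. Re (f x * cnj (series a x)))"
    using integrable_Re[OF i3[unfolded set_integrable_def]] by (simp add: set_integrable_def)
  have "Re (LINT x:{0..T}|lborel. f x * cnj (series a x)) = (LINT x:{0..T}|lborel. Re (f x * cnj (series a x)))"
    using integral_Re[OF i3[unfolded set_integrable_def]] by (simp add: set_lebesgue_integral_def)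
  then have 3: "(LINT x:{0..T}|lborel. Re (f x * cnj (series a x))) = T * S" using 1 by simp
  have eq: "(cmod (f x - series a x))\<^sup>2 = (cmod (f x))\<^sup>2 + (cmod (series a x))\<^sup>2 - 2 * Re (f x * cnj (series a x))" for x
    unfolding cmod_power2 by (simp add: power2_eq_square algebra_simps)
  have "0 \<le> (LINT x:{0..T}|lborel. (cmod (f x - series a x))\<^sup>2)"
    unfolding set_lebesgue_integral_def by simp
  also have "\<dots> = (LINT x:{0..T}|lborel. (cmod (f x))\<^sup>2) + (LINT x:{0..T}|lborel. (cmod (series a x))\<^sup>2)
      - 2 * (LINT x:{0..T}|lborel. Re (f x * cnj (series a x)))"
    unfolding eq set_integral_mult_right[symmetric]
    using L2_norm_sq_integrable[OF f] L2_norm_sq_integrable[OF L2_series[OF a]]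
      set_integrable_mult_right[OF i4, of 2]
    by (subst set_integral_diff(2) set_integral_add(2); (intro set_integral_add(1))?; simp only: simp_thms)+
  finally show ?thesis using 2 3 T_pos by (simp add: S_def field_simps)
qed

section \<open>Uniqueness of Fourier coefficients\<close>

text \<open>
  Closed under multiplication by \<open>chr 1\<close> and \<open>chr (- 1)\<close>, hence by polynomials in the real and imaginary
  part of \<open>chr 1\<close>, which is the class to which Stone--Weierstrass applies.
\<close>

definition null_against :: "(real \<Rightarrow> complex) \<Rightarrow> (real \<Rightarrow> complex) \<Rightarrow> bool" where
  "null_against f h \<longleftrightarrow> h \<in> borel_measurable borel \<and> (\<exists>C. \<forall>x. cmod (h x) \<le> C) \<and>
     (\<forall>m. (LINT x:{0..T}|lborel. f x * (h x * chr m x)) = 0)"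

lemma null_against_integrable:
  assumes "set_integrable lborel {0..T} f" "null_against f h"
  shows "set_integrable lborel {0..T} (\<lambda>x. f x * h x)"
  using assms set_integrable_mult_bounded[OF assms(1), of h] by (auto simp: null_against_def)

lemma null_against_add:
  assumes f: "set_integrable lborel {0..T} f" and g: "null_against f g" and h: "null_against f h"
  shows "null_against f (\<lambda>x. g x + h x)"
proof -
  have [measurable]: "g \<in> borel_measurable borel" "h \<in> borel_measurable borel"
    using g h by (auto simp: null_against_def)
  obtain C D where "\<And>x. cmod (g x) \<le> C" "\<And>x. cmod (h x) \<le> D" using g h by (auto simp: null_against_def)
  then have "cmod (g x + h x) \<le> C + D" for x
    by (meson add_mono norm_triangle_le)
  moreover have "(LINT x:{0..T}|lborel. f x * ((g x + h x) * chr m x)) = 0" for m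
  proof -
    have "(LINT x:{0..T}|lborel. f x * ((g x + h x) * chr m x)) =
      (LINT x:{0..T}|lborel. f x * g x * chr m x + f x * h x * chr m x)"
      by (simp add: algebra_simps)
    also have "\<dots> = 0"
      using set_integrable_mult_chr[OF null_against_integrable[OF f g], of m]
        set_integrable_mult_chr[OF null_against_integrable[OF f h], of m] g h
      by (subst set_integral_add) (auto simp: null_against_def mult.assoc)
    finally show ?thesis .
  qed
  ultimately show ?thesis by (auto simp: null_against_def)
qed

lemma null_against_cmult:
  assumes "null_against f h"
  shows "null_against f (\<lambda>x. c * h x)"
proof -
  obtain C where "\<And>x. cmod (h x) \<le> C" using assms by (auto simp: null_against_def)
  then have "cmod (c * h x) \<le> cmod c * C" for x
    by (simp add: norm_mult mult_left_mono)
  moreover have "(LINT x:{0..T}|lborel. f x * (c * h x * chr m x)) = c * (LINT x:{0..T}|lborel. f x * (h x * chr m x))" for m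
    by (subst set_integral_mult_right[symmetric]) (simp add: mult_ac)
  ultimately show ?thesis using assms by (auto simp: null_against_def)
qed

lemma null_against_chr:
  assumes "null_against f h"
  shows "null_against f (\<lambda>x. chr l x * h x)"
proof -
  have [measurable]: "h \<in> borel_measurable borel" using assms by (auto simp: null_against_def)
  have "chr l x * h x * chr m x = h x * chr (l + m) x" for x m
    by (simp add: chr_mult[symmetric] mult_ac)
  then have "(LINT x:{0..T}|lborel. f x * (chr l x * h x * chr m x)) = (LINT x:{0..T}|lborel. f x * (h x * chr (l + m) x))" for m
    by presburger
  then show ?thesis using assms unfolding null_against_def by (auto simp: norm_mult)
qed

lemma null_against_polynomial:
  assumes f: "set_integrable lborel {0..T} f" and "real_polynomial_function p"
  shows "null_against f h \<Longrightarrow> null_against f (\<lambda>x. of_real (p (chr 1 x)) * h x)"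
  using assms(2)
proof (induction arbitrary: h rule: real_polynomial_function.induct)
  case (linear p)
  have p: "p z = Re z * p 1 + Im z * p \<i>" for z
  proof -
    have "p (Re z *\<^sub>R 1 + Im z *\<^sub>R \<i>) = Re z *\<^sub>R p 1 + Im z *\<^sub>R p \<i>"
      by (simp only: linear_add linear_scale bounded_linear.linear[OF linear(1)])
    then show ?thesis by (simp add: scaleR_conv_of_real complex_eq[symmetric] mult.commute)
  qed
  \<comment> \<open>A real-linear functional of z is a combination of z and its conjugate, and on
    the circle conjugation turns \<open>chr 1\<close> into \<open>chr (- 1)\<close>.\<close>
  define c d where "c = (of_real (p 1) - \<i> * of_real (p \<i>)) / 2" and "d = (of_real (p 1) + \<i> * of_real (p \<i>)) / 2"
  have "of_real (p (chr 1 x)) * h x = c * (chr 1 x * h x) + d * (chr (- 1) x * h x)" for x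
  proof -
    have "complex_of_real (p (chr 1 x)) = c * chr 1 x + d * cnj (chr 1 x)"
      unfolding p[of "chr 1 x"] c_def d_def by (simp add: complex_eq_iff field_simps)
    then show ?thesis by (simp add: cnj_chr algebra_simps)
  qed
  then show ?case using linear(2)
    by (simp add: null_against_add[OF f] null_against_cmult null_against_chr)
next
  case (const c)
  then show ?case by (simp add: null_against_cmult)
next
  case (add p q)
  show ?case using null_against_add[OF f add.IH(1)[OF add.prems] add.IH(2)[OF add.prems]]
    by (simp add: algebra_simps)
next
  case (mult p q)
  show ?case using mult.IH(1)[OF mult.IH(2)[OF mult.prems]] by (simp add: mult_ac)
qed

text \<open>By Stone-Weierstrass a polynomial is within \<open>e\<close> of \<open>g\<close> on the
  unit circle. The integral against the polynomial vanishes, so the integral against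
  \<open>g\<close> is at most \<open>e * J\<close>, which the choice of \<open>e\<close> puts
  strictly below its own modulus.\<close>

lemma integral_continuous_zero:
  fixes g :: "complex \<Rightarrow> real"
  assumes f: "set_integrable lborel {0..T} f" and zero: "\<And>m. coef f m = 0" and g: "continuous_on UNIV g"
  shows "(LINT x:{0..T}|lborel. f x * of_real (g (chr 1 x))) = 0"
proof (rule ccontr)
  define I where "I = (LINT x:{0..T}|lborel. f x * of_real (g (chr 1 x)))"
  assume "\<not> ?thesis"
  then have I: "cmod I > 0" by (simp add: I_def)
  define J where "J = (LINT x:{0..T}|lborel. cmod (f x))"
  have J: "J \<ge> 0" by (simp add: J_def set_lebesgue_integral_def)
  define e where "e = cmod I / (J + 1)"
  have e: "e > 0" using I J by (simp add: e_def)
  have gm[measurable]: "g \<in> borel_measurable borel"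
    using g by (rule borel_measurable_continuous_onI)
  have "compact (sphere (0::complex) 1)" by simp
  moreover have "continuous_on (sphere (0::complex) 1) g" using g continuous_on_subset by blast
  ultimately obtain p where p: "real_polynomial_function p" "\<And>z. z \<in> sphere 0 1 \<Longrightarrow> \<bar>g z - p z\<bar> < e"
    using Stone_Weierstrass_real_polynomial_function e by metis
  have pm[measurable]: "p \<in> borel_measurable borel"
    using continuous_on_polymonial_function[of p UNIV] p(1)
    by (intro borel_measurable_continuous_onI) (simp add: real_polynomial_function_eq)
  have "null_against f (\<lambda>x. 1)"
    using zero T_pos by (auto simp: null_against_def coef_def intro!: exI[of _ 1] dest: spec[of _ "- _"]) 
      (metis add.inverse_inverse)
  from null_against_polynomial[OF f p(1) this] have np: "null_against f (\<lambda>x. of_real (p (chr 1 x)))" by simp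
  have ip: "set_integrable lborel {0..T} (\<lambda>x. f x * of_real (p (chr 1 x)))"
    by (rule null_against_integrable[OF f np])
  have "(LINT x:{0..T}|lborel. f x * of_real (p (chr 1 x))) = 0" (is "?P = 0")
    using np[unfolded null_against_def, THEN conjunct2, THEN conjunct2, rule_format, of 0] by simp
  note P0 = this
  have dm: "cmod (complex_of_real (g (chr 1 x) - p (chr 1 x))) \<le> e" for x
    using p(2)[of "chr 1 x"] by (simp add: norm_of_real less_imp_le del: of_real_diff)
  have id: "set_integrable lborel {0..T} (\<lambda>x. f x * of_real (g (chr 1 x) - p (chr 1 x)))"
    by (rule set_integrable_mult_bounded[OF f _ dm]) auto
  have "I = (LINT x:{0..T}|lborel. f x * of_real (p (chr 1 x)) + f x * of_real (g (chr 1 x) - p (chr 1 x)))"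
    unfolding I_def by (simp add: algebra_simps)
  also have "\<dots> = (LINT x:{0..T}|lborel. f x * of_real (p (chr 1 x))) + (LINT x:{0..T}|lborel. f x * of_real (g (chr 1 x) - p (chr 1 x)))"
    by (rule set_integral_add(2)[OF ip id])
  finally have "I = (LINT x:{0..T}|lborel. f x * of_real (p (chr 1 x))) + (LINT x:{0..T}|lborel. f x * of_real (g (chr 1 x) - p (chr 1 x)))" .
  then have "I = (LINT x:{0..T}|lborel. f x * of_real (g (chr 1 x) - p (chr 1 x)))" using P0 by simp
  also have "cmod \<dots> \<le> (LINT x:{0..T}|lborel. e * cmod (f x))"
    unfolding set_lebesgue_integral_def
  proof (rule order_trans[OF integral_norm_bound integral_mono])
    show "integrable lborel (\<lambda>x. norm (indicat_real {0..T} x *\<^sub>R (f x * of_real (g (chr 1 x) - p (chr 1 x)))))"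
      using id unfolding set_integrable_def by (rule integrable_norm)
    have "set_integrable lborel {0..T} (\<lambda>x. e * cmod (f x))"
      using f by (intro set_integrable_mult_right set_integrable_norm)
    then show "integrable lborel (\<lambda>x. indicat_real {0..T} x *\<^sub>R (e * cmod (f x)))"
      by (simp add: set_integrable_def)
    show "norm (indicat_real {0..T} x *\<^sub>R (f x * of_real (g (chr 1 x) - p (chr 1 x))))
       \<le> indicat_real {0..T} x *\<^sub>R (e * cmod (f x))" for x
      using mult_left_mono[OF dm[of x], of "cmod (f x)"] by (simp add: indicator_def norm_mult mult.commute)
  qed
  also have "\<dots> = e * J" by (simp add: J_def)
  also have "\<dots> < cmod I" using I J by (simp add: e_def field_simps)
  finally show False by simp
qed

text \<open>\<open>chr 1\<close> identifies 0 and \<open>T\<close>, so \<open>x\<close> must avoid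
  both endpoints while \<open>y\<close> may be either of them. This is why indicators of intervals
  are recovered only almost everywhere.\<close>

lemma chr_one_eq:
  assumes "chr 1 x = chr 1 y" "0 < x" "x < T" "0 \<le> y" "y \<le> T"
  shows "x = y"
proof -
  have "chr 1 (x - y) = 1"
    using assms(1) by (simp add: chr_diff chr_mult)
  then have "cos (2 * pi * (x - y) / T) = 1" by (simp add: chr_def complex_eq_iff)
  then obtain j :: int where "2 * pi * (x - y) / T = of_int j * (2 * pi)"
    using cos_one_2pi_int by (metis mult.assoc mult.commute)
  then have "(2 * pi) * (x - y) = (2 * pi) * (of_int j * T)" using T_pos by (simp add: field_simps)
  then have j: "x - y = of_int j * T" by (subst (asm) mult_cancel_left) simp
  have "\<bar>x - y\<bar> < T" using assms by auto
  then have "\<bar>of_int j\<bar> * T < 1 * T" using j T_pos by (simp add: abs_mult)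
  then have "\<bar>j\<bar> < 1" using T_pos by simp
  then show ?thesis using j by simp
qed

lemma integral_interval_zero:
  assumes f: "set_integrable lborel {0..T} f" and zero: "\<And>m. coef f m = 0"
  shows "(LINT x:{a..b}|lborel. indicat_real {0..T} x *\<^sub>R f x) = 0"
proof (cases "{a..b} \<inter> {0..T} = {}")
  case True
  then have zero': "indicat_real {a..b} x *\<^sub>R indicat_real {0..T} x *\<^sub>R f x = 0" for x
    by (auto simp: indicator_def)
  show ?thesis unfolding set_lebesgue_integral_def zero' by simp
next
  case False
  define C where "C = chr 1 ` ({a..b} \<inter> {0..T})"
  have "compact ({a..b} \<inter> {0..T})" by (intro compact_Int) auto
  then have C: "compact C" unfolding C_def by (intro compact_continuous_image continuous_intros)
  have C0: "C \<noteq> {}" using False by (auto simp: C_def)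
  \<comment> \<open>Continuous cutoffs decreasing to the indicator of the arc \<open>C\<close>. They
    depend on \<open>x\<close> only through \<open>chr 1 x\<close>, so the integrals of
    \<open>f\<close> against them vanish.\<close>
  define g where "g j z = max 0 (1 - real j * infdist z C)" for j z
  have g: "continuous_on UNIV (g j)" for j unfolding g_def by (intro continuous_intros)
  have gm[measurable]: "g j \<in> borel_measurable borel" for j
    using g by (rule borel_measurable_continuous_onI)
  have lim: "(\<lambda>j. g j z) \<longlonglongrightarrow> indicator C z" for z
  proof (cases "z \<in> C")
    case True
    then have "g j z = 1" for j by (simp add: g_def)
    then show ?thesis using True by simp
  next
    case False
    then have d: "infdist z C > 0"
      using C C0 by (metis compact_imp_closed in_closed_iff_infdist_zero infdist_nonneg less_le)
    obtain N where N: "real N > 1 / infdist z C" using reals_Archimedean2 by blast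
    have "g j z = 0" if "j \<ge> N" for j
    proof -
      have "1 / infdist z C < real j" using N that by linarith
      then have "1 < real j * infdist z C" using d by (simp add: field_simps)
      then show ?thesis by (simp add: g_def)
    qed
    then have "eventually (\<lambda>j. g j z = 0) sequentially" by (auto simp: eventually_sequentially)
    then show ?thesis using False by (simp add: tendsto_eventually)
  qed
  define F where "F x = indicat_real {0..T} x *\<^sub>R f x" for x
  have F: "integrable lborel F" using f by (simp add: F_def[abs_def] set_integrable_def)
  then have Fm[measurable]: "F \<in> borel_measurable borel" by auto
  have "C \<in> sets borel" using C by (simp add: compact_imp_closed borel_closed)
  then have [measurable]: "indicat_real C \<in> borel_measurable borel" by simp
  have "(\<lambda>j. LINT x|lborel. F x * of_real (g j (chr 1 x))) \<longlonglongrightarrow> (LINT x|lborel. F x * of_real (indicat_real C (chr 1 x)))"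
  proof (rule integral_dominated_convergence[where w = "\<lambda>x. cmod (F x)"])
    show "AE x in lborel. (\<lambda>j. F x * of_real (g j (chr 1 x))) \<longlonglongrightarrow> F x * of_real (indicat_real C (chr 1 x))"
      by (intro AE_I2 tendsto_intros lim)
    have "0 \<le> g j z" "g j z \<le> 1" for j z by (auto simp: g_def infdist_nonneg)
    then show "AE x in lborel. norm (F x * of_real (g j (chr 1 x))) \<le> cmod (F x)" for j
      by (intro AE_I2) (auto simp: norm_mult norm_of_real intro!: mult_left_le)
  qed (use F in auto)
  moreover have "(LINT x|lborel. F x * of_real (g j (chr 1 x))) = 0" for j
    using integral_continuous_zero[OF f zero g[of j]] by (simp add: F_def set_lebesgue_integral_def)
  ultimately have "(LINT x|lborel. F x * of_real (indicat_real C (chr 1 x))) = 0"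
    by (simp add: LIMSEQ_const_iff)
  moreover have "(LINT x|lborel. F x * of_real (indicat_real C (chr 1 x))) = (LINT x|lborel. indicat_real {a..b} x *\<^sub>R F x)"
  proof (rule integral_cong_AE)
    have "AE x in lborel. x \<noteq> 0 \<and> x \<noteq> T"
      using AE_lborel_singleton[of 0] AE_lborel_singleton[of T] by eventually_elim auto
    then show "AE x in lborel. F x * of_real (indicat_real C (chr 1 x)) = indicat_real {a..b} x *\<^sub>R F x"
    proof eventually_elim
      case (elim x)
      have "chr 1 x \<in> C \<longleftrightarrow> x \<in> {a..b}" if "x \<in> {0..T}"
        using that elim chr_one_eq[of x] by (fastforce simp: C_def)
      then show ?case by (auto simp: F_def indicator_def)
    qed
  qed auto
  ultimately show ?thesis by (simp add: set_lebesgue_integral_def F_def)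
qed

text \<open>Vanishing integrals over intervals propagate to all Borel sets through complements and
  disjoint unions. Uniqueness of densities, applied to the real and the imaginary part, then leaves
  only the zero function.\<close>

lemma coef_zero_AE:
  assumes f: "set_integrable lborel {0..T} f" and zero: "\<And>m. coef f m = 0"
  shows "AE x in lborel. x \<in> {0..T} \<longrightarrow> f x = 0"
proof -
  define F where "F x = indicat_real {0..T} x *\<^sub>R f x" for x
  have F: "integrable lborel F" using f by (simp add: F_def[abs_def] set_integrable_def)
  have FA: "set_integrable lborel A F" if "A \<in> sets borel" for A
    using integrable_mult_indicator[of A lborel F] F that by (simp add: set_integrable_def)
  have F0: "(LINT x|lborel. F x) = 0"
    using zero[of 0] T_pos by (simp add: coef_def F_def set_lebesgue_integral_def)
  have sets: "(LINT x:A|lborel. F x) = 0" if "A \<in> sets borel" for A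
  proof -
    show ?thesis
      using that
    proof (induction rule: borel_set_induct)
      case (interval a b)
      then show ?case using integral_interval_zero[OF f zero] by (auto simp: F_def)
    next
      case (compl A)
      have A: "A \<in> sets borel" by fact
      have "(LINT x:A \<union> (- A)|lborel. F x) = (LINT x:A|lborel. F x) + (LINT x:- A|lborel. F x)"
        by (rule set_integral_Un) (use A FA in auto)
      then show ?case using compl F0 by (simp add: set_lebesgue_integral_def)
    next
      case (union A)
      have A: "A i \<in> sets borel" for i using union by auto
      have "(LINT x:(\<Union>i. A i)|lborel. F x) = (\<Sum>i. (LINT x:A i|lborel. F x))"
        by (rule lebesgue_integral_countable_add) (use union(1) A FA in \<open>auto simp: disjoint_family_on_def\<close>)
      then show ?case using union by simp
    qed (auto simp: set_lebesgue_integral_def)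
  qed
  have re: "AE x in lborel. Re (F x) = 0"
  proof (rule density_unique_real[where f' = "\<lambda>x. 0"])
    show "(LINT x:A|lborel. Re (F x)) = (LINT x:A|lborel. 0)" if "A \<in> sets lborel" for A
    proof -
      have "Re (LINT x:A|lborel. F x) = (LINT x:A|lborel. Re (F x))"
        using integral_Re[OF FA[of A, unfolded set_integrable_def]] that by (simp add: set_lebesgue_integral_def)
      then show ?thesis using sets[of A] that by simp
    qed
  qed (use F in auto)
  have im: "AE x in lborel. Im (F x) = 0"
  proof (rule density_unique_real[where f' = "\<lambda>x. 0"])
    show "(LINT x:A|lborel. Im (F x)) = (LINT x:A|lborel. 0)" if "A \<in> sets lborel" for A
    proof -
      have "Im (LINT x:A|lborel. F x) = (LINT x:A|lborel. Im (F x))"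
        using integral_Im[OF FA[of A, unfolded set_integrable_def]] that by (simp add: set_lebesgue_integral_def)
      then show ?thesis using sets[of A] that by simp
    qed
  qed (use F in auto)
  from re im show ?thesis by eventually_elim (auto simp: F_def complex_eq_iff)
qed

lemma period_int:
  assumes "\<And>x. f (x + T) = f x"
  shows "f (x + of_int j * T) = f x"
proof (induction j rule: int_induct[where k = 0])
  case (step1 j)
  have "x + of_int (j + 1) * T = (x + of_int j * T) + T" by (simp add: algebra_simps)
  then show ?case using step1 assms by metis
next
  case (step2 j)
  have "x + of_int j * T = (x + of_int (j - 1) * T) + T" by (simp add: algebra_simps)
  then show ?case using step2 assms by metis
qed simp

lemma periodic_AE:
  assumes per: "\<And>x. P (x + T) = P x" and AE: "AE x in lborel. x \<in> {0..T} \<longrightarrow> P x"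
  shows "AE x in lborel. P x"
proof -
  obtain N where N: "N \<in> null_sets lborel" "{x. \<not> (x \<in> {0..T} \<longrightarrow> P x)} \<subseteq> N"
    using AE by (auto simp: eventually_ae_filter)
  have "{x. \<not> P x} \<subseteq> (\<Union>j::int. {x. x - of_int j * T \<in> N})"
  proof
    fix x assume x: "x \<in> {x. \<not> P x}"
    define j where "j = \<lfloor>x / T\<rfloor>"
    define y where "y = x - of_int j * T"
    have "of_int j \<le> x / T" "x / T < of_int j + 1" by (simp_all add: j_def)
    then have "y \<in> {0..T}" using T_pos by (simp add: y_def field_simps)
    moreover have "\<not> P y" using period_int[of P y j, OF per] x by (simp add: y_def)
    ultimately have "y \<in> N" using N by auto
    then show "x \<in> (\<Union>j::int. {x. x - of_int j * T \<in> N})" by (auto simp: y_def)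
  qed
  moreover have "(\<Union>j::int. {x. x - of_int j * T \<in> N}) \<in> null_sets lborel"
    by (intro null_sets_UN null_sets_translation N)
  ultimately show ?thesis by (auto simp: eventually_ae_filter)
qed

theorem coef_unique:
  assumes "f \<in> L2_circle T" "g \<in> L2_circle T" "\<And>m. coef f m = coef g m"
  shows "AE x in lborel. f x = g x"
proof (rule periodic_AE)
  have "AE x in lborel. x \<in> {0..T} \<longrightarrow> f x - g x = 0"
    by (rule coef_zero_AE) (use assms in \<open>auto simp: coef_diff intro!: L2_integrable L2_diff\<close>)
  then show "AE x in lborel. x \<in> {0..T} \<longrightarrow> f x = g x" by eventually_elim auto
qed (use assms in \<open>auto simp: L2_circle_def\<close>)

end

section \<open>Weak derivatives and Fourier coefficients\<close>

lemma summable_on_int_iff: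
  fixes f :: "int \<Rightarrow> real"
  assumes "(\<lambda>n. f (int n)) summable_on UNIV" "(\<lambda>n. f (- int n)) summable_on UNIV"
  shows "f summable_on UNIV"
proof -
  have "f summable_on range int"
    using assms(1) by (subst summable_on_reindex) (auto simp: inj_on_def comp_def)
  moreover have "f summable_on range (\<lambda>n. - int n)"
    using assms(2) by (subst summable_on_reindex) (auto simp: inj_on_def comp_def)
  ultimately have "f summable_on (range int \<union> range (\<lambda>n. - int n))"
    by (rule summable_on_union)
  moreover have "range int \<union> range (\<lambda>n. - int n) = (UNIV :: int set)"
  proof -
    have "m \<in> range int \<union> range (\<lambda>n. - int n)" for m :: int
    proof (cases "m \<ge> 0")
      case True then have "m = int (nat m)" by simp then show ?thesis by blast
    next
      case False then have "m = - int (nat (- m))" by simp then show ?thesis by blast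
    qed
    then show ?thesis by blast
  qed
  ultimately show ?thesis by simp
qed

lemma summable_on_inverse_square_int: "(\<lambda>m::int. 1 / (of_int m)\<^sup>2 :: real) summable_on UNIV"
proof -
  have "summable (\<lambda>n. 1 / (real n)\<^sup>2)"
    using inverse_power_summable[of 2, where 'a = real] by (simp add: inverse_eq_divide)
  then have "(\<lambda>n. 1 / (real n)\<^sup>2) summable_on UNIV"
    by (intro norm_summable_imp_summable_on) auto
  then show ?thesis by (intro summable_on_int_iff) auto
qed

lemma i_mult_i_mult: "\<i> * c * (\<i> * c * z) = - (c\<^sup>2 * z)"
  by (simp add: power2_eq_square complex_eq_iff algebra_simps)

context circle begin

definition freq :: "int \<Rightarrow> real" where "freq m = 2 * pi * of_int m / T"

lemma chr_freq: "chr m x = cis (freq m * x)"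
  by (simp add: chr_def freq_def)

lemma abs_summable_quadratic_decay:
  assumes "\<And>m. (freq m)\<^sup>2 * cmod (a m) \<le> K"
  shows "abs_summable a"
proof -
  define K' where "K' = K * T\<^sup>2 / (2 * pi)\<^sup>2"
  \<comment> \<open>At \<open>m = 0\<close> the hypothesis gives nothing, since
    \<open>freq 0 = 0\<close>, and the first summand is 0 because division by zero yields 0. The
    second summand covers this index.\<close>
  have "cmod (a m) \<le> K' * (1 / (of_int m)\<^sup>2) + (if m = 0 then cmod (a 0) else 0)" for m
  proof (cases "m = 0")
    case False
    have "freq m \<noteq> 0" using False T_pos by (simp add: freq_def)
    then have "cmod (a m) \<le> K / (freq m)\<^sup>2" using assms[of m] by (simp add: field_simps)
    also have "\<dots> = K' * (1 / (of_int m)\<^sup>2)"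
      using T_pos by (simp add: freq_def K'_def power_divide power_mult_distrib)
    finally show ?thesis using False by simp
  qed simp
  moreover have "(\<lambda>m. K' * (1 / (real_of_int m)\<^sup>2) + (if m = 0 then cmod (a 0) else 0)) summable_on UNIV"
  proof (intro summable_on_add summable_on_cmult_right summable_on_inverse_square_int)
    show "(\<lambda>m::int. if m = 0 then cmod (a 0) else 0) summable_on UNIV"
      by (rule finite_nonzero_values_imp_summable_on) auto
  qed
  ultimately show ?thesis
    by (intro summable_on_comparison_test[where g = "\<lambda>m. cmod (a m)"]) auto
qed

lemma norm_coef_le:
  assumes "set_integrable lborel {0..T} f"
  shows "cmod (coef f m) \<le> (LINT x:{0..T}|lborel. cmod (f x)) / T"
proof -
  have "cmod (LINT x:{0..T}|lborel. f x * chr (- m) x) \<le> (LINT x:{0..T}|lborel. cmod (f x * chr (- m) x))"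
    unfolding set_lebesgue_integral_def
    by (rule order_trans[OF integral_norm_bound]) simp
  then show ?thesis using T_pos by (simp add: coef_def norm_divide norm_mult divide_right_mono)
qed

lemma deriv_trig:
  "deriv (\<lambda>x. a * cos (c * x) + b * sin (c * x)) = (\<lambda>x. (b * c) * cos (c * x) + (- a * c) * sin (c * x :: real))"
  by (rule ext, rule DERIV_imp_deriv) (auto intro!: derivative_eq_intros)

lemma smooth_periodic_trig:
  "smooth_periodic T (\<lambda>x. a * cos (freq m * x) + b * sin (freq m * x))"
proof -
  have "chr m (x + T) = chr m x" for x by simp
  then have per: "cos (freq m * (x + T)) = cos (freq m * x)" "sin (freq m * (x + T)) = sin (freq m * x)" for x
    unfolding chr_freq complex_eq_iff by auto
  have "\<exists>a' b'. (deriv ^^ j) (\<lambda>x. a * cos (freq m * x) + b * sin (freq m * x)) =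
    (\<lambda>x. a' * cos (freq m * x) + b' * sin (freq m * x))" for j
  proof (induction j)
    case (Suc j)
    then obtain a' b' where "(deriv ^^ j) (\<lambda>x. a * cos (freq m * x) + b * sin (freq m * x)) =
        (\<lambda>x. a' * cos (freq m * x) + b' * sin (freq m * x))" by blast
    then have "(deriv ^^ Suc j) (\<lambda>x. a * cos (freq m * x) + b * sin (freq m * x)) =
        (\<lambda>x. (b' * freq m) * cos (freq m * x) + (- a' * freq m) * sin (freq m * x))"
      by (simp only: funpow.simps comp_def deriv_trig)
    then show ?case by blast
  qed auto
  moreover have "(\<lambda>x. a' * cos (freq m * x) + b' * sin (freq m * x)) differentiable at x" for a' b' x
    unfolding real_differentiable_def by (rule exI) (auto intro!: derivative_eq_intros)
  ultimately show ?thesis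
    unfolding smooth_periodic_def using per by metis
qed

text \<open>\<open>has_weak_deriv\<close> tests against real functions, so the exponential is split
  into its cosine and its sine, each of which is a smooth periodic test function.\<close>

lemma coef_weak_deriv:
  assumes f: "f \<in> L2_circle T" and g: "g \<in> L2_circle T" and w: "has_weak_deriv T f g"
  shows "coef g m = \<i> * of_real (freq m) * coef f m"
proof -
  define c where "c = freq m"
  have c: "cos (c * x) = 1 * cos (freq m * x) + 0 * sin (freq m * x)"
    "sin (c * x) = 0 * cos (freq m * x) + 1 * sin (freq m * x)" for x by (simp_all add: c_def)
  have "smooth_periodic T (\<lambda>x. cos (c * x))" "smooth_periodic T (\<lambda>x. sin (c * x))"
    unfolding c by (rule smooth_periodic_trig)+
  then have 1: "(LINT x:{0..T}|lborel. f x * of_real (deriv (\<lambda>x. cos (c * x)) x)) = - (LINT x:{0..T}|lborel. g x * of_real (cos (c * x)))"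
    and 2: "(LINT x:{0..T}|lborel. f x * of_real (deriv (\<lambda>x. sin (c * x)) x)) = - (LINT x:{0..T}|lborel. g x * of_real (sin (c * x)))"
    using w unfolding has_weak_deriv_def by blast+
  have d: "deriv (\<lambda>x. cos (c * x)) = (\<lambda>x. - c * sin (c * x))" "deriv (\<lambda>x. sin (c * x)) = (\<lambda>x. c * cos (c * x))"
    using deriv_trig[of 1 c 0] deriv_trig[of 0 c 1] by simp_all
  have cis: "chr (- m) x = of_real (cos (c * x)) - \<i> * of_real (sin (c * x))" for x
    by (simp add: chr_freq freq_def c_def complex_eq_iff)
  have I: "set_integrable lborel {0..T} (\<lambda>x. F x * of_real (cos (c * x)))"
    "set_integrable lborel {0..T} (\<lambda>x. F x * of_real (sin (c * x)))" if "F \<in> L2_circle T" for F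
    by (rule set_integrable_mult_bounded[OF L2_integrable[OF that], of _ 1]; simp add: norm_of_real)+
  have E: "coef F m * of_real T = (LINT x:{0..T}|lborel. F x * of_real (cos (c * x))) - \<i> * (LINT x:{0..T}|lborel. F x * of_real (sin (c * x)))"
    if "F \<in> L2_circle T" for F
  proof -
    have "coef F m * of_real T = (LINT x:{0..T}|lborel. F x * of_real (cos (c * x)) - \<i> * (F x * of_real (sin (c * x))))"
      using T_pos by (simp add: coef_def cis algebra_simps)
    also have "\<dots> = (LINT x:{0..T}|lborel. F x * of_real (cos (c * x))) - (LINT x:{0..T}|lborel. \<i> * (F x * of_real (sin (c * x))))"
      using I[OF that] by (intro set_integral_diff(2) set_integrable_mult_right) auto
    finally show ?thesis by simp
  qed
  have e: "(LINT x:{0..T}|lborel. f x * of_real (- c * sin (c * x))) = of_real (- c) * (LINT x:{0..T}|lborel. f x * of_real (sin (c * x)))"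
    "(LINT x:{0..T}|lborel. f x * of_real (c * cos (c * x))) = of_real c * (LINT x:{0..T}|lborel. f x * of_real (cos (c * x)))"
    unfolding set_integral_mult_right[symmetric] by (simp_all add: mult_ac)
  have 3: "(LINT x:{0..T}|lborel. g x * of_real (cos (c * x))) = of_real c * (LINT x:{0..T}|lborel. f x * of_real (sin (c * x)))"
    "(LINT x:{0..T}|lborel. g x * of_real (sin (c * x))) = - of_real c * (LINT x:{0..T}|lborel. f x * of_real (cos (c * x)))"
    using trans[OF 1[unfolded d, symmetric] e(1)] trans[OF 2[unfolded d, symmetric] e(2)] 
    by (simp_all add: minus_equation_iff[of "LINT x:{0..T}|lborel. g x * of_real (sin (c * x))"])
  have "coef g m * of_real T = \<i> * of_real c * (coef f m * of_real T)"
    unfolding E[OF f] E[OF g] 3 by (simp add: algebra_simps)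
  then show ?thesis using T_pos by (simp add: c_def)
qed

section \<open>Fourier series of smooth test functions\<close>

lemma coef_deriv:
  fixes \<phi> \<psi> :: "real \<Rightarrow> real"
  assumes per: "\<And>x. \<phi> (x + T) = \<phi> x" and d: "\<And>x. (\<phi> has_real_derivative \<psi> x) (at x)"
    and c: "continuous_on UNIV \<psi>"
  shows "coef (\<lambda>x. of_real (\<psi> x)) m = \<i> * of_real (freq m) * coef (\<lambda>x. of_real (\<phi> x)) m"
proof -
  have c\<phi>: "continuous_on UNIV \<phi>" using d DERIV_isCont by (auto simp: continuous_on_eq_continuous_at)
  have ch: "chr l = (\<lambda>x. exp (\<i> * of_real (freq l) * of_real x))" for l
    by (auto simp: chr_freq cis_conv_exp mult_ac)
  have dch: "(chr l has_vector_derivative \<i> * of_real (freq l) * chr l x) (at x within A)" for l x A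
    unfolding ch by (rule has_vector_derivative_real_field) (auto intro!: derivative_eq_intros)
  define P where "P x = of_real (\<phi> x) * chr (- m) x" for x
  define p where "p x = of_real (\<psi> x) * chr (- m) x + (- (\<i> * of_real (freq m))) * (of_real (\<phi> x) * chr (- m) x)" for x
  have fm: "freq (- m) = - freq m" by (simp add: freq_def)
  have "(LINT x|lborel. indicat_real {0..T} x *\<^sub>R p x) = P T - P 0"
  proof (rule integral_FTC_atLeastAtMost)
    show "continuous_on {0..T} p" unfolding p_def
      by (intro continuous_intros continuous_on_subset[OF c] continuous_on_subset[OF c\<phi>]) auto
    have "((\<lambda>x. complex_of_real (\<phi> x)) has_vector_derivative of_real (\<psi> x)) (at x within {0..T})" for x
      using d[of x] by (intro has_vector_derivative_of_real has_vector_derivative_at_within)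
        (simp add: has_real_derivative_iff_has_vector_derivative)
    then show "(P has_vector_derivative p x) (at x within {0..T})" for x
      unfolding P_def p_def
      by (rule has_vector_derivative_eq_rhs[OF has_vector_derivative_mult[OF _ dch]]) (simp add: fm algebra_simps)
  qed (use T_pos in auto)
  also have "P T - P 0 = 0" using per[of 0] chr_period[of "-m" 0] by (simp add: P_def)
  finally have "(LINT x:{0..T}|lborel. p x) = 0" by (simp add: set_lebesgue_integral_def)
  moreover have "set_integrable lborel {0..T} (\<lambda>x. of_real (\<psi> x) * chr (- m) x)"
    "set_integrable lborel {0..T} (\<lambda>x. of_real (\<phi> x) * chr (- m) x)"
    unfolding set_integrable_def
    by (rule borel_integrable_compact, simp, intro continuous_intros continuous_on_subset[OF c] continuous_on_subset[OF c\<phi>]; simp)+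
  then have "(LINT x:{0..T}|lborel. p x) = (LINT x:{0..T}|lborel. of_real (\<psi> x) * chr (- m) x) + (- (\<i> * of_real (freq m))) * (LINT x:{0..T}|lborel. of_real (\<phi> x) * chr (- m) x)"
    unfolding p_def set_integral_mult_right[symmetric] by (intro set_integral_add(2) set_integrable_mult_right) auto
  ultimately have "(LINT x:{0..T}|lborel. of_real (\<psi> x) * chr (- m) x) + (- (\<i> * of_real (freq m))) * (LINT x:{0..T}|lborel. of_real (\<phi> x) * chr (- m) x) = 0"
    by simp
  then show ?thesis by (simp add: coef_def add_eq_0_iff2)
qed

lemma L2_continuous_periodic:
  fixes \<phi> :: "real \<Rightarrow> real"
  assumes per: "\<And>x. \<phi> (x + T) = \<phi> x" and c: "continuous_on UNIV \<phi>"
  shows "(\<lambda>x. complex_of_real (\<phi> x)) \<in> L2_circle T"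
proof -
  have "set_integrable lborel {0..T} (\<lambda>x. (cmod (complex_of_real (\<phi> x)))\<^sup>2)"
    unfolding set_integrable_def
    by (rule borel_integrable_compact) (auto intro!: continuous_intros continuous_on_subset[OF c])
  moreover have "\<phi> \<in> borel_measurable borel" using c by (rule borel_measurable_continuous_onI)
  ultimately show ?thesis using per by (auto simp: L2_circle_def)
qed

lemma smooth_periodic_deriv:
  assumes "smooth_periodic T \<phi>"
  shows "smooth_periodic T (deriv \<phi>)" "(\<phi> has_real_derivative deriv \<phi> x) (at x)" "continuous_on UNIV \<phi>"
proof -
  have per: "\<And>x. \<phi> (x + T) = \<phi> x" and d: "\<And>j x. (deriv ^^ j) \<phi> differentiable (at x)"
    using assms by (auto simp: smooth_periodic_def)
  show D: "(\<phi> has_real_derivative deriv \<phi> x) (at x)" for x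
    using d[of 0 x] by (simp add: DERIV_deriv_iff_real_differentiable)
  show "continuous_on UNIV \<phi>" using D DERIV_isCont by (auto simp: continuous_on_eq_continuous_at)
  have "deriv \<phi> (x + T) = deriv \<phi> x" for x
  proof (rule DERIV_imp_deriv[symmetric, symmetric])
    have "((\<lambda>y. \<phi> (y + T)) has_real_derivative deriv \<phi> x) (at x)" using D[of x] per by simp
    then show "(\<phi> has_real_derivative deriv \<phi> x) (at (x + T))"
      using DERIV_shift[of \<phi> "deriv \<phi> x" x T] by (simp add: add.commute)
  qed
  moreover have "(deriv ^^ j) (deriv \<phi>) differentiable (at x)" for j x
    using d[of "Suc j" x] by (simp add: funpow_swap1)
  ultimately show "smooth_periodic T (deriv \<phi>)" by (auto simp: smooth_periodic_def)
qed

lemma smooth_periodic_L2: "smooth_periodic T \<phi> \<Longrightarrow> (\<lambda>x. complex_of_real (\<phi> x)) \<in> L2_circle T"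
  using smooth_periodic_deriv(3)[of \<phi>] by (auto intro!: L2_continuous_periodic simp: smooth_periodic_def)

lemma smooth_periodic_coef_deriv:
  "smooth_periodic T \<phi> \<Longrightarrow> coef (\<lambda>x. of_real (deriv \<phi> x)) m = \<i> * of_real (freq m) * coef (\<lambda>x. of_real (\<phi> x)) m"
  by (rule coef_deriv) (auto simp: smooth_periodic_deriv, simp add: smooth_periodic_def)

text \<open>The coefficients of the second derivative are bounded, which gives quadratic decay. Test
  functions are thus absolutely convergent series, and pairings with them may be computed
  termwise.\<close>

lemma smooth_periodic_abs_summable:
  assumes "smooth_periodic T \<phi>"
  shows "abs_summable (coef (\<lambda>x. of_real (\<phi> x)))"
proof (rule abs_summable_quadratic_decay)
  fix m
  let ?h = "\<lambda>x. complex_of_real (deriv (deriv \<phi>) x)"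
  have s: "smooth_periodic T (deriv \<phi>)" "smooth_periodic T (deriv (deriv \<phi>))"
    using assms smooth_periodic_deriv(1) by blast+
  have "coef ?h m = - ((of_real (freq m))\<^sup>2 * coef (\<lambda>x. of_real (\<phi> x)) m)"
    by (simp add: smooth_periodic_coef_deriv s assms i_mult_i_mult)
  then have "cmod (coef ?h m) = (freq m)\<^sup>2 * cmod (coef (\<lambda>x. of_real (\<phi> x)) m)"
    by (simp add: norm_mult norm_power)
  then show "(freq m)\<^sup>2 * cmod (coef (\<lambda>x. of_real (\<phi> x)) m) \<le> (LINT x:{0..T}|lborel. cmod (?h x)) / T"
    using norm_coef_le[OF L2_integrable[OF smooth_periodic_L2[OF s(2)]], of m] by simp
qed

lemma has_sum_smooth_periodic:
  assumes f: "f \<in> L2_circle T" and \<phi>: "smooth_periodic T \<phi>"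
  shows "((\<lambda>m. coef (\<lambda>x. of_real (\<phi> x)) m * (of_real T * coef f (- m))) has_sum (LINT x:{0..T}|lborel. f x * of_real (\<phi> x))) UNIV"
proof -
  let ?a = "coef (\<lambda>x. of_real (\<phi> x))"
  have a: "abs_summable ?a" by (rule smooth_periodic_abs_summable[OF \<phi>])
  have [measurable]: "f \<in> borel_measurable borel" "series ?a \<in> borel_measurable borel" "\<phi> \<in> borel_measurable borel"
    using f borel_measurable_series[OF a] smooth_periodic_deriv(3)[OF \<phi>]
    by (auto simp: L2_circle_def intro: borel_measurable_continuous_onI)
  have "AE x in lborel. of_real (\<phi> x) = series ?a x"
    by (rule coef_unique) (auto intro!: smooth_periodic_L2 L2_series a \<phi> simp: coef_series[OF a])
  then have "(LINT x:{0..T}|lborel. f x * series ?a x) = (LINT x:{0..T}|lborel. f x * of_real (\<phi> x))"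
    by (intro set_lebesgue_integral_cong_AE) auto
  then show ?thesis using has_sum_set_integral_series[OF L2_integrable[OF f] a] by simp
qed

text \<open>Converse of \<open>coef_weak_deriv\<close>. Both pairings are expanded in the
  coefficients of the test function, and the minus sign of integration by parts comes from
  \<open>freq (- m) = - freq m\<close>.\<close>

lemma has_weak_deriv_coef:
  assumes f: "f \<in> L2_circle T" and g: "g \<in> L2_circle T"
    and fg: "\<And>m. coef g m = \<i> * of_real (freq m) * coef f m"
  shows "has_weak_deriv T f g"
  unfolding has_weak_deriv_def
proof (intro allI impI)
  fix \<phi> assume \<phi>: "smooth_periodic T \<phi>"
  let ?a = "coef (\<lambda>x. of_real (\<phi> x))"
  have "((\<lambda>m. (\<i> * of_real (freq m) * ?a m) * (of_real T * coef f (- m))) has_sum (LINT x:{0..T}|lborel. f x * of_real (deriv \<phi> x))) UNIV"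
    using has_sum_smooth_periodic[OF f smooth_periodic_deriv(1)[OF \<phi>]] by (simp add: smooth_periodic_coef_deriv[OF \<phi>])
  moreover have "((\<lambda>m. - (?a m * (of_real T * coef g (- m)))) has_sum - (LINT x:{0..T}|lborel. g x * of_real (\<phi> x))) UNIV"
    using has_sum_smooth_periodic[OF g \<phi>] by (subst has_sum_uminus) simp
  moreover have "freq (- m) = - freq m" for m by (simp add: freq_def)
  ultimately show "(LINT x:{0..T}|lborel. f x * of_real (deriv \<phi> x)) = - (LINT x:{0..T}|lborel. g x * of_real (\<phi> x))"
    by (auto intro!: has_sum_unique simp: fg mult_ac)
qed

lemma weak_deriv_props:
  assumes "g \<in> L2_circle T" "has_weak_deriv T f g"
  shows "weak_deriv T f \<in> L2_circle T" "has_weak_deriv T f (weak_deriv T f)"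
  using someI[of "\<lambda>g. g \<in> L2_circle T \<and> has_weak_deriv T f g" g] assms by (auto simp: weak_deriv_def)

lemma sobolev_1_weak_deriv:
  assumes "f \<in> sobolev_circle (Suc 0) T"
  shows "weak_deriv T f \<in> L2_circle T" "coef (weak_deriv T f) m = \<i> * of_real (freq m) * coef f m"
proof -
  obtain g where g: "g \<in> L2_circle T" "has_weak_deriv T f g" using assms by auto
  show "weak_deriv T f \<in> L2_circle T" using weak_deriv_props[OF g] by simp
  show "coef (weak_deriv T f) m = \<i> * of_real (freq m) * coef f m"
    using weak_deriv_props[OF g] assms by (auto intro!: coef_weak_deriv)
qed

lemma sobolev_2_weak_deriv:
  assumes f: "f \<in> sobolev_circle 2 T"
  shows "f \<in> L2_circle T" "weak_deriv T (weak_deriv T f) \<in> L2_circle T"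
    "coef (weak_deriv T (weak_deriv T f)) m = - (of_real (freq m))\<^sup>2 * coef f m"
proof -
  obtain g where g: "g \<in> sobolev_circle (Suc 0) T" "has_weak_deriv T f g" and fL: "f \<in> L2_circle T"
    using f by (auto simp: numeral_2_eq_2)
  then have f1: "f \<in> sobolev_circle (Suc 0) T" by auto
  obtain h where h: "h \<in> L2_circle T" "has_weak_deriv T g h" and gL: "g \<in> L2_circle T" using g by auto
  let ?d = "weak_deriv T f"
  have d: "?d \<in> L2_circle T" "\<And>m. coef ?d m = \<i> * of_real (freq m) * coef f m"
    using sobolev_1_weak_deriv[OF f1] by auto
  \<comment> \<open>The selected \<open>?d\<close> may differ from \<open>g\<close> on a null set.
    It has the same coefficients, which is enough to make \<open>h\<close> a weak derivative of
    \<open>?d\<close> too.\<close>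
  have "has_weak_deriv T ?d h"
    using d(1) h(1) by (rule has_weak_deriv_coef)
      (simp add: coef_weak_deriv[OF gL h] d(2) coef_weak_deriv[OF fL gL g(2)])
  then have d1: "?d \<in> sobolev_circle (Suc 0) T" using d h by auto
  show "f \<in> L2_circle T" by fact
  show "weak_deriv T ?d \<in> L2_circle T" by (rule sobolev_1_weak_deriv[OF d1])
  show "coef (weak_deriv T ?d) m = - (of_real (freq m))\<^sup>2 * coef f m"
    by (simp add: sobolev_1_weak_deriv(2)[OF d1] d(2) i_mult_i_mult)
qed

lemma sobolev_2_series:
  assumes f: "f \<in> sobolev_circle 2 T"
  shows "abs_summable (coef f)" "AE x in lborel. f x = series (coef f) x"
proof -
  let ?h = "weak_deriv T (weak_deriv T f)"
  show a: "abs_summable (coef f)"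
  proof (rule abs_summable_quadratic_decay)
    fix m
    have "cmod (coef ?h m) = (freq m)\<^sup>2 * cmod (coef f m)"
      by (simp add: sobolev_2_weak_deriv(3)[OF f] norm_mult norm_power)
    then show "(freq m)\<^sup>2 * cmod (coef f m) \<le> (LINT x:{0..T}|lborel. cmod (?h x)) / T"
      using norm_coef_le[OF L2_integrable[OF sobolev_2_weak_deriv(2)[OF f]], of m] by simp
  qed
  show "AE x in lborel. f x = series (coef f) x"
    by (rule coef_unique) (auto simp: coef_series[OF a] sobolev_2_weak_deriv(1)[OF f] intro!: L2_series a)
qed

text \<open>For the domain functions to be built, the first derivative is again an absolutely
  convergent series, whereas the second is merely square integrable. A function \<open>h\<close>
  with the right coefficients is therefore taken as an argument.\<close>

lemma series_in_sobolev_2: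
  assumes a: "abs_summable a" and da: "abs_summable (\<lambda>m. \<i> * of_real (freq m) * a m)"
    and h: "h \<in> L2_circle T" "\<And>m. coef h m = - (of_real (freq m))\<^sup>2 * a m"
  shows "series a \<in> sobolev_circle 2 T"
proof -
  let ?g = "series (\<lambda>m. \<i> * of_real (freq m) * a m)"
  have "has_weak_deriv T (series a) ?g"
    by (rule has_weak_deriv_coef) (auto simp: coef_series a da intro!: L2_series)
  moreover have "has_weak_deriv T ?g h"
    by (rule has_weak_deriv_coef) (auto simp: coef_series a da h i_mult_i_mult intro!: L2_series)
  ultimately show ?thesis using L2_series[OF a] L2_series[OF da] h(1)
    unfolding numeral_2_eq_2 sobolev_circle.simps by blast
qed

end

section \<open>Coercivity of the energy in co-rotating coefficients\<close>

text \<open>An injective square system is solvable, by Gaussian elimination with induction on the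
  columns. Rows and columns are arbitrary finite index sets because the Galerkin systems are indexed
  by a window whose size varies.\<close>

lemma finite_linear_system:
  fixes A :: "'i \<Rightarrow> 'j \<Rightarrow> 'a::field"
  assumes "finite C" "finite R" "card R = card C"
    and "\<And>x. (\<And>i. i \<in> R \<Longrightarrow> (\<Sum>j\<in>C. A i j * x j) = 0) \<Longrightarrow> (\<And>j. j \<in> C \<Longrightarrow> x j = 0)"
  shows "\<exists>x. \<forall>i\<in>R. (\<Sum>j\<in>C. A i j * x j) = b i"
  using assms
proof (induction C arbitrary: R A b rule: finite_induct)
  case empty
  then show ?case by simp
next
  case (insert k C)
  have "\<exists>p\<in>R. A p k \<noteq> 0"
  proof (rule ccontr)
    assume "\<not> ?thesis"
    then have z: "A i k = 0" if "i \<in> R" for i using that by blast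
    have "(\<Sum>j\<in>insert k C. A i j * (if j = k then 1 else 0)) = 0" if "i \<in> R" for i
      using z[OF that] insert.hyps by (auto intro!: sum.neutral)
    from insert.prems(3)[OF this, of k] show False by simp
  qed
  then obtain p where p: "p \<in> R" "A p k \<noteq> 0" by blast
  have k: "k \<notin> C" "finite C" by (fact insert.hyps)+
  define A' where "A' i j = A i j - A i k / A p k * A p j" for i j
  have A': "(\<Sum>j\<in>C. A' i j * x j) = (\<Sum>j\<in>C. A i j * x j) - A i k / A p k * (\<Sum>j\<in>C. A p j * x j)" for i x
    by (simp add: A'_def sum_subtractf sum_distrib_left algebra_simps)
  define ext where "ext x t j = (if j = k then t else x j)" for x :: "'j \<Rightarrow> 'a" and t j
  have ext: "(\<Sum>j\<in>insert k C. A i j * ext x t j) = A i k * t + (\<Sum>j\<in>C. A i j * x j)" for i x t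
  proof -
    have "(\<Sum>j\<in>C. A i j * ext x t j) = (\<Sum>j\<in>C. A i j * x j)"
      by (rule sum.cong) (use k in \<open>auto simp: ext_def\<close>)
    then show ?thesis using k by (simp add: ext_def)
  qed
  have "\<exists>x. \<forall>i\<in>R - {p}. (\<Sum>j\<in>C. A' i j * x j) = b i - A i k / A p k * b p"
  proof (rule insert.IH)
    show "finite (R - {p})" "card (R - {p}) = card C"
      using insert.prems(1,2) p k by auto
    fix x j assume x: "\<And>i. i \<in> R - {p} \<Longrightarrow> (\<Sum>j\<in>C. A' i j * x j) = 0" and j: "j \<in> C"
    \<comment> \<open>The value that the pivot row forces on the unknown \<open>k\<close>; with it a
      kernel vector of the reduced system extends to one of the full system.\<close>
    define t where "t = - (\<Sum>j\<in>C. A p j * x j) / A p k"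
    have "(\<Sum>j\<in>insert k C. A i j * ext x t j) = 0" if "i \<in> R" for i
    proof (cases "i = p")
      case True then show ?thesis unfolding ext t_def using p by simp
    next
      case False
      then have "(\<Sum>j\<in>C. A' i j * x j) = 0" using x that by simp
      then show ?thesis unfolding ext t_def A' by simp
    qed
    then have "ext x t j = 0" using insert.prems(3)[of "ext x t" j] j by simp
    moreover have "j \<noteq> k" using j k by auto
    ultimately show "x j = 0" by (simp add: ext_def)
  qed
  then obtain x where x: "\<And>i. i \<in> R - {p} \<Longrightarrow> (\<Sum>j\<in>C. A' i j * x j) = b i - A i k / A p k * b p" by blast
  define t where "t = (b p - (\<Sum>j\<in>C. A p j * x j)) / A p k"
  have "(\<Sum>j\<in>insert k C. A i j * ext x t j) = b i" if "i \<in> R" for i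
  proof (cases "i = p")
    case True then show ?thesis unfolding ext t_def using p by simp
  next
    case False
    then have "(\<Sum>j\<in>C. A' i j * x j) = b i - A i k / A p k * b p" using x that by simp
    then show ?thesis unfolding ext t_def A' by (simp add: diff_divide_distrib algebra_simps)
  qed
  then show ?case by blast
qed

lemma sum_shift_int:
  fixes f :: "int \<Rightarrow> 'a::comm_monoid_add"
  assumes "\<And>m. \<bar>m\<bar> > N \<Longrightarrow> f m = 0" "M \<ge> N + \<bar>j\<bar>"
  shows "(\<Sum>m\<in>{-M..M}. f (m + j)) = (\<Sum>m\<in>{-M..M}. f m)"
proof -
  have "(\<Sum>m\<in>{-M..M}. f (m + j)) = (\<Sum>m\<in>{-M+j..M+j}. f m)"
    by (rule sum.reindex_bij_witness[of _ "\<lambda>m. m - j" "\<lambda>m. m + j"]) auto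
  also have "\<dots> = (\<Sum>m\<in>{-N..N}. f m)"
    by (rule sum.mono_neutral_right) (use assms in auto)
  also have "\<dots> = (\<Sum>m\<in>{-M..M}. f m)"
    by (rule sum.mono_neutral_left) (use assms in auto)
  finally show ?thesis .
qed

lemma norm_add_sq_le: "(norm (a + b))\<^sup>2 \<le> 2 * (norm a)\<^sup>2 + 2 * (norm b :: real)\<^sup>2"
  using power_mono[OF norm_triangle_ineq[of a b], of 2] zero_le_power2[of "norm a - norm b"]
  by (simp add: power2_eq_square algebra_simps)

lemma norm_diff_sq_le: "(norm (a - b))\<^sup>2 \<le> 2 * (norm a)\<^sup>2 + 2 * (norm b :: real)\<^sup>2"
  using norm_add_sq_le[of a "-b"] by simp

text \<open>\<open>\<sigma>\<close> and \<open>- \<delta>\<close> are half the amplitudes of exp(ix)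
  and exp(-ix) in the profile, and \<open>r m\<close> is the multiplier of the kernel at frequency
  m/n. \<open>large\<close> makes the nonlocal term dominate where the kinetic part can be negative;
  \<open>small\<close> lets the coupling through \<open>\<delta>\<close> consume at most half of the
  resulting gap.\<close>

locale linearized =
  fixes n :: int and k \<sigma> \<delta> :: real and r :: "int \<Rightarrow> real"
  assumes n: "n \<ge> 1" and k: "k > 0" and \<sigma>: "\<sigma> > 0" and \<delta>: "\<delta> \<ge> 0"
    and r: "r m \<ge> 0" "r m \<le> 1"
    and large: "\<bar>m\<bar> \<le> 3 * n \<Longrightarrow> 6 * k\<^sup>2 \<le> 4 * r m * \<sigma>\<^sup>2"
    and small: "96 * (of_int n)\<^sup>2 * \<delta>\<^sup>2 \<le> k\<^sup>2"
begin

definition s :: "int \<Rightarrow> real" where "s m = of_int m / of_int n"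
text \<open>\<open>dX\<close> and \<open>dY\<close> are the symbols of \<open>- k\<^sup>2 / 2 * (\<partial>\<^sub>x\<^sup>2 + 1)\<close>, with the frequency shifted by \<open>1\<close> and \<open>- 1\<close>.\<close>

definition dX :: "int \<Rightarrow> real" where "dX m = k\<^sup>2 / 2 * ((s m)\<^sup>2 + 2 * s m)"
definition dY :: "int \<Rightarrow> real" where "dY m = k\<^sup>2 / 2 * ((s m)\<^sup>2 - 2 * s m)"

text \<open>Coefficient of \<open>u\<^sub>\<omega> w + v\<^sub>\<omega> z\<close>; here \<open>sqrt B = 2 * (\<sigma> - \<delta>)\<close> and \<open>sqrt (B + A) = 2 * (\<sigma> + \<delta>)\<close>.\<close>

definition q :: "(int \<Rightarrow> complex) \<Rightarrow> (int \<Rightarrow> complex) \<Rightarrow> int \<Rightarrow> complex" where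
  "q X Y m = of_real \<sigma> * (X m + Y m) - of_real \<delta> * (X (m - 2 * n) + Y (m + 2 * n))"

text \<open>\<open>KX\<close> and \<open>KY\<close> are the two components of the adjoint of
  \<open>q\<close>, applied to \<open>4 * r * q\<close>. They represent the nonlocal term of L: its
  coefficient 2 doubles when the two real components are combined.\<close>

definition KX :: "(int \<Rightarrow> complex) \<Rightarrow> (int \<Rightarrow> complex) \<Rightarrow> int \<Rightarrow> complex" where
  "KX X Y m = 4 * (of_real (\<sigma> * r m) * q X Y m - of_real (\<delta> * r (m + 2 * n)) * q X Y (m + 2 * n))"

definition KY :: "(int \<Rightarrow> complex) \<Rightarrow> (int \<Rightarrow> complex) \<Rightarrow> int \<Rightarrow> complex" where
  "KY X Y m = 4 * (of_real (\<sigma> * r m) * q X Y m - of_real (\<delta> * r (m - 2 * n)) * q X Y (m - 2 * n))"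

text \<open>In co-rotating coefficients J is diagonal: it multiplies the \<open>X\<close> component
  by \<open>- \<i>\<close> and the \<open>Y\<close> component by \<open>\<i>\<close>.\<close>

definition rowX :: "complex \<Rightarrow> (int \<Rightarrow> complex) \<Rightarrow> (int \<Rightarrow> complex) \<Rightarrow> int \<Rightarrow> complex" where
  "rowX \<mu> X Y m = - \<i> * (of_real (dX m) * X m + KX X Y m) - \<mu> * X m"

definition rowY :: "complex \<Rightarrow> (int \<Rightarrow> complex) \<Rightarrow> (int \<Rightarrow> complex) \<Rightarrow> int \<Rightarrow> complex" where
  "rowY \<mu> X Y m = \<i> * (of_real (dY m) * Y m + KY X Y m) - \<mu> * Y m"

definition sq :: "(int \<Rightarrow> complex) \<Rightarrow> (int \<Rightarrow> complex) \<Rightarrow> int \<Rightarrow> real" where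
  "sq X Y m = (cmod (X m))\<^sup>2 + (cmod (Y m))\<^sup>2"

definition energy :: "(int \<Rightarrow> complex) \<Rightarrow> (int \<Rightarrow> complex) \<Rightarrow> int \<Rightarrow> real" where
  "energy X Y m = dX m * (cmod (X m))\<^sup>2 + dY m * (cmod (Y m))\<^sup>2 + 4 * r m * (cmod (q X Y m))\<^sup>2"

lemma sq_nonneg [simp]: "sq X Y m \<ge> 0" by (simp add: sq_def)

text \<open>Moving \<open>q\<close> to the other side of the pairing is a change of summation index
  by 2n. The shifted products are supported within \<open>N + 2 * n\<close>, and the window must
  also contain their translates, hence the bound on \<open>M\<close>.\<close>

lemma energy_identity:
  assumes X: "\<And>m. \<bar>m\<bar> > N \<Longrightarrow> X m = 0" and Y: "\<And>m. \<bar>m\<bar> > N \<Longrightarrow> Y m = 0" and M: "M \<ge> N + 4 * n"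
  shows "(\<Sum>m\<in>{-M..M}. (of_real (dX m) * X m + KX X Y m) * cnj (X m) + (of_real (dY m) * Y m + KY X Y m) * cnj (Y m))
    = of_real (\<Sum>m\<in>{-M..M}. energy X Y m)"
proof -
  define c where "c m = of_real (r m) * q X Y m" for m
  have 1: "(\<Sum>m\<in>{-M..M}. c (m + 2 * n) * cnj (X m)) = (\<Sum>m\<in>{-M..M}. c m * cnj (X (m - 2 * n)))"
    using sum_shift_int[of "N + 2 * n" "\<lambda>m. c m * cnj (X (m - 2 * n))" "2 * n" M] X M n by simp
  have 2: "(\<Sum>m\<in>{-M..M}. c (m - 2 * n) * cnj (Y m)) = (\<Sum>m\<in>{-M..M}. c m * cnj (Y (m + 2 * n)))"
    using sum_shift_int[of "N + 2 * n" "\<lambda>m. c m * cnj (Y (m + 2 * n))" "- (2 * n)" M] Y M n by simp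
  have "(\<Sum>m\<in>{-M..M}. KX X Y m * cnj (X m) + KY X Y m * cnj (Y m))
    = 4 * (of_real \<sigma> * (\<Sum>m\<in>{-M..M}. c m * (cnj (X m) + cnj (Y m)))
       - of_real \<delta> * (\<Sum>m\<in>{-M..M}. c (m + 2 * n) * cnj (X m)) - of_real \<delta> * (\<Sum>m\<in>{-M..M}. c (m - 2 * n) * cnj (Y m)))"
    unfolding sum_distrib_left sum_subtractf[symmetric]
    by (rule sum.cong) (auto simp: KX_def KY_def c_def algebra_simps)
  also have "\<dots> = (\<Sum>m\<in>{-M..M}. 4 * (c m * cnj (q X Y m)))"
    unfolding 1 2 sum_distrib_left sum_subtractf[symmetric]
    by (rule sum.cong) (auto simp: q_def algebra_simps)
  also have "\<dots> = (\<Sum>m\<in>{-M..M}. of_real (4 * r m * (cmod (q X Y m))\<^sup>2))"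
    by (rule sum.cong) (simp_all only: c_def complex_norm_square of_real_mult of_real_numeral mult.assoc)
  finally have K: "(\<Sum>m\<in>{-M..M}. KX X Y m * cnj (X m) + KY X Y m * cnj (Y m)) = (\<Sum>m\<in>{-M..M}. of_real (4 * r m * (cmod (q X Y m))\<^sup>2))" .
  have "(\<Sum>m\<in>{-M..M}. (of_real (dX m) * X m + KX X Y m) * cnj (X m) + (of_real (dY m) * Y m + KY X Y m) * cnj (Y m))
    = (\<Sum>m\<in>{-M..M}. of_real (dX m * (cmod (X m))\<^sup>2 + dY m * (cmod (Y m))\<^sup>2))
      + (\<Sum>m\<in>{-M..M}. KX X Y m * cnj (X m) + KY X Y m * cnj (Y m))"
    unfolding sum.distrib[symmetric]
    by (rule sum.cong) (simp_all only: complex_norm_square of_real_mult of_real_add distrib_right mult.assoc add_ac)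
  then show ?thesis unfolding K by (simp add: energy_def sum.distrib)
qed

text \<open>After removing the factor k^2/2, the direction y = -x contributes 2 t^2 |x|^2 with t =
  m/n, which is at least of order 1/n^2 unless m = 0. At m = 0 that direction is null, so there x =
  y is imposed. The weight is \<open>2 * r m * \<sigma>\<^sup>2\<close>, half of what the energy
  offers; the other half pays for \<open>\<delta>\<close>.\<close>

lemma pointwise_coercive:
  assumes "m \<noteq> 0 \<or> x = y"
  shows "k\<^sup>2 / (6 * (of_int n)\<^sup>2) * ((cmod x)\<^sup>2 + (cmod y)\<^sup>2)
    \<le> dX m * (cmod x)\<^sup>2 + dY m * (cmod y)\<^sup>2 + 2 * r m * \<sigma>\<^sup>2 * (cmod (x + y))\<^sup>2"
proof -
  define P where "P = 4 * r m * \<sigma>\<^sup>2 / k\<^sup>2"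
  define t where "t = s m"
  \<comment> \<open>For m \<noteq> 0 one has t^2 \<ge> 1/n^2 = 3c. The factor 3 pays for |x|^2 +
    |y|^2 \<le> 3 |x|^2 + 2 |g|^2 with g = x + y.\<close>
  define c where "c = 1 / (3 * (of_int n)\<^sup>2 :: real)"
  have n1: "(of_int n)\<^sup>2 \<ge> (1::real)" using n by (simp add: power_mono)
  have c: "c > 0" "c \<le> 1 / 3" using n1 n by (auto simp: c_def field_simps)
  have P: "P \<ge> 0" using r[of m] by (simp add: P_def)
  have main: "c * ((cmod x)\<^sup>2 + (cmod y)\<^sup>2) \<le> (t\<^sup>2 + 2 * t) * (cmod x)\<^sup>2 + (t\<^sup>2 - 2 * t) * (cmod y)\<^sup>2 + P * (cmod (x + y))\<^sup>2"
  proof (cases "\<bar>m\<bar> \<le> 3 * n")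
    case True
    have "4 * r m * \<sigma>\<^sup>2 \<ge> 6 * k\<^sup>2" by (rule large[OF True])
    then have P6: "P \<ge> 6" using k by (simp add: P_def field_simps)
    show ?thesis
    proof (cases "m = 0")
      case True
      then have "x = y" "t = 0" using assms by (auto simp: t_def s_def)
      have "cmod (x + x) = 2 * cmod x" using norm_mult[of 2 x] by (simp flip: mult_2)
      have "c * (2 * (cmod x)\<^sup>2) \<le> 1 * (2 * (cmod x)\<^sup>2)" using c by (intro mult_right_mono) auto
      also have "\<dots> \<le> P * (4 * (cmod x)\<^sup>2)" using P6 by (intro mult_mono) auto
      finally show ?thesis
        using \<open>x = y\<close> \<open>t = 0\<close> \<open>cmod (x + x) = _\<close> by (simp add: power_mult_distrib)
    next
      case False
      have t1: "t\<^sup>2 \<ge> 3 * c"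
      proof -
        have "0 < m\<^sup>2" using False by simp
        then have "1 \<le> m\<^sup>2" by linarith
        then have "(of_int m)\<^sup>2 \<ge> (1::real)" by (metis of_int_1_le_iff of_int_power)
        then show ?thesis using n n1 by (simp add: t_def s_def c_def power_divide divide_right_mono)
      qed
      have "\<bar>t\<bar> \<le> 3"
      proof -
        have "\<bar>real_of_int m\<bar> \<le> 3 * real_of_int n" using True by linarith
        then show ?thesis using n by (simp add: t_def s_def field_simps)
      qed
      show ?thesis
      proof -
        have *: "c * ((cmod x)\<^sup>2 + (cmod y)\<^sup>2) \<le> (u\<^sup>2 + 2 * u) * (cmod x)\<^sup>2 + (u\<^sup>2 - 2 * u) * (cmod y)\<^sup>2 + P * (cmod (x + y))\<^sup>2"
          if u: "u\<^sup>2 \<ge> 3 * c" "0 \<le> u" "u \<le> 3" for u x y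
        proof -
          \<comment> \<open>In the variables \<open>x\<close> and \<open>g\<close> the terms linear
            in \<open>u\<close> cancel in front of |x|^2, leaving 2 u^2, and \<open>P\<close> acts
            on \<open>g\<close> alone. Of the 6 that \<open>P\<close> provides, 1 covers the minimum
            of u^2 - 2u and 4 the cross term, so one |g|^2 is left over.\<close>
          define g where "g = x + y"
          have y: "y = g - x" by (simp add: g_def)
          define R where "R = Re (x * cnj g)"
          have ny: "(cmod y)\<^sup>2 = (cmod g)\<^sup>2 - 2 * R + (cmod x)\<^sup>2"
            unfolding y R_def cmod_power2 by (simp add: power2_eq_square algebra_simps)
          have Rb: "\<bar>R\<bar> \<le> cmod x * cmod g"
            unfolding R_def using abs_Re_le_cmod[of "x * cnj g"] by (simp add: norm_mult)
          have "\<bar>2 * (u\<^sup>2 - 2 * u) * R\<bar> \<le> u\<^sup>2 * (cmod x)\<^sup>2 + 4 * (cmod g)\<^sup>2"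
          proof -
            have u2: "\<bar>u - 2\<bar> \<le> 2" using u by auto
            have "\<bar>2 * (u\<^sup>2 - 2 * u) * R\<bar> = 2 * (u * \<bar>u - 2\<bar>) * \<bar>R\<bar>"
            proof -
              have "2 * (u\<^sup>2 - 2 * u) * R = 2 * (u * (u - 2)) * R" by (simp add: power2_eq_square algebra_simps)
              then have "\<bar>2 * (u\<^sup>2 - 2 * u) * R\<bar> = \<bar>2 * (u * (u - 2)) * R\<bar>" by (rule arg_cong)
              also have "\<dots> = 2 * (u * \<bar>u - 2\<bar>) * \<bar>R\<bar>" using u by (simp add: abs_mult)
              finally show ?thesis .
            qed
            also have "\<dots> \<le> 2 * (u * 2) * (cmod x * cmod g)"
            proof (rule mult_mono[OF _ Rb])
              show "2 * (u * \<bar>u - 2\<bar>) \<le> 2 * (u * 2)"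
                using mult_left_mono[OF u2 u(2)] by linarith
            qed (use u in simp_all)
            also have "\<dots> \<le> u\<^sup>2 * (cmod x)\<^sup>2 + 4 * (cmod g)\<^sup>2"
              using zero_le_power2[of "u * cmod x - 2 * cmod g"] by (simp add: power2_eq_square algebra_simps)
            finally show ?thesis .
          qed
          then have cross: "- (2 * (u\<^sup>2 - 2 * u) * R) \<ge> - (u\<^sup>2 * (cmod x)\<^sup>2) - 4 * (cmod g)\<^sup>2" by linarith
          have "u\<^sup>2 - 2 * u \<ge> - 1" using zero_le_power2[of "u - 1"] by (simp add: power2_eq_square algebra_simps)
          then have gg: "(u\<^sup>2 - 2 * u + P) * (cmod g)\<^sup>2 \<ge> 5 * (cmod g)\<^sup>2"
            using P6 by (intro mult_right_mono) auto
          have xx: "u\<^sup>2 * (cmod x)\<^sup>2 \<ge> 3 * c * (cmod x)\<^sup>2" using u by (intro mult_right_mono) auto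
          have "(u\<^sup>2 + 2 * u) * (cmod x)\<^sup>2 + (u\<^sup>2 - 2 * u) * (cmod y)\<^sup>2 + P * (cmod g)\<^sup>2
            = 2 * (u\<^sup>2 * (cmod x)\<^sup>2) - 2 * (u\<^sup>2 - 2 * u) * R + (u\<^sup>2 - 2 * u + P) * (cmod g)\<^sup>2"
            unfolding ny by (simp add: algebra_simps)
          then have low: "(u\<^sup>2 + 2 * u) * (cmod x)\<^sup>2 + (u\<^sup>2 - 2 * u) * (cmod y)\<^sup>2 + P * (cmod g)\<^sup>2 \<ge> 3 * c * (cmod x)\<^sup>2 + (cmod g)\<^sup>2"
            using cross gg xx by linarith
          have "(cmod y)\<^sup>2 \<le> 2 * (cmod g)\<^sup>2 + 2 * (cmod x)\<^sup>2"
            unfolding y by (rule norm_diff_sq_le)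
          then have "c * (cmod y)\<^sup>2 \<le> c * (2 * (cmod g)\<^sup>2 + 2 * (cmod x)\<^sup>2)" using c by (intro mult_left_mono) auto
          moreover have "c * (2 * (cmod g)\<^sup>2) \<le> 1 * (cmod g)\<^sup>2"
            using c mult_right_mono[of "2 * c" 1 "(cmod g)\<^sup>2"] by simp
          ultimately have "c * ((cmod x)\<^sup>2 + (cmod y)\<^sup>2) \<le> 3 * c * (cmod x)\<^sup>2 + (cmod g)\<^sup>2"
            by (simp only: distrib_left mult.left_commute[of c 2])
          with low show ?thesis unfolding g_def by linarith
        qed
        show ?thesis
        proof (cases "t \<ge> 0")
          case True then show ?thesis using * t1 \<open>\<bar>t\<bar> \<le> 3\<close> by auto
        next
          \<comment> \<open>Changing the sign of \<open>t\<close> exchanges the roles of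
            \<open>x\<close> and \<open>y\<close>.\<close>
          case False
          then have "c * ((cmod y)\<^sup>2 + (cmod x)\<^sup>2) \<le> ((-t)\<^sup>2 + 2 * (-t)) * (cmod y)\<^sup>2 + ((-t)\<^sup>2 - 2 * (-t)) * (cmod x)\<^sup>2 + P * (cmod (y + x))\<^sup>2"
            using t1 \<open>\<bar>t\<bar> \<le> 3\<close> by (intro *) auto
          then show ?thesis by (simp add: add_ac)
        qed
      qed
    qed
  next
    case False
    \<comment> \<open>From |t| \<ge> 3 on, t^2 - 2|t| \<ge> |t| \<ge> 3, so the kinetic part is
      coercive by itself and \<open>P \<ge> 0\<close> suffices.\<close>
    have "\<bar>real_of_int m\<bar> \<ge> 3 * real_of_int n" using False by linarith
    then have t3: "\<bar>t\<bar> \<ge> 3" using n by (simp add: t_def s_def field_simps)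
    then have "t\<^sup>2 \<ge> 3 * \<bar>t\<bar>" using mult_right_mono[of 3 "\<bar>t\<bar>" "\<bar>t\<bar>"] by (simp add: power2_eq_square)
    then have "t\<^sup>2 + 2 * t \<ge> c" "t\<^sup>2 - 2 * t \<ge> c" using t3 c by linarith+
    then have "c * (cmod x)\<^sup>2 \<le> (t\<^sup>2 + 2 * t) * (cmod x)\<^sup>2" "c * (cmod y)\<^sup>2 \<le> (t\<^sup>2 - 2 * t) * (cmod y)\<^sup>2"
      by (intro mult_right_mono; simp)+
    moreover have "0 \<le> P * (cmod (x + y))\<^sup>2" using P by simp
    ultimately show ?thesis unfolding distrib_left by linarith
  qed
  have "k\<^sup>2 / 2 * (c * ((cmod x)\<^sup>2 + (cmod y)\<^sup>2)) \<le> k\<^sup>2 / 2 * ((t\<^sup>2 + 2 * t) * (cmod x)\<^sup>2 + (t\<^sup>2 - 2 * t) * (cmod y)\<^sup>2 + P * (cmod (x + y))\<^sup>2)"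
    by (rule mult_left_mono[OF main]) simp
  moreover have "k\<^sup>2 / 2 * P = 2 * r m * \<sigma>\<^sup>2" using k by (simp add: P_def)
  moreover have "k\<^sup>2 / 2 * ((t\<^sup>2 + 2 * t) * (cmod x)\<^sup>2 + (t\<^sup>2 - 2 * t) * (cmod y)\<^sup>2 + P * (cmod (x + y))\<^sup>2)
      = dX m * (cmod x)\<^sup>2 + dY m * (cmod y)\<^sup>2 + (k\<^sup>2 / 2 * P) * (cmod (x + y))\<^sup>2"
    by (simp add: dX_def dY_def t_def algebra_simps)
  moreover have "k\<^sup>2 / 2 * (c * ((cmod x)\<^sup>2 + (cmod y)\<^sup>2)) = k\<^sup>2 / (6 * (of_int n)\<^sup>2) * ((cmod x)\<^sup>2 + (cmod y)\<^sup>2)"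
    by (simp add: c_def)
  ultimately show ?thesis by simp
qed

text \<open>With q = a - b, |q|^2 \<ge> |a|^2 / 2 - |b|^2: the first term feeds the blocks, the
  second costs 8 \<delta>^2 times squares at shifted indices. Summed over the window, the shifts
  disappear and the cost is at most half of the gap k^2 / (6 n^2).\<close>

lemma energy_coercive:
  assumes X: "\<And>m. \<bar>m\<bar> > N \<Longrightarrow> X m = 0" and Y: "\<And>m. \<bar>m\<bar> > N \<Longrightarrow> Y m = 0" and M: "M \<ge> N + 4 * n"
    and XY0: "X 0 = Y 0"
  shows "k\<^sup>2 / (12 * (of_int n)\<^sup>2) * (\<Sum>m\<in>{-M..M}. sq X Y m) \<le> (\<Sum>m\<in>{-M..M}. energy X Y m)"
proof -
  define h where "h m = (cmod (X (m - 2 * n)))\<^sup>2 + (cmod (Y (m + 2 * n)))\<^sup>2" for m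
  have e: "energy X Y m \<ge> k\<^sup>2 / (6 * (of_int n)\<^sup>2) * sq X Y m - 8 * \<delta>\<^sup>2 * h m" for m
  proof -
    define a where "a = of_real \<sigma> * (X m + Y m)"
    define b where "b = of_real \<delta> * (X (m - 2 * n) + Y (m + 2 * n))"
    have qab: "q X Y m = a - b" by (simp add: q_def a_def b_def)
    have "(cmod a)\<^sup>2 \<le> 2 * (cmod (q X Y m))\<^sup>2 + 2 * (cmod b)\<^sup>2"
      using norm_add_sq_le[of "a - b" b] by (simp add: qab)
    then have "r m * (cmod a)\<^sup>2 \<le> r m * (2 * (cmod (q X Y m))\<^sup>2 + 2 * (cmod b)\<^sup>2)" using r by (intro mult_left_mono)
    moreover have "r m * (cmod b)\<^sup>2 \<le> 1 * (cmod b)\<^sup>2" using r by (intro mult_right_mono) auto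
    moreover have "(cmod b)\<^sup>2 \<le> \<delta>\<^sup>2 * (2 * h m)"
      using norm_add_sq_le[of "X (m - 2 * n)" "Y (m + 2 * n)"]
      by (simp add: b_def norm_mult power_mult_distrib h_def mult_left_mono)
    moreover have "(cmod a)\<^sup>2 = \<sigma>\<^sup>2 * (cmod (X m + Y m))\<^sup>2" by (simp add: a_def norm_mult power_mult_distrib)
    ultimately have "4 * r m * (cmod (q X Y m))\<^sup>2 \<ge> 2 * r m * \<sigma>\<^sup>2 * (cmod (X m + Y m))\<^sup>2 - 8 * \<delta>\<^sup>2 * h m"
      by (simp add: algebra_simps)
    moreover have "m \<noteq> 0 \<or> X m = Y m" using XY0 by auto
    ultimately show ?thesis
      using pointwise_coercive[of m "X m" "Y m"] by (simp add: energy_def sq_def)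
  qed
  have "(\<Sum>m\<in>{-M..M}. h m) = (\<Sum>m\<in>{-M..M}. sq X Y m)"
  proof -
    have "(\<Sum>m\<in>{-M..M}. (cmod (X (m - 2 * n)))\<^sup>2) = (\<Sum>m\<in>{-M..M}. (cmod (X m))\<^sup>2)"
      using sum_shift_int[of N "\<lambda>m. (cmod (X m))\<^sup>2" "- (2 * n)" M] X M n by simp
    moreover have "(\<Sum>m\<in>{-M..M}. (cmod (Y (m + 2 * n)))\<^sup>2) = (\<Sum>m\<in>{-M..M}. (cmod (Y m))\<^sup>2)"
      using sum_shift_int[of N "\<lambda>m. (cmod (Y m))\<^sup>2" "2 * n" M] Y M n by simp
    ultimately show ?thesis by (simp add: h_def sq_def sum.distrib)
  qed
  then have "(\<Sum>m\<in>{-M..M}. k\<^sup>2 / (6 * (of_int n)\<^sup>2) * sq X Y m - 8 * \<delta>\<^sup>2 * h m)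
    = (k\<^sup>2 / (6 * (of_int n)\<^sup>2) - 8 * \<delta>\<^sup>2) * (\<Sum>m\<in>{-M..M}. sq X Y m)"
    by (simp only: sum_subtractf sum_distrib_left[symmetric] left_diff_distrib)
  moreover have "k\<^sup>2 / (12 * (of_int n)\<^sup>2) \<le> k\<^sup>2 / (6 * (of_int n)\<^sup>2) - 8 * \<delta>\<^sup>2"
  proof -
    have "8 * \<delta>\<^sup>2 \<le> k\<^sup>2 / (12 * (of_int n)\<^sup>2)" using small n by (simp add: field_simps)
    moreover have "k\<^sup>2 / (6 * (real_of_int n)\<^sup>2) = 2 * (k\<^sup>2 / (12 * (of_int n)\<^sup>2))" by simp
    ultimately show ?thesis by linarith
  qed
  then have "k\<^sup>2 / (12 * (of_int n)\<^sup>2) * (\<Sum>m\<in>{-M..M}. sq X Y m) \<le> (k\<^sup>2 / (6 * (of_int n)\<^sup>2) - 8 * \<delta>\<^sup>2) * (\<Sum>m\<in>{-M..M}. sq X Y m)"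
    by (intro mult_right_mono sum_nonneg) auto
  moreover have "(\<Sum>m\<in>{-M..M}. k\<^sup>2 / (6 * (of_int n)\<^sup>2) * sq X Y m - 8 * \<delta>\<^sup>2 * h m) \<le> (\<Sum>m\<in>{-M..M}. energy X Y m)"
    by (rule sum_mono[OF e])
  ultimately show ?thesis by linarith
qed

text \<open>The phase mode \<open>(- v\<^sub>\<omega>, u\<^sub>\<omega>)\<close> in co-rotating coefficients, scaled so that \<open>eX 0 - eY 0 = 1\<close>.\<close>

definition eX :: "int \<Rightarrow> complex" where
  "eX m = (if m = 0 then 1 / 2 else if m = - (2 * n) then - of_real (\<delta> / (2 * \<sigma>)) else 0)"
definition eY :: "int \<Rightarrow> complex" where
  "eY m = (if m = 0 then - 1 / 2 else if m = 2 * n then of_real (\<delta> / (2 * \<sigma>)) else 0)"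

text \<open>The phase mode is pointwise orthogonal to the profile: u (-v) + v u = 0. This holds for
  every \<open>\<delta>\<close>, so the perturbation cannot push the zero eigenvalue of L to the
  negative side.\<close>

lemma q_kernel: "q (\<lambda>m. X m - D * eX m) (\<lambda>m. Y m - D * eY m) m = q X Y m"
proof -
  have "q eX eY m = 0"
    using n \<sigma> by (auto simp: q_def eX_def eY_def)
  moreover have "q (\<lambda>m. X m - D * eX m) (\<lambda>m. Y m - D * eY m) m = q X Y m - D * q eX eY m"
    by (simp add: q_def algebra_simps)
  ultimately show ?thesis by simp
qed

text \<open>The phase mode lives where the kinetic symbols vanish: \<open>dX\<close> is zero at 0
  and -2n, \<open>dY\<close> at 0 and 2n. Invisible to \<open>q\<close> as well, it drops out of
  every summand.\<close>

lemma energy_kernel: "energy (\<lambda>m. X m - D * eX m) (\<lambda>m. Y m - D * eY m) m = energy X Y m"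
proof -
  have "dX m * (cmod (X m - D * eX m))\<^sup>2 = dX m * (cmod (X m))\<^sup>2"
    using n by (auto simp: eX_def dX_def s_def)
  moreover have "dY m * (cmod (Y m - D * eY m))\<^sup>2 = dY m * (cmod (Y m))\<^sup>2"
    using n by (auto simp: eY_def dY_def s_def)
  ultimately show ?thesis unfolding energy_def q_kernel by linarith
qed

end

section \<open>A priori bound and Galerkin approximation\<close>

context linearized begin

lemma norm_q_le:
  assumes "\<And>m. cmod (X m) \<le> y" "\<And>m. cmod (Y m) \<le> y"
  shows "cmod (q X Y m) \<le> 2 * (\<sigma> + \<delta>) * y"
proof -
  have "cmod (q X Y m) \<le> \<sigma> * cmod (X m + Y m) + \<delta> * cmod (X (m - 2 * n) + Y (m + 2 * n))"
    unfolding q_def by (rule order_trans[OF norm_triangle_ineq4]) (use \<sigma> \<delta> in \<open>simp add: norm_mult\<close>)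
  also have "\<dots> \<le> \<sigma> * (y + y) + \<delta> * (y + y)"
    by (intro add_mono mult_left_mono order_trans[OF norm_triangle_ineq] assms) (use \<sigma> \<delta> in auto)
  finally show ?thesis by (simp add: algebra_simps)
qed

lemma norm_K_le:
  assumes "\<And>m. cmod (X m) \<le> y" "\<And>m. cmod (Y m) \<le> y"
  shows "cmod (KX X Y m) \<le> 8 * (\<sigma> + \<delta>)\<^sup>2 * y" "cmod (KY X Y m) \<le> 8 * (\<sigma> + \<delta>)\<^sup>2 * y"
proof -
  have K: "cmod (4 * (of_real (\<sigma> * r a) * q X Y a - of_real (\<delta> * r b) * q X Y b)) \<le> 8 * (\<sigma> + \<delta>)\<^sup>2 * y" for a b
  proof -
    have "r a * cmod (q X Y a) \<le> 1 * (2 * (\<sigma> + \<delta>) * y)" "r b * cmod (q X Y b) \<le> 1 * (2 * (\<sigma> + \<delta>) * y)"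
      by (intro mult_mono r norm_q_le assms; simp)+
    then have "\<sigma> * (r a * cmod (q X Y a)) + \<delta> * (r b * cmod (q X Y b)) \<le> \<sigma> * (2 * (\<sigma> + \<delta>) * y) + \<delta> * (2 * (\<sigma> + \<delta>) * y)"
      using \<sigma> \<delta> by (intro add_mono mult_left_mono) auto
    moreover have "cmod (of_real (\<sigma> * r a) * q X Y a - of_real (\<delta> * r b) * q X Y b) \<le> \<sigma> * (r a * cmod (q X Y a)) + \<delta> * (r b * cmod (q X Y b))"
      by (rule order_trans[OF norm_triangle_ineq4]) (use \<sigma> \<delta> r in \<open>simp add: norm_mult abs_mult\<close>)
    moreover have "\<sigma> * (2 * (\<sigma> + \<delta>) * y) + \<delta> * (2 * (\<sigma> + \<delta>) * y) = 2 * (\<sigma> + \<delta>)\<^sup>2 * y"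
      by (simp add: power2_eq_square algebra_simps)
    ultimately have "cmod (of_real (\<sigma> * r a) * q X Y a - of_real (\<delta> * r b) * q X Y b) \<le> 2 * (\<sigma> + \<delta>)\<^sup>2 * y" by linarith
    then show ?thesis unfolding norm_mult[of 4] by (simp add: mult_ac)
  qed
  show "cmod (KX X Y m) \<le> 8 * (\<sigma> + \<delta>)\<^sup>2 * y" "cmod (KY X Y m) \<le> 8 * (\<sigma> + \<delta>)\<^sup>2 * y"
    unfolding KX_def KY_def by (rule K)+
qed

lemma energy_bound:
  assumes X: "\<And>m. \<bar>m\<bar> > N \<Longrightarrow> X m = 0" and Y: "\<And>m. \<bar>m\<bar> > N \<Longrightarrow> Y m = 0" and M: "M \<ge> N + 4 * n" "N \<ge> 0"
    and \<mu>: "Re \<mu> > 0" and t: "t > 0"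
  shows "Re \<mu> * (\<Sum>m\<in>{-M..M}. energy X Y m) \<le> cmod \<mu> * (t * (\<Sum>m\<in>{-N..N}. sq X Y m) + (\<Sum>m\<in>{-N..N}. sq (rowX \<mu> X Y) (rowY \<mu> X Y) m) / t)"
proof -
  define E where "E = (\<Sum>m\<in>{-M..M}. energy X Y m)"
  define A where "A = (\<Sum>m\<in>{-M..M}. (cmod (X m))\<^sup>2 - (cmod (Y m))\<^sup>2)"
  define Q where "Q m = \<i> * rowX \<mu> X Y m * cnj (X m) - \<i> * rowY \<mu> X Y m * cnj (Y m)" for m
  have Qm: "Q m = ((of_real (dX m) * X m + KX X Y m) * cnj (X m) + (of_real (dY m) * Y m + KY X Y m) * cnj (Y m))
    - \<i> * \<mu> * of_real ((cmod (X m))\<^sup>2 - (cmod (Y m))\<^sup>2)" for m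
    unfolding Q_def rowX_def rowY_def of_real_diff complex_norm_square
    by (simp add: algebra_simps)
  have EI: "(\<Sum>m\<in>{-M..M}. (of_real (dX m) * X m + KX X Y m) * cnj (X m) + (of_real (dY m) * Y m + KY X Y m) * cnj (Y m)) = of_real E"
    unfolding E_def by (rule energy_identity[of N]) (use X Y M in auto)
  have QE: "(\<Sum>m\<in>{-M..M}. Q m) = of_real E - \<i> * \<mu> * of_real A"
    unfolding Qm sum_subtractf[of "\<lambda>m. (of_real (dX m) * X m + KX X Y m) * cnj (X m) + (of_real (dY m) * Y m + KY X Y m) * cnj (Y m)"]
      EI sum_distrib_left[symmetric] A_def of_real_sum ..
  \<comment> \<open>Rows outside the truncation are not under control, but each is multiplied by a
    vanishing coefficient of \<open>X\<close> or \<open>Y\<close>.\<close>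
  have QN: "(\<Sum>m\<in>{-M..M}. Q m) = (\<Sum>m\<in>{-N..N}. Q m)"
    by (rule sum.mono_neutral_right) (use M n X Y in \<open>auto simp: Q_def\<close>)
  \<comment> \<open>The indefinite quantity \<open>A\<close> is real, and multiplication by
    \<open>cnj \<mu>\<close> turns its factor into
    \<open>- \<i> * \<bar>\<mu>\<bar>\<^sup>2\<close>. It contributes nothing to the real part, and
    only the energy survives.\<close>
  have "Re (cnj \<mu> * (of_real E - \<i> * \<mu> * of_real A)) = Re \<mu> * E"
    by (simp add: algebra_simps)
  then have "Re \<mu> * E = Re (cnj \<mu> * (\<Sum>m\<in>{-N..N}. Q m))" using QE QN by simp
  also have "\<dots> \<le> cmod (cnj \<mu> * (\<Sum>m\<in>{-N..N}. Q m))" by (rule complex_Re_le_cmod)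
  also have "\<dots> = cmod \<mu> * cmod (\<Sum>m\<in>{-N..N}. Q m)" by (simp add: norm_mult)
  also have "\<dots> \<le> cmod \<mu> * (\<Sum>m\<in>{-N..N}. t * sq X Y m + sq (rowX \<mu> X Y) (rowY \<mu> X Y) m / t)"
  proof (intro mult_left_mono sum_norm_le)
    have am: "a * b \<le> t * b\<^sup>2 + a\<^sup>2 / t" if "a \<ge> 0" "b \<ge> 0" for a b :: real
    proof -
      have "0 \<le> (t * b - a / 2)\<^sup>2 / t + 3 / 4 * a\<^sup>2 / t" using t by (intro add_nonneg_nonneg divide_nonneg_pos) auto
      also have "\<dots> = t * b\<^sup>2 + a\<^sup>2 / t - a * b" using t by (simp add: power2_eq_square field_simps)
      finally show ?thesis by simp
    qed
    show "cmod (Q m) \<le> t * sq X Y m + sq (rowX \<mu> X Y) (rowY \<mu> X Y) m / t" for m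
    proof -
      have "cmod (Q m) \<le> cmod (rowX \<mu> X Y m) * cmod (X m) + cmod (rowY \<mu> X Y m) * cmod (Y m)"
        unfolding Q_def by (rule order_trans[OF norm_triangle_ineq4]) (simp add: norm_mult)
      also have "\<dots> \<le> (t * (cmod (X m))\<^sup>2 + (cmod (rowX \<mu> X Y m))\<^sup>2 / t) + (t * (cmod (Y m))\<^sup>2 + (cmod (rowY \<mu> X Y m))\<^sup>2 / t)"
        by (intro add_mono am) auto
      finally show ?thesis by (simp add: sq_def algebra_simps add_divide_distrib)
    qed
  qed auto
  finally show ?thesis by (simp add: E_def sum.distrib sum_distrib_left sum_divide_distrib)
qed

lemma apriori:
  assumes \<mu>: "Re \<mu> > 0"
  obtains C where "C \<ge> 0" and
    "\<And>N X Y. N \<ge> 2 * n \<Longrightarrow> (\<And>m. \<bar>m\<bar> > N \<Longrightarrow> X m = 0) \<Longrightarrow> (\<And>m. \<bar>m\<bar> > N \<Longrightarrow> Y m = 0) \<Longrightarrow>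
      (\<Sum>m\<in>{-N..N}. sq X Y m) \<le> C * (\<Sum>m\<in>{-N..N}. sq (rowX \<mu> X Y) (rowY \<mu> X Y) m)"
proof -
  define c where "c = k\<^sup>2 / (12 * (of_int n)\<^sup>2)"
  have c: "c > 0" using k n by (simp add: c_def)
  have \<mu>0: "cmod \<mu> > 0" using \<mu> by auto
  define e2 where "e2 = (\<Sum>m\<in>{-(2*n)..2*n}. sq eX eY m)"
  have e2: "e2 \<ge> 0" unfolding e2_def by (rule sum_nonneg) simp
  define H where "H = 16 * (\<sigma> + \<delta>)\<^sup>2"
  \<comment> \<open>These constants come from x2 \<le> a y2 + b f2, where \<open>e2\<close> is the
    squared norm of the phase mode and \<open>H\<close> bounds the nonlocal part of the two rows at
    0. Since y2 \<le> g (t x2 + f2 / t), the choice of \<open>t\<close> makes a g t = 1/2, so that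
    x2 can be absorbed on the left. None of them involves the truncation \<open>N\<close>.\<close>
  define a b where "a = 2 + 4 * e2 * H\<^sup>2 / (cmod \<mu>)\<^sup>2" and "b = 16 * e2 / (cmod \<mu>)\<^sup>2"
  have ab: "a > 0" "b \<ge> 0" using e2 by (auto simp: a_def b_def intro: add_pos_nonneg)
  define g where "g = cmod \<mu> / (Re \<mu> * c)"
  have g: "g > 0" using \<mu> \<mu>0 c by (simp add: g_def)
  define t where "t = 1 / (2 * a * g)"
  have t: "t > 0" using ab g by (simp add: t_def)
  define C where "C = 2 * (a * g / t + b)"
  have "C \<ge> 0" using ab g t by (simp add: C_def)
  moreover have "(\<Sum>m\<in>{-N..N}. sq X Y m) \<le> C * (\<Sum>m\<in>{-N..N}. sq (rowX \<mu> X Y) (rowY \<mu> X Y) m)"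
    if N: "N \<ge> 2 * n" and X: "\<And>m. \<bar>m\<bar> > N \<Longrightarrow> X m = 0" and Y: "\<And>m. \<bar>m\<bar> > N \<Longrightarrow> Y m = 0" for N X Y
  proof -
    \<comment> \<open>Subtracting this multiple of the phase mode makes \<open>X' 0 = Y' 0\<close> without changing the energy.\<close>
    define D where "D = X 0 - Y 0"
    define X' Y' where "X' m = X m - D * eX m" and "Y' m = Y m - D * eY m" for m
    define M where "M = N + 4 * n"
    have N0: "N \<ge> 0" and NM: "N \<le> M" using N n by (auto simp: M_def)
    have X': "X' m = 0" and Y': "Y' m = 0" if "\<bar>m\<bar> > N" for m
      using X[OF that] Y[OF that] that N n by (auto simp: X'_def Y'_def eX_def eY_def)
    have XY0: "X' 0 = Y' 0" by (simp add: X'_def Y'_def eX_def eY_def D_def field_simps)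
    define x2 where "x2 = (\<Sum>m\<in>{-N..N}. sq X Y m)"
    define y2 where "y2 = (\<Sum>m\<in>{-N..N}. sq X' Y' m)"
    define f2 where "f2 = (\<Sum>m\<in>{-N..N}. sq (rowX \<mu> X Y) (rowY \<mu> X Y) m)"
    have nn: "x2 \<ge> 0" "y2 \<ge> 0" "f2 \<ge> 0" by (auto simp: x2_def y2_def f2_def intro: sum_nonneg)
    have "y2 = (\<Sum>m\<in>{-M..M}. sq X' Y' m)" unfolding y2_def
      by (rule sum.mono_neutral_left) (use NM X' Y' in \<open>auto simp: sq_def\<close>)
    then have "c * y2 \<le> (\<Sum>m\<in>{-M..M}. energy X' Y' m)"
      using energy_coercive[of N X' Y' M] X' Y' XY0 by (simp add: M_def c_def)
    also have "\<dots> = (\<Sum>m\<in>{-M..M}. energy X Y m)"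
      unfolding X'_def[abs_def] Y'_def[abs_def] energy_kernel ..
    finally have "Re \<mu> * (c * y2) \<le> Re \<mu> * (\<Sum>m\<in>{-M..M}. energy X Y m)" using \<mu> by (intro mult_left_mono) auto
    also have "\<dots> \<le> cmod \<mu> * (t * x2 + f2 / t)"
      unfolding x2_def f2_def by (rule energy_bound[OF X Y _ N0 \<mu> t]) (auto simp: M_def)
    finally have y2: "y2 \<le> g * (t * x2 + f2 / t)"
      using \<mu> c by (simp add: g_def field_simps)
    have sqle: "sq X' Y' m \<le> y2" for m
    proof (cases "\<bar>m\<bar> > N")
      case True then show ?thesis using X' Y' nn by (simp add: sq_def)
    next
      case False then show ?thesis unfolding y2_def by (intro member_le_sum) auto
    qed
    have bX: "cmod (X' m) \<le> sqrt y2" and bY: "cmod (Y' m) \<le> sqrt y2" for m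
    proof -
      have "(cmod (X' m))\<^sup>2 \<le> y2" "(cmod (Y' m))\<^sup>2 \<le> y2" using sqle[of m] by (auto simp: sq_def intro: order_trans[rotated])
      then show "cmod (X' m) \<le> sqrt y2" "cmod (Y' m) \<le> sqrt y2" by (auto intro: real_le_rsqrt)
    qed
    have KK: "KX X Y 0 = KX X' Y' 0" "KY X Y 0 = KY X' Y' 0"
      unfolding KX_def KY_def X'_def[abs_def] Y'_def[abs_def] q_kernel by simp_all
    have f0: "cmod (rowX \<mu> X Y 0) \<le> sqrt f2" "cmod (rowY \<mu> X Y 0) \<le> sqrt f2"
    proof -
      have "sq (rowX \<mu> X Y) (rowY \<mu> X Y) 0 \<le> f2" unfolding f2_def
        by (rule member_le_sum) (use N0 in auto)
      then have "(cmod (rowX \<mu> X Y 0))\<^sup>2 \<le> f2" "(cmod (rowY \<mu> X Y 0))\<^sup>2 \<le> f2"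
        by (auto simp: sq_def intro: order_trans[rotated])
      then show "cmod (rowX \<mu> X Y 0) \<le> sqrt f2" "cmod (rowY \<mu> X Y 0) \<le> sqrt f2" by (auto intro: real_le_rsqrt)
    qed
    \<comment> \<open>\<open>dX 0 = dY 0 = 0\<close>, so the difference of the two rows at \<open>0\<close> determines \<open>D\<close>.\<close>
    have "\<mu> * D = - \<i> * (KX X Y 0 + KY X Y 0) - (rowX \<mu> X Y 0 - rowY \<mu> X Y 0)"
      by (simp add: rowX_def rowY_def D_def dX_def dY_def s_def algebra_simps)
    also have "cmod \<dots> \<le> (cmod (KX X Y 0) + cmod (KY X Y 0)) + (cmod (rowX \<mu> X Y 0) + cmod (rowY \<mu> X Y 0))"
      by (rule order_trans[OF norm_triangle_ineq4 add_mono])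
        (auto simp: norm_mult intro: order_trans[OF norm_triangle_ineq4] norm_triangle_ineq
          simp del: minus_mult_left mult_minus_left)
    also have "\<dots> \<le> H * sqrt y2 + 2 * sqrt f2"
      using norm_K_le[of X' "sqrt y2" Y' 0, OF bX bY] f0 KK by (simp add: H_def)
    finally have "cmod \<mu> * cmod D \<le> H * sqrt y2 + 2 * sqrt f2" by (simp add: norm_mult)
    then have "(cmod \<mu> * cmod D)\<^sup>2 \<le> (H * sqrt y2 + 2 * sqrt f2)\<^sup>2" by (intro power_mono) auto
    also have "\<dots> \<le> 2 * (H * sqrt y2)\<^sup>2 + 2 * (2 * sqrt f2)\<^sup>2"
      using norm_add_sq_le[of "H * sqrt y2" "2 * sqrt f2"] by simp
    also have "\<dots> = 2 * H\<^sup>2 * y2 + 8 * f2" using nn by (simp add: power_mult_distrib)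
    finally have D2: "(cmod D)\<^sup>2 \<le> (2 * H\<^sup>2 * y2 + 8 * f2) / (cmod \<mu>)\<^sup>2"
      using \<mu>0 by (simp add: power_mult_distrib field_simps)
    have "x2 \<le> (\<Sum>m\<in>{-N..N}. 2 * sq X' Y' m + 2 * (cmod D)\<^sup>2 * sq eX eY m)"
      unfolding x2_def
    proof (rule sum_mono)
      fix m
      have "(cmod (X m))\<^sup>2 \<le> 2 * (cmod (X' m))\<^sup>2 + 2 * (cmod (D * eX m))\<^sup>2"
        using norm_add_sq_le[of "X' m" "D * eX m"] by (simp add: X'_def)
      moreover have "(cmod (Y m))\<^sup>2 \<le> 2 * (cmod (Y' m))\<^sup>2 + 2 * (cmod (D * eY m))\<^sup>2"
        using norm_add_sq_le[of "Y' m" "D * eY m"] by (simp add: Y'_def)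
      ultimately show "sq X Y m \<le> 2 * sq X' Y' m + 2 * (cmod D)\<^sup>2 * sq eX eY m"
        by (simp add: sq_def norm_mult power_mult_distrib algebra_simps)
    qed
    also have "\<dots> = 2 * y2 + 2 * (cmod D)\<^sup>2 * (\<Sum>m\<in>{-N..N}. sq eX eY m)"
      by (simp add: sum.distrib sum_distrib_left y2_def)
    also have "(\<Sum>m\<in>{-N..N}. sq eX eY m) = e2" unfolding e2_def
      by (rule sum.mono_neutral_right) (use N n in \<open>auto simp: sq_def eX_def eY_def\<close>)
    finally have "x2 \<le> 2 * y2 + 2 * (cmod D)\<^sup>2 * e2" .
    also have "\<dots> \<le> 2 * y2 + 2 * ((2 * H\<^sup>2 * y2 + 8 * f2) / (cmod \<mu>)\<^sup>2) * e2"
      using D2 e2 by (intro add_mono mult_right_mono mult_left_mono) auto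
    also have "\<dots> = a * y2 + b * f2" by (simp add: a_def b_def algebra_simps add_divide_distrib)
    also have "\<dots> \<le> a * (g * (t * x2 + f2 / t)) + b * f2"
      using y2 ab by (intro add_mono mult_left_mono) auto
    also have "\<dots> = (a * g * t) * x2 + (a * g / t + b) * f2" by (simp add: algebra_simps)
    also have "a * g * t = 1 / 2" using ab g by (simp add: t_def)
    finally show ?thesis unfolding x2_def[symmetric] f2_def[symmetric] C_def mult.assoc[of 2] by linarith
  qed
  ultimately show thesis using that by blast
qed

section \<open>Galerkin truncations and their limit\<close>

lemma q_lin: "q (\<lambda>m. X m + X' m) (\<lambda>m. Y m + Y' m) m = q X Y m + q X' Y' m"
  "q (\<lambda>m. c * X m) (\<lambda>m. c * Y m) m = c * q X Y m"
  by (simp_all add: q_def algebra_simps)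

lemma K_lin: "KX (\<lambda>m. X m + X' m) (\<lambda>m. Y m + Y' m) m = KX X Y m + KX X' Y' m"
  "KX (\<lambda>m. c * X m) (\<lambda>m. c * Y m) m = c * KX X Y m"
  "KY (\<lambda>m. X m + X' m) (\<lambda>m. Y m + Y' m) m = KY X Y m + KY X' Y' m"
  "KY (\<lambda>m. c * X m) (\<lambda>m. c * Y m) m = c * KY X Y m"
  by (simp_all add: KX_def KY_def q_lin algebra_simps)

text \<open>Packs both components into one family of unknowns, \<open>True\<close> marking
  \<open>X\<close> and \<open>False\<close> marking \<open>Y\<close>, so that a truncation becomes a
  single square system.\<close>

definition row :: "complex \<Rightarrow> (bool \<times> int \<Rightarrow> complex) \<Rightarrow> bool \<times> int \<Rightarrow> complex" where
  "row \<mu> U p = (if fst p then rowX \<mu> (\<lambda>m. U (True, m)) (\<lambda>m. U (False, m)) (snd p)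
                else rowY \<mu> (\<lambda>m. U (True, m)) (\<lambda>m. U (False, m)) (snd p))"

lemma row_lin: "row \<mu> (\<lambda>p. U p + V p) p = row \<mu> U p + row \<mu> V p" "row \<mu> (\<lambda>p. c * U p) p = c * row \<mu> U p"
  by (simp_all add: row_def rowX_def rowY_def K_lin algebra_simps)

lemma row_sum:
  assumes "finite I"
  shows "row \<mu> (\<lambda>p. \<Sum>j\<in>I. c j * u j p) p = (\<Sum>j\<in>I. row \<mu> (u j) p * c j)"
  using assms
proof (induction I rule: finite_induct)
  case empty
  show ?case using row_lin(2)[of \<mu> 0 "\<lambda>p. 0" p] by simp
next
  case (insert i I)
  then show ?case by (simp add: row_lin mult.commute)
qed

text \<open>The truncated system has as many rows as unknowns, and the bound \<open>C\<close> makes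
  its kernel trivial, so every right-hand side is attained.\<close>

lemma galerkin:
  assumes C: "\<And>X Y. (\<And>m. \<bar>m\<bar> > N \<Longrightarrow> X m = 0) \<Longrightarrow> (\<And>m. \<bar>m\<bar> > N \<Longrightarrow> Y m = 0) \<Longrightarrow>
      (\<Sum>m\<in>{-N..N}. sq X Y m) \<le> C * (\<Sum>m\<in>{-N..N}. sq (rowX \<mu> X Y) (rowY \<mu> X Y) m)"
  obtains X Y where "\<And>m. \<bar>m\<bar> > N \<Longrightarrow> X m = 0" "\<And>m. \<bar>m\<bar> > N \<Longrightarrow> Y m = 0"
    "\<And>m. \<bar>m\<bar> \<le> N \<Longrightarrow> rowX \<mu> X Y m = F m" "\<And>m. \<bar>m\<bar> \<le> N \<Longrightarrow> rowY \<mu> X Y m = G m"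
proof -
  define I where "I = (UNIV :: bool set) \<times> {-N..N}"
  have I: "finite I" by (simp add: I_def)
  define u where "u j p = (if p = j then 1 else 0 :: complex)" for j p :: "bool \<times> int"
  define ext where "ext x p = (\<Sum>j\<in>I. x j * u j p)" for x :: "bool \<times> int \<Rightarrow> complex" and p
  have ext: "ext x p = (if p \<in> I then x p else 0)" for x p
  proof -
    have "ext x p = (\<Sum>j\<in>I. if p = j then x j else 0)" unfolding ext_def u_def by (rule sum.cong) auto
    then show ?thesis using I by simp
  qed
  have rext: "row \<mu> (ext x) p = (\<Sum>j\<in>I. row \<mu> (u j) p * x j)" for x p
    unfolding ext_def by (rule row_sum[OF I])
  have "\<exists>x. \<forall>i\<in>I. (\<Sum>j\<in>I. row \<mu> (u j) i * x j) = (if fst i then F (snd i) else G (snd i))"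
  proof (rule finite_linear_system[OF I I refl])
    fix x j assume x: "\<And>i. i \<in> I \<Longrightarrow> (\<Sum>j\<in>I. row \<mu> (u j) i * x j) = 0" and j: "j \<in> I"
    define X Y where "X m = ext x (True, m)" and "Y m = ext x (False, m)" for m
    have "rowX \<mu> X Y m = 0 \<and> rowY \<mu> X Y m = 0" if "m \<in> {-N..N}" for m
      using x[of "(True, m)", folded rext] x[of "(False, m)", folded rext] that
      by (simp add: row_def X_def[abs_def] Y_def[abs_def] I_def)
    then have "(\<Sum>m\<in>{-N..N}. sq (rowX \<mu> X Y) (rowY \<mu> X Y) m) = 0" by (intro sum.neutral) (auto simp: sq_def)
    moreover have "X m = 0" "Y m = 0" if "\<bar>m\<bar> > N" for m using that by (auto simp: X_def Y_def ext I_def)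
    ultimately have "(\<Sum>m\<in>{-N..N}. sq X Y m) \<le> 0" using C[of X Y] by auto
    then have "(\<Sum>m\<in>{-N..N}. sq X Y m) = 0" by (intro antisym sum_nonneg) auto
    then have "sq X Y m = 0" if "m \<in> {-N..N}" for m
      using that by (subst (asm) sum_nonneg_eq_0_iff) auto
    then have XY: "X m = 0 \<and> Y m = 0" if "m \<in> {-N..N}" for m
      using that by (auto simp: sq_def add_nonneg_eq_0_iff)
    show "x j = 0"
      using XY[of "snd j"] j by (cases j) (auto simp: X_def Y_def ext I_def split: if_splits, (metis (full_types))+)
  qed
  then obtain x where x: "\<And>i. i \<in> I \<Longrightarrow> row \<mu> (ext x) i = (if fst i then F (snd i) else G (snd i))"
    unfolding rext by blast
  define X Y where "X m = ext x (True, m)" and "Y m = ext x (False, m)" for m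
  show thesis
  proof (rule that[of X Y])
    show "X m = 0" "Y m = 0" if "\<bar>m\<bar> > N" for m using that by (auto simp: X_def Y_def ext I_def)
    show "rowX \<mu> X Y m = F m" "rowY \<mu> X Y m = G m" if "\<bar>m\<bar> \<le> N" for m
      using x[of "(True, m)"] x[of "(False, m)"] that
      by (auto simp: row_def X_def[abs_def] Y_def[abs_def] I_def abs_le_iff minus_le_iff)
  qed
qed

text \<open>Each row involves finitely many coordinates. Uniform bounds therefore give a diagonal
  subsequence converging in every coordinate, along which every fixed row is eventually exact, and
  bounds on finite partial sums survive in the limit.\<close>

theorem solve_rows:
  assumes \<mu>: "Re \<mu> > 0" and FG: "\<And>A. finite A \<Longrightarrow> (\<Sum>m\<in>A. sq F G m) \<le> K"
  obtains X Y K' where "\<And>m. rowX \<mu> X Y m = F m" "\<And>m. rowY \<mu> X Y m = G m"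
    "\<And>A. finite A \<Longrightarrow> (\<Sum>m\<in>A. sq X Y m) \<le> K'"
proof -
  obtain C where C: "C \<ge> 0" "\<And>N X Y. N \<ge> 2 * n \<Longrightarrow> (\<And>m. \<bar>m\<bar> > N \<Longrightarrow> X m = 0) \<Longrightarrow> (\<And>m. \<bar>m\<bar> > N \<Longrightarrow> Y m = 0) \<Longrightarrow>
      (\<Sum>m\<in>{-N..N}. sq X Y m) \<le> C * (\<Sum>m\<in>{-N..N}. sq (rowX \<mu> X Y) (rowY \<mu> X Y) m)"
    by (rule apriori[OF \<mu>]) blast
  define NN where "NN j = 2 * n + int j" for j
  have "\<exists>X Y. (\<forall>m. \<bar>m\<bar> > NN j \<longrightarrow> X m = 0 \<and> Y m = 0) \<and> (\<forall>m. \<bar>m\<bar> \<le> NN j \<longrightarrow> rowX \<mu> X Y m = F m \<and> rowY \<mu> X Y m = G m)" for j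
  proof -
    obtain X Y where "\<And>m. \<bar>m\<bar> > NN j \<Longrightarrow> X m = 0" "\<And>m. \<bar>m\<bar> > NN j \<Longrightarrow> Y m = 0"
      "\<And>m. \<bar>m\<bar> \<le> NN j \<Longrightarrow> rowX \<mu> X Y m = F m" "\<And>m. \<bar>m\<bar> \<le> NN j \<Longrightarrow> rowY \<mu> X Y m = G m"
      by (rule galerkin[where N="NN j" and \<mu> = \<mu> and F = F and G = G and C = C]) (use C(2)[of "NN j"] in \<open>auto simp: NN_def\<close>)
    then show ?thesis by blast
  qed
  then obtain XX YY where XY0: "\<And>j m. \<bar>m\<bar> > NN j \<Longrightarrow> XX j m = 0 \<and> YY j m = 0"
    and XYr: "\<And>j m. \<bar>m\<bar> \<le> NN j \<Longrightarrow> rowX \<mu> (XX j) (YY j) m = F m \<and> rowY \<mu> (XX j) (YY j) m = G m"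
    by metis
  have bd: "(\<Sum>m\<in>A. sq (XX j) (YY j) m) \<le> C * K" if "finite A" for A j
  proof -
    have "(\<Sum>m\<in>A. sq (XX j) (YY j) m) \<le> (\<Sum>m\<in>{-NN j..NN j}. sq (XX j) (YY j) m)"
    proof -
      have "(\<Sum>m\<in>A. sq (XX j) (YY j) m) = (\<Sum>m\<in>A \<inter> {-NN j..NN j}. sq (XX j) (YY j) m)"
        by (rule sum.mono_neutral_right) (use that XY0 in \<open>auto simp: sq_def abs_if\<close>)
      also have "\<dots> \<le> (\<Sum>m\<in>{-NN j..NN j}. sq (XX j) (YY j) m)" by (rule sum_mono2) auto
      finally show ?thesis .
    qed
    also have "\<dots> \<le> C * (\<Sum>m\<in>{-NN j..NN j}. sq (rowX \<mu> (XX j) (YY j)) (rowY \<mu> (XX j) (YY j)) m)"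
      by (rule C(2)) (use XY0 in \<open>auto simp: NN_def\<close>)
    also have "(\<Sum>m\<in>{-NN j..NN j}. sq (rowX \<mu> (XX j) (YY j)) (rowY \<mu> (XX j) (YY j)) m) = (\<Sum>m\<in>{-NN j..NN j}. sq F G m)"
      by (rule sum.cong) (use XYr in \<open>auto simp: sq_def abs_le_iff\<close>)
    also have "C * \<dots> \<le> C * K" using FG C(1) by (intro mult_left_mono) auto
    finally show ?thesis .
  qed
  define f where "f j p = (if fst p then XX j (snd p) else YY j (snd p))" for j and p :: "bool \<times> int"
  have "norm (f j p) \<le> sqrt (C * K)" for j p
  proof -
    have "sq (XX j) (YY j) (snd p) \<le> C * K" using bd[of "{snd p}" j] by simp
    then have "(cmod (XX j (snd p)))\<^sup>2 \<le> C * K" "(cmod (YY j (snd p)))\<^sup>2 \<le> C * K"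
      by (auto simp: sq_def intro: order_trans[rotated])
    then show ?thesis by (auto simp: f_def intro: real_le_rsqrt)
  qed
  then obtain \<kappa> :: "nat \<Rightarrow> nat" where \<kappa>: "strict_mono \<kappa>" "\<And>p. \<exists>l. (\<lambda>j. f (\<kappa> j) p) \<longlonglongrightarrow> l"
    using function_convergent_subsequence[of "UNIV :: (bool \<times> int) set" f "sqrt (C * K)"] by (metis UNIV_I countableI_type)
  then obtain l where l: "\<And>p. (\<lambda>j. f (\<kappa> j) p) \<longlonglongrightarrow> l p" by metis
  define X Y where "X m = l (True, m)" and "Y m = l (False, m)" for m
  have lim: "(\<lambda>j. XX (\<kappa> j) m) \<longlonglongrightarrow> X m" "(\<lambda>j. YY (\<kappa> j) m) \<longlonglongrightarrow> Y m" for m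
    using l[of "(True, m)"] l[of "(False, m)"] by (auto simp: f_def X_def Y_def)
  have ev: "eventually (\<lambda>j. \<bar>m\<bar> \<le> NN (\<kappa> j)) sequentially" for m
    using eventually_ge_at_top[of "nat \<bar>m\<bar>"]
  proof eventually_elim
    case (elim j)
    have "j \<le> \<kappa> j" by (rule seq_suble[OF \<kappa>(1)])
    then show ?case using elim n by (simp add: NN_def)
  qed
  show thesis
  proof (rule that[of X Y "C * K"])
    fix m
    have qlim: "(\<lambda>j. q (XX (\<kappa> j)) (YY (\<kappa> j)) m) \<longlonglongrightarrow> q X Y m" for m
      unfolding q_def by (intro tendsto_intros lim)
    have "(\<lambda>j. rowX \<mu> (XX (\<kappa> j)) (YY (\<kappa> j)) m) \<longlonglongrightarrow> rowX \<mu> X Y m"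
      unfolding rowX_def KX_def by (intro tendsto_intros lim qlim)
    moreover have "(\<lambda>j. rowX \<mu> (XX (\<kappa> j)) (YY (\<kappa> j)) m) \<longlonglongrightarrow> F m"
      by (rule tendsto_eventually, rule eventually_mono[OF ev[of m]]) (use XYr in blast)
    ultimately show "rowX \<mu> X Y m = F m" by (rule LIMSEQ_unique)
    have "(\<lambda>j. rowY \<mu> (XX (\<kappa> j)) (YY (\<kappa> j)) m) \<longlonglongrightarrow> rowY \<mu> X Y m"
      unfolding rowY_def KY_def by (intro tendsto_intros lim qlim)
    moreover have "(\<lambda>j. rowY \<mu> (XX (\<kappa> j)) (YY (\<kappa> j)) m) \<longlonglongrightarrow> G m"
      by (rule tendsto_eventually, rule eventually_mono[OF ev[of m]]) (use XYr in blast)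
    ultimately show "rowY \<mu> X Y m = G m" by (rule LIMSEQ_unique)
  next
    fix A :: "int set" assume A: "finite A"
    have "(\<lambda>j. \<Sum>m\<in>A. sq (XX (\<kappa> j)) (YY (\<kappa> j)) m) \<longlonglongrightarrow> (\<Sum>m\<in>A. sq X Y m)"
      unfolding sq_def by (intro tendsto_intros lim)
    then show "(\<Sum>m\<in>A. sq X Y m) \<le> C * K"
      by (rule LIMSEQ_le_const2) (use bd[OF A] in auto)
  qed
qed

end

section \<open>The bound for square-summable sequences\<close>

lemma tendsto_symmetric_sums:
  fixes g :: "int \<Rightarrow> real"
  assumes "g summable_on UNIV"
  shows "(\<lambda>j. \<Sum>m\<in>{-int j..int j}. g m) \<longlonglongrightarrow> infsum g UNIV"
proof -
  have "filterlim (\<lambda>j. {-int j..int j}) (finite_subsets_at_top UNIV) sequentially"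
    unfolding filterlim_finite_subsets_at_top
  proof safe
    fix X :: "int set" assume X: "finite X"
    define b where "b = (\<Sum>x\<in>X. \<bar>x\<bar>)"
    have b: "\<bar>x\<bar> \<le> b" if "x \<in> X" for x
      unfolding b_def by (rule member_le_sum) (use that X in auto)
    show "\<forall>\<^sub>F j in sequentially. finite {-int j..int j} \<and> X \<subseteq> {-int j..int j} \<and> {-int j..int j} \<subseteq> UNIV"
      using eventually_ge_at_top[of "nat b"]
    proof eventually_elim
      case (elim j)
      then show ?case using b by (force simp: abs_le_iff)
    qed
  qed
  moreover have "(sum g \<longlongrightarrow> infsum g UNIV) (finite_subsets_at_top UNIV)"
    using has_sum_infsum[OF assms] by (simp add: has_sum_def)
  ultimately show ?thesis by (rule filterlim_compose[rotated])
qed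

context linearized begin

lemma norm_q_sq_le:
  "(cmod (q X Y m))\<^sup>2 \<le> 4 * (\<sigma> + \<delta>)\<^sup>2 * (sq X Y m + sq X Y (m - 2 * n) + sq X Y (m + 2 * n))"
proof -
  have \<rho>: "\<sigma>\<^sup>2 \<le> (\<sigma> + \<delta>)\<^sup>2" "\<delta>\<^sup>2 \<le> (\<sigma> + \<delta>)\<^sup>2" using \<sigma> \<delta> by (auto intro!: power_mono)
  have "(cmod (q X Y m))\<^sup>2 \<le> 2 * (\<sigma>\<^sup>2 * (cmod (X m + Y m))\<^sup>2) + 2 * (\<delta>\<^sup>2 * (cmod (X (m - 2 * n) + Y (m + 2 * n)))\<^sup>2)"
    unfolding q_def by (rule order_trans[OF norm_diff_sq_le]) (simp add: norm_mult power_mult_distrib)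
  also have "\<dots> \<le> 2 * ((\<sigma> + \<delta>)\<^sup>2 * (2 * (cmod (X m))\<^sup>2 + 2 * (cmod (Y m))\<^sup>2))
      + 2 * ((\<sigma> + \<delta>)\<^sup>2 * (2 * (cmod (X (m - 2 * n)))\<^sup>2 + 2 * (cmod (Y (m + 2 * n)))\<^sup>2))"
    by (intro add_mono mult_left_mono mult_mono norm_add_sq_le \<rho>) auto
  also have "\<dots> = 4 * (\<sigma> + \<delta>)\<^sup>2 * (sq X Y m + (cmod (X (m - 2 * n)))\<^sup>2 + (cmod (Y (m + 2 * n)))\<^sup>2)"
    by (simp add: sq_def algebra_simps)
  also have "\<dots> \<le> 4 * (\<sigma> + \<delta>)\<^sup>2 * (sq X Y m + sq X Y (m - 2 * n) + sq X Y (m + 2 * n))"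
    by (intro mult_left_mono add_mono) (auto simp: sq_def)
  finally show ?thesis .
qed

lemma sum_norm_q_sq_le:
  assumes t: "\<And>A. finite A \<Longrightarrow> (\<Sum>m\<in>A. sq X Y m) \<le> \<tau>" and A: "finite A"
  shows "(\<Sum>m\<in>A. (cmod (q X Y (m + j)))\<^sup>2) \<le> 12 * (\<sigma> + \<delta>)\<^sup>2 * \<tau>"
proof -
  have sh: "(\<Sum>m\<in>A. sq X Y (m + i)) \<le> \<tau>" for i
  proof -
    have "(\<Sum>m\<in>A. sq X Y (m + i)) = (\<Sum>m\<in>(\<lambda>m. m + i) ` A. sq X Y m)"
      by (subst sum.reindex) (auto simp: inj_on_def)
    also have "\<dots> \<le> \<tau>" using A by (intro t) auto
    finally show ?thesis .
  qed
  have "(\<Sum>m\<in>A. (cmod (q X Y (m + j)))\<^sup>2) \<le> (\<Sum>m\<in>A. 4 * (\<sigma> + \<delta>)\<^sup>2 * (sq X Y (m + j) + sq X Y (m + (j - 2 * n)) + sq X Y (m + (j + 2 * n))))"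
  proof (rule sum_mono)
    show "(cmod (q X Y (m + j)))\<^sup>2 \<le> 4 * (\<sigma> + \<delta>)\<^sup>2 * (sq X Y (m + j) + sq X Y (m + (j - 2 * n)) + sq X Y (m + (j + 2 * n)))" for m
      using norm_q_sq_le[of X Y "m + j"] by (simp only: add_diff_eq add.assoc)
  qed
  also have "\<dots> = 4 * (\<sigma> + \<delta>)\<^sup>2 * ((\<Sum>m\<in>A. sq X Y (m + j)) + (\<Sum>m\<in>A. sq X Y (m + (j - 2 * n))) + (\<Sum>m\<in>A. sq X Y (m + (j + 2 * n))))"
    by (simp only: sum.distrib sum_distrib_left distrib_left)
  also have "\<dots> \<le> 4 * (\<sigma> + \<delta>)\<^sup>2 * (\<tau> + \<tau> + \<tau>)" by (intro mult_left_mono add_mono sh) auto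
  finally show ?thesis by simp
qed

text \<open>Each sum of |q|^2 costs \<open>12 * (\<sigma> + \<delta>)\<^sup>2 * \<tau>\<close>, and
  four such sums enter with weight \<open>32 * (\<sigma> + \<delta>)\<^sup>2\<close>, which makes
  1536.\<close>

lemma sum_norm_K_sq_le:
  assumes t: "\<And>A. finite A \<Longrightarrow> (\<Sum>m\<in>A. sq X Y m) \<le> \<tau>" and A: "finite A"
  shows "(\<Sum>m\<in>A. sq (KX X Y) (KY X Y) m) \<le> 1536 * (\<sigma> + \<delta>) ^ 4 * \<tau>"
proof -
  have \<rho>: "\<sigma>\<^sup>2 \<le> (\<sigma> + \<delta>)\<^sup>2" "\<delta>\<^sup>2 \<le> (\<sigma> + \<delta>)\<^sup>2" using \<sigma> \<delta> by (auto intro!: power_mono)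
  have K: "(cmod (4 * (of_real (\<sigma> * r a) * q X Y a - of_real (\<delta> * r b) * q X Y b)))\<^sup>2 \<le> 32 * (\<sigma> + \<delta>)\<^sup>2 * ((cmod (q X Y a))\<^sup>2 + (cmod (q X Y b))\<^sup>2)" for a b
  proof -
    have r2: "(r m)\<^sup>2 \<le> 1" for m using r[of m] by (simp add: power_le_one)
    have "(cmod (of_real (\<sigma> * r a) * q X Y a - of_real (\<delta> * r b) * q X Y b))\<^sup>2 \<le> 2 * (\<sigma>\<^sup>2 * (r a)\<^sup>2 * (cmod (q X Y a))\<^sup>2) + 2 * (\<delta>\<^sup>2 * (r b)\<^sup>2 * (cmod (q X Y b))\<^sup>2)"
      by (rule order_trans[OF norm_diff_sq_le]) (simp add: norm_mult power_mult_distrib)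
    also have "\<dots> \<le> 2 * ((\<sigma> + \<delta>)\<^sup>2 * 1 * (cmod (q X Y a))\<^sup>2) + 2 * ((\<sigma> + \<delta>)\<^sup>2 * 1 * (cmod (q X Y b))\<^sup>2)"
      by (intro add_mono mult_left_mono mult_mono \<rho> r2) auto
    finally show ?thesis unfolding norm_mult[of 4] by (simp add: power_mult_distrib algebra_simps)
  qed
  have "(\<Sum>m\<in>A. sq (KX X Y) (KY X Y) m) \<le> (\<Sum>m\<in>A. 32 * (\<sigma> + \<delta>)\<^sup>2 * ((cmod (q X Y (m + 0)))\<^sup>2 + (cmod (q X Y (m + 2 * n)))\<^sup>2)
     + 32 * (\<sigma> + \<delta>)\<^sup>2 * ((cmod (q X Y (m + 0)))\<^sup>2 + (cmod (q X Y (m + (- (2 * n)))))\<^sup>2))"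
    unfolding sq_def KX_def KY_def by (intro sum_mono add_mono) (use K in simp_all)
  also have "\<dots> = 32 * (\<sigma> + \<delta>)\<^sup>2 * ((\<Sum>m\<in>A. (cmod (q X Y (m + 0)))\<^sup>2) + (\<Sum>m\<in>A. (cmod (q X Y (m + 2 * n)))\<^sup>2)
     + ((\<Sum>m\<in>A. (cmod (q X Y (m + 0)))\<^sup>2) + (\<Sum>m\<in>A. (cmod (q X Y (m + (- (2 * n)))))\<^sup>2)))"
    by (simp only: sum.distrib sum_distrib_left distrib_left)
  also have "\<dots> \<le> 32 * (\<sigma> + \<delta>)\<^sup>2 * (12 * (\<sigma> + \<delta>)\<^sup>2 * \<tau> + 12 * (\<sigma> + \<delta>)\<^sup>2 * \<tau> + (12 * (\<sigma> + \<delta>)\<^sup>2 * \<tau> + 12 * (\<sigma> + \<delta>)\<^sup>2 * \<tau>))"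
    by (intro mult_left_mono add_mono sum_norm_q_sq_le[OF t A]) auto
  also have "\<dots> = 1536 * (\<sigma> + \<delta>) ^ 4 * \<tau>"
  proof -
    have "(\<sigma> + \<delta>) ^ 4 = (\<sigma> + \<delta>)\<^sup>2 * (\<sigma> + \<delta>)\<^sup>2" by (simp flip: power_add)
    then show ?thesis by simp
  qed
  finally show ?thesis .
qed

text \<open>
  Truncating a square-summable sequence perturbs the rows only through the bounded operators \<open>KX\<close>, \<open>KY\<close>
  applied to the tail, because the unbounded part of each row is diagonal.
\<close>

theorem rows_bound:
  assumes \<mu>: "Re \<mu> > 0"
  obtains C where "C \<ge> 0" "\<And>X Y R. sq X Y summable_on UNIV \<Longrightarrow>
    (\<And>A. finite A \<Longrightarrow> (\<Sum>m\<in>A. sq (rowX \<mu> X Y) (rowY \<mu> X Y) m) \<le> R) \<Longrightarrow> infsum (sq X Y) UNIV \<le> C * R"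
proof -
  obtain C where C: "C \<ge> 0" "\<And>N X Y. N \<ge> 2 * n \<Longrightarrow> (\<And>m. \<bar>m\<bar> > N \<Longrightarrow> X m = 0) \<Longrightarrow> (\<And>m. \<bar>m\<bar> > N \<Longrightarrow> Y m = 0) \<Longrightarrow>
      (\<Sum>m\<in>{-N..N}. sq X Y m) \<le> C * (\<Sum>m\<in>{-N..N}. sq (rowX \<mu> X Y) (rowY \<mu> X Y) m)"
    by (rule apriori[OF \<mu>]) blast
  have "infsum (sq X Y) UNIV \<le> 2 * C * R"
    if su: "sq X Y summable_on UNIV" and R: "\<And>A. finite A \<Longrightarrow> (\<Sum>m\<in>A. sq (rowX \<mu> X Y) (rowY \<mu> X Y) m) \<le> R" for X Y R
  proof -
    define S where "S = infsum (sq X Y) UNIV"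
    define Q where "Q = 1536 * (\<sigma> + \<delta>) ^ 4"
    have step: "(\<Sum>m\<in>{-N..N}. sq X Y m) \<le> C * (2 * R + 2 * (Q * (S - (\<Sum>m\<in>{-N..N}. sq X Y m))))"
      if N: "N \<ge> 2 * n" for N
    proof -
      define P where "P Z m = (if \<bar>m\<bar> \<le> N then Z m else 0)" for Z :: "int \<Rightarrow> complex" and m
      define t where "t Z m = (if \<bar>m\<bar> \<le> N then 0 else Z m)" for Z :: "int \<Rightarrow> complex" and m
      have PX: "P Z m = Z m + (- 1) * t Z m" for Z m by (simp add: P_def t_def)
      have tail: "(\<Sum>m\<in>A. sq (t X) (t Y) m) \<le> S - (\<Sum>m\<in>{-N..N}. sq X Y m)" if A: "finite A" for A
      proof -
        have "(\<Sum>m\<in>A. sq (t X) (t Y) m) = (\<Sum>m\<in>A - {-N..N}. sq X Y m)"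
          by (rule sum.mono_neutral_cong_right) (use A in \<open>auto simp: sq_def t_def abs_le_iff\<close>)
        also have "\<dots> + (\<Sum>m\<in>{-N..N}. sq X Y m) = (\<Sum>m\<in>(A - {-N..N}) \<union> {-N..N}. sq X Y m)"
          by (rule sum.union_disjoint[symmetric]) (use A in auto)
        also have "\<dots> \<le> S" unfolding S_def
          by (rule finite_sum_le_infsum[OF su]) (use A in auto)
        finally show ?thesis by simp
      qed
      have rows: "rowX \<mu> (P X) (P Y) m = rowX \<mu> X Y m + \<i> * KX (t X) (t Y) m \<and>
                  rowY \<mu> (P X) (P Y) m = rowY \<mu> X Y m - \<i> * KY (t X) (t Y) m" if "\<bar>m\<bar> \<le> N" for m
      proof -
        have K: "KX (P X) (P Y) m = KX X Y m + (- 1) * KX (t X) (t Y) m" "KY (P X) (P Y) m = KY X Y m + (- 1) * KY (t X) (t Y) m"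
          unfolding PX[abs_def] K_lin by simp_all
        show ?thesis using that unfolding rowX_def rowY_def K by (simp add: P_def algebra_simps)
      qed
      have "(\<Sum>m\<in>{-N..N}. sq X Y m) = (\<Sum>m\<in>{-N..N}. sq (P X) (P Y) m)"
        by (rule sum.cong) (auto simp: sq_def P_def)
      also have "\<dots> \<le> C * (\<Sum>m\<in>{-N..N}. sq (rowX \<mu> (P X) (P Y)) (rowY \<mu> (P X) (P Y)) m)"
        by (rule C(2)[OF N]) (auto simp: P_def)
      also have "(\<Sum>m\<in>{-N..N}. sq (rowX \<mu> (P X) (P Y)) (rowY \<mu> (P X) (P Y)) m)
         \<le> (\<Sum>m\<in>{-N..N}. 2 * sq (rowX \<mu> X Y) (rowY \<mu> X Y) m + 2 * sq (KX (t X) (t Y)) (KY (t X) (t Y)) m)"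
      proof (rule sum_mono)
        fix m assume "m \<in> {-N..N}"
        then have "\<bar>m\<bar> \<le> N" by auto
        from rows[OF this] show "sq (rowX \<mu> (P X) (P Y)) (rowY \<mu> (P X) (P Y)) m \<le> 2 * sq (rowX \<mu> X Y) (rowY \<mu> X Y) m + 2 * sq (KX (t X) (t Y)) (KY (t X) (t Y)) m"
          using norm_add_sq_le[of "rowX \<mu> X Y m" "\<i> * KX (t X) (t Y) m"] norm_diff_sq_le[of "rowY \<mu> X Y m" "\<i> * KY (t X) (t Y) m"]
          by (simp add: sq_def norm_mult)
      qed
      also have "\<dots> = 2 * (\<Sum>m\<in>{-N..N}. sq (rowX \<mu> X Y) (rowY \<mu> X Y) m) + 2 * (\<Sum>m\<in>{-N..N}. sq (KX (t X) (t Y)) (KY (t X) (t Y)) m)"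
        by (simp add: sum.distrib sum_distrib_left)
      also have "\<dots> \<le> 2 * R + 2 * (Q * (S - (\<Sum>m\<in>{-N..N}. sq X Y m)))"
        unfolding Q_def by (intro add_mono mult_left_mono R sum_norm_K_sq_le tail) auto
      finally show ?thesis using C(1) by (simp add: mult_left_mono)
    qed
    have lim: "(\<lambda>j. \<Sum>m\<in>{-int j..int j}. sq X Y m) \<longlonglongrightarrow> S"
      unfolding S_def by (rule tendsto_symmetric_sums[OF su])
    \<comment> \<open>Summability makes the tail S minus the partial sum vanish in the limit, and
      with it the error caused by truncation. The inequality that remains is S \<le> 2 C R.\<close>
    have "(\<lambda>j. C * (2 * R + 2 * (Q * (S - (\<Sum>m\<in>{-int j..int j}. sq X Y m))))) \<longlonglongrightarrow> C * (2 * R + 2 * (Q * (S - S)))"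
      by (intro tendsto_intros lim)
    then have "S \<le> C * (2 * R + 2 * (Q * (S - S)))"
    proof (rule LIMSEQ_le[OF lim])
      show "\<exists>N. \<forall>j\<ge>N. (\<Sum>m\<in>{-int j..int j}. sq X Y m) \<le> C * (2 * R + 2 * (Q * (S - (\<Sum>m\<in>{-int j..int j}. sq X Y m))))"
        by (rule exI[of _ "nat (2 * n)"]) (auto intro!: step)
    qed
    then show ?thesis by (simp add: S_def)
  qed
  then show thesis using that[of "2 * C"] C(1) by simp
qed

end

section \<open>The linearized operator on Fourier coefficients\<close>

context circle begin

text \<open>Writing |freq a| as the product of |freq^2 a| and 1/|freq| bounds it by a sum of two
  squares, both summable.\<close>

lemma abs_summable_freq_mult:
  assumes "\<And>A. finite A \<Longrightarrow> (\<Sum>m\<in>A. ((freq m)\<^sup>2 * cmod (a m))\<^sup>2) \<le> K"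
  shows "abs_summable (\<lambda>m. \<i> * of_real (freq m) * a m)"
proof -
  have 1: "(\<lambda>m. ((freq m)\<^sup>2 * cmod (a m))\<^sup>2) summable_on UNIV"
    by (rule nonneg_bdd_above_summable_on) (use assms in \<open>auto intro!: bdd_aboveI[of _ K]\<close>)
  have 2: "(\<lambda>m. (T / (2 * pi))\<^sup>2 * (1 / (real_of_int m)\<^sup>2)) summable_on UNIV"
    by (intro summable_on_cmult_right summable_on_inverse_square_int)
  have bound: "cmod (\<i> * of_real (freq m) * a m) \<le> ((freq m)\<^sup>2 * cmod (a m))\<^sup>2 + (T / (2 * pi))\<^sup>2 * (1 / (real_of_int m)\<^sup>2)" for m
  proof (cases "m = 0")
    case True then show ?thesis by (simp add: freq_def)
  next
    case False
    define f where "f = \<bar>freq m\<bar>"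
    have f: "f > 0" using False T_pos by (simp add: f_def freq_def)
    have "(T / (2 * pi))\<^sup>2 * (1 / (real_of_int m)\<^sup>2) = (1 / f)\<^sup>2"
      using T_pos by (simp add: f_def freq_def power_divide power_mult_distrib)
    moreover have "f * cmod (a m) = (f\<^sup>2 * cmod (a m)) * (1 / f)" using f by (simp add: power2_eq_square)
    moreover have xy: "x * y \<le> x\<^sup>2 + y\<^sup>2" if "x \<ge> 0" "y \<ge> 0" for x y :: real
      using zero_le_power2[of "x - y"] mult_nonneg_nonneg[OF that] unfolding power2_diff by linarith
    moreover have "(freq m)\<^sup>2 = f\<^sup>2" by (simp add: f_def)
    moreover have "(f\<^sup>2 * cmod (a m)) * (1 / f) \<le> (f\<^sup>2 * cmod (a m))\<^sup>2 + (1 / f)\<^sup>2" by (rule xy) (use f in auto)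
    ultimately show ?thesis by (simp add: norm_mult f_def[symmetric])
  qed
  show ?thesis
    by (rule summable_on_comparison_test[OF summable_on_add[OF 1 2]]) (use bound in auto)
qed

lemma parseval_of_AE_series:
  assumes w: "w \<in> L2_circle T" and a: "abs_summable (coef w)" and ae: "AE x in lborel. w x = series (coef w) x"
  shows "((\<lambda>m. (cmod (coef w m))\<^sup>2) has_sum (LINT x:{0..T}|lborel. (cmod (w x))\<^sup>2) / T) UNIV"
proof -
  have [measurable]: "w \<in> borel_measurable borel" "series (coef w) \<in> borel_measurable borel"
    using w borel_measurable_series[OF a] by (auto simp: L2_circle_def)
  have "(LINT x:{0..T}|lborel. (cmod (w x))\<^sup>2) = (LINT x:{0..T}|lborel. (cmod (series (coef w) x))\<^sup>2)"
    by (rule set_lebesgue_integral_cong_AE) (use ae in auto)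
  then show ?thesis using parseval_series[OF a] by simp
qed

end

section \<open>The co-rotating change of variables\<close>

context linearized begin

definition PX :: "(int \<Rightarrow> complex) \<Rightarrow> (int \<Rightarrow> complex) \<Rightarrow> int \<Rightarrow> complex" where
  "PX a b m = a (m + n) + \<i> * b (m + n)"
definition PY :: "(int \<Rightarrow> complex) \<Rightarrow> (int \<Rightarrow> complex) \<Rightarrow> int \<Rightarrow> complex" where
  "PY a b m = a (m - n) - \<i> * b (m - n)"

text \<open>Coefficients of the convolution term and, below, of the two components of L in the
  original variables. The profile is (\<sigma> - \<delta>)(exp(ix) + exp(-ix)) in its real and -i
  (\<sigma> + \<delta>)(exp(ix) - exp(-ix)) in its imaginary part, and exp(ix) has index n.\<close>

definition cc :: "(int \<Rightarrow> complex) \<Rightarrow> (int \<Rightarrow> complex) \<Rightarrow> int \<Rightarrow> complex" where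
  "cc a b m = of_real (r m) * (of_real (\<sigma> - \<delta>) * (a (m - n) + a (m + n)) - \<i> * of_real (\<sigma> + \<delta>) * (b (m - n) - b (m + n)))"

definition L1c :: "(int \<Rightarrow> complex) \<Rightarrow> (int \<Rightarrow> complex) \<Rightarrow> int \<Rightarrow> complex" where
  "L1c a b m = of_real (k\<^sup>2 / 2 * ((s m)\<^sup>2 - 1)) * a m + 2 * of_real (\<sigma> - \<delta>) * (cc a b (m - n) + cc a b (m + n))"
definition L2c :: "(int \<Rightarrow> complex) \<Rightarrow> (int \<Rightarrow> complex) \<Rightarrow> int \<Rightarrow> complex" where
  "L2c a b m = of_real (k\<^sup>2 / 2 * ((s m)\<^sup>2 - 1)) * b m - 2 * \<i> * of_real (\<sigma> + \<delta>) * (cc a b (m - n) - cc a b (m + n))"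

lemma cc_eq: "cc a b m = of_real (r m) * q (PX a b) (PY a b) m"
proof -
  have "of_real (\<sigma> - \<delta>) * (a (m - n) + a (m + n)) - \<i> * of_real (\<sigma> + \<delta>) * (b (m - n) - b (m + n)) = q (PX a b) (PY a b) m"
    by (simp add: q_def PX_def PY_def algebra_simps)
  then show ?thesis unfolding cc_def by simp
qed

text \<open>Completing the square: s^2 + 2s = (s + 1)^2 - 1, and a shift of the index by n changes s
  by 1.\<close>

lemma dX_shift: "dX m = k\<^sup>2 / 2 * ((s (m + n))\<^sup>2 - 1)" and dY_shift: "dY m = k\<^sup>2 / 2 * ((s (m - n))\<^sup>2 - 1)"
  using n by (simp_all add: dX_def dY_def s_def field_simps power2_eq_square)

lemma rows_P:
  "rowX \<mu> (PX a b) (PY a b) m = PX (\<lambda>m. L2c a b m - \<mu> * a m) (\<lambda>m. - L1c a b m - \<mu> * b m) m"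
  "rowY \<mu> (PX a b) (PY a b) m = PY (\<lambda>m. L2c a b m - \<mu> * a m) (\<lambda>m. - L1c a b m - \<mu> * b m) m"
proof -
  have K: "KX (PX a b) (PY a b) m = 4 * (of_real \<sigma> * cc a b m - of_real \<delta> * cc a b (m + 2 * n))"
    "KY (PX a b) (PY a b) m = 4 * (of_real \<sigma> * cc a b m - of_real \<delta> * cc a b (m - 2 * n))"
    unfolding cc_eq KX_def KY_def by simp_all
  have i: "\<i> * (\<i> * z) = - z" for z by (simp flip: mult.assoc)
  \<comment> \<open>The symbol is made opaque so that the simplifier normalizes only the terms of
    the linear identity and does not expand the symbol itself.\<close>
  obtain E where E: "complex_of_real (k\<^sup>2 / 2 * ((s (m + n))\<^sup>2 - 1)) = E" by blast
  show "rowX \<mu> (PX a b) (PY a b) m = PX (\<lambda>m. L2c a b m - \<mu> * a m) (\<lambda>m. - L1c a b m - \<mu> * b m) m"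
    unfolding rowX_def K dX_shift PX_def L1c_def L2c_def
      E by (simp add: algebra_simps i)
  obtain E' where E': "complex_of_real (k\<^sup>2 / 2 * ((s (m - n))\<^sup>2 - 1)) = E'" by blast
  show "rowY \<mu> (PX a b) (PY a b) m = PY (\<lambda>m. L2c a b m - \<mu> * a m) (\<lambda>m. - L1c a b m - \<mu> * b m) m"
    unfolding rowY_def K dY_shift PY_def L1c_def L2c_def
      E' by (simp add: algebra_simps i)
qed

lemma P_inject:
  assumes "PX a b = PX a' b'" "PY a b = PY a' b'"
  shows "a m = a' m" "b m = b' m"
proof -
  have "a m + \<i> * b m = a' m + \<i> * b' m" "a m - \<i> * b m = a' m - \<i> * b' m"
    using fun_cong[OF assms(1), of "m - n"] fun_cong[OF assms(2), of "m + n"] by (simp_all add: PX_def PY_def)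
  then show "a m = a' m" "b m = b' m" by (auto simp: complex_eq_iff)
qed

lemma sum_shift_le:
  fixes g :: "int \<Rightarrow> real"
  assumes "\<And>A. finite A \<Longrightarrow> (\<Sum>m\<in>A. g m) \<le> R" "finite A"
  shows "(\<Sum>m\<in>A. g (m + j)) \<le> R"
proof -
  have "(\<Sum>m\<in>A. g (m + j)) = (\<Sum>m\<in>(\<lambda>m. m + j) ` A. g m)"
    by (subst sum.reindex) (auto simp: inj_on_def)
  then show ?thesis using assms by simp
qed

lemma sum_sq_P_le:
  assumes "\<And>A. finite A \<Longrightarrow> (\<Sum>m\<in>A. sq a b m) \<le> R" "finite A"
  shows "(\<Sum>m\<in>A. sq (PX a b) (PY a b) m) \<le> 4 * R"
proof -
  have "(\<Sum>m\<in>A. sq (PX a b) (PY a b) m) \<le> (\<Sum>m\<in>A. 2 * sq a b (m + n) + 2 * sq a b (m + (- n)))"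
  proof (rule sum_mono)
    fix m
    show "sq (PX a b) (PY a b) m \<le> 2 * sq a b (m + n) + 2 * sq a b (m + (- n))"
      using norm_add_sq_le[of "a (m + n)" "\<i> * b (m + n)"] norm_diff_sq_le[of "a (m - n)" "\<i> * b (m - n)"]
      by (simp add: sq_def PX_def PY_def norm_mult)
  qed
  also have "\<dots> = 2 * (\<Sum>m\<in>A. sq a b (m + n)) + 2 * (\<Sum>m\<in>A. sq a b (m + (- n)))"
    by (simp only: sum.distrib sum_distrib_left)
  also have "\<dots> \<le> 2 * R + 2 * R"
    by (intro add_mono mult_left_mono sum_shift_le[where g = "sq a b"] assms) auto
  finally show ?thesis by simp
qed

text \<open>The parallelogram identity: |a|^2 + |b|^2 is the mean of |a + ib|^2 and |a - ib|^2, and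
  these two sit at the indices m - n and m + n. With \<open>sum_sq_P_le\<close> it makes the change
  of variables an equivalence of norms.\<close>

lemma sum_sq_le_P:
  assumes "\<And>A. finite A \<Longrightarrow> (\<Sum>m\<in>A. sq (PX a b) (PY a b) m) \<le> R" "finite A"
  shows "(\<Sum>m\<in>A. sq a b m) \<le> R"
proof -
  have "(\<Sum>m\<in>A. sq a b m) \<le> (\<Sum>m\<in>A. (sq (PX a b) (PY a b) (m + (- n)) + sq (PX a b) (PY a b) (m + n)) / 2)"
  proof (rule sum_mono)
    fix m
    have "sq a b m = ((cmod (PX a b (m - n)))\<^sup>2 + (cmod (PY a b (m + n)))\<^sup>2) / 2"
      unfolding sq_def PX_def PY_def cmod_power2 by (simp add: power2_eq_square algebra_simps)
    also have "\<dots> \<le> (sq (PX a b) (PY a b) (m + (- n)) + sq (PX a b) (PY a b) (m + n)) / 2"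
      by (simp add: sq_def)
    finally show "sq a b m \<le> (sq (PX a b) (PY a b) (m + (- n)) + sq (PX a b) (PY a b) (m + n)) / 2" .
  qed
  also have "\<dots> = ((\<Sum>m\<in>A. sq (PX a b) (PY a b) (m + (- n))) + (\<Sum>m\<in>A. sq (PX a b) (PY a b) (m + n))) / 2"
    unfolding sum_divide_distrib[symmetric] sum.distrib ..
  also have "\<dots> \<le> (R + R) / 2"
    by (intro divide_right_mono add_mono sum_shift_le[where g = "sq (PX a b) (PY a b)"] assms) auto
  finally show ?thesis by simp
qed

end

text \<open>The hypotheses frozen at one \<open>B\<close> and one \<open>V0\<close>.
  \<open>B_large\<close> yields \<open>large\<close> since sqrt B \<le> 2 \<sigma>,
  \<open>A_small\<close> is \<open>small\<close> with \<open>\<delta>\<close> written out, and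
  \<open>A_nonneg\<close> orders the two square roots, so that \<open>\<delta>\<close> is
  nonnegative.\<close>

locale gp =
  fixes \<zeta> :: "real \<Rightarrow> real" and k \<epsilon> :: real and n :: nat and V0 B :: real
  assumes zeta_integrable: "integrable lborel \<zeta>"
    and zeta_L1_norm: "(LINT x|lborel. \<bar>\<zeta> x\<bar>) = 1"
    and zeta_hat_pos: "\<And>s. fourier \<zeta> s \<in> \<real> \<and> Re (fourier \<zeta> s) > 0"
    and k_pos: "k > 0" and eps_pos: "\<epsilon> > 0" and n_pos: "n \<ge> 1"
    and B_pos: "B > 0" and A_nonneg: "amplitude \<zeta> k \<epsilon> 1 V0 \<ge> 0"
    and B_large: "\<And>m::int. \<bar>m\<bar> \<le> 3 * int n \<Longrightarrow> 6 * k\<^sup>2 \<le> B * Re (fourier \<zeta> (k * \<epsilon> * of_int m / real n))"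
    and A_small: "96 * (real n)\<^sup>2 * ((sqrt (B + amplitude \<zeta> k \<epsilon> 1 V0) - sqrt B) / 4)\<^sup>2 \<le> k\<^sup>2"
begin

definition \<sigma> where "\<sigma> = (sqrt (B + amplitude \<zeta> k \<epsilon> 1 V0) + sqrt B) / 4"
definition \<delta> where "\<delta> = (sqrt (B + amplitude \<zeta> k \<epsilon> 1 V0) - sqrt B) / 4"
definition rr where "rr m = Re (fourier \<zeta> (k * \<epsilon> * of_int m / real n))" for m :: int
definition T where "T = 2 * pi * real n"

lemma fourier_le_one: "Re (fourier \<zeta> s) \<le> 1"
proof -
  have "Re (fourier \<zeta> s) \<le> cmod (fourier \<zeta> s)" by (rule complex_Re_le_cmod)
  also have "\<dots> \<le> (LINT x|lborel. cmod (exp (- \<i> * complex_of_real (s * x)) * complex_of_real (\<zeta> x)))"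
    unfolding fourier_def by (rule integral_norm_bound)
  also have "\<dots> = (LINT x|lborel. \<bar>\<zeta> x\<bar>)" by (simp add: norm_mult)
  finally show ?thesis using zeta_L1_norm by simp
qed

sublocale circle T
  by unfold_locales (use n_pos in \<open>simp add: T_def\<close>)

sublocale linearized "int n" k \<sigma> \<delta> rr
proof unfold_locales
  have le: "sqrt B \<le> sqrt (B + amplitude \<zeta> k \<epsilon> 1 V0)" using A_nonneg by simp
  show "\<sigma> > 0" "\<delta> \<ge> 0" using le B_pos by (auto simp: \<sigma>_def \<delta>_def add_pos_pos)
  show "rr m \<ge> 0" "rr m \<le> 1" for m using zeta_hat_pos fourier_le_one by (auto simp: rr_def less_imp_le)
  have "sqrt B \<le> 2 * \<sigma>" using le by (simp add: \<sigma>_def)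
  then have "(sqrt B)\<^sup>2 \<le> (2 * \<sigma>)\<^sup>2" using B_pos by (intro power_mono) auto
  then have \<sigma>B: "B \<le> 4 * \<sigma>\<^sup>2" using B_pos by (simp add: power_mult_distrib)
  show "6 * k\<^sup>2 \<le> 4 * rr m * \<sigma>\<^sup>2" if "\<bar>m\<bar> \<le> 3 * int n" for m
  proof -
    have "6 * k\<^sup>2 \<le> B * rr m" using B_large[OF that] by (simp add: rr_def)
    also have "\<dots> \<le> 4 * \<sigma>\<^sup>2 * rr m" using \<sigma>B \<open>\<And>m. rr m \<ge> 0\<close> by (intro mult_right_mono) auto
    finally show ?thesis by (simp add: mult_ac)
  qed
  show "96 * (of_int (int n))\<^sup>2 * \<delta>\<^sup>2 \<le> k\<^sup>2" using A_small by (simp add: \<delta>_def)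
qed (use n_pos k_pos in auto)

lemma freq_eq: "freq m = s m"
  unfolding freq_def s_def by (simp add: T_def)

lemma chr_n: "chr (int n) x = cis x" "chr (- int n) x = cis (- x)"
  using n_pos by (simp_all add: chr_freq freq_eq s_def)

lemma u_eq: "complex_of_real (u_omega \<zeta> k \<epsilon> V0 B x) = of_real (\<sigma> - \<delta>) * (chr (int n) x + chr (- int n) x)"
  using k_pos by (simp add: u_omega_def phi_omega_def chr_n \<sigma>_def \<delta>_def complex_eq_iff field_simps)

lemma v_eq: "complex_of_real (v_omega \<zeta> k \<epsilon> V0 B x) = - \<i> * of_real (\<sigma> + \<delta>) * (chr (int n) x - chr (- int n) x)"
  using k_pos by (simp add: v_omega_def phi_omega_def chr_n \<sigma>_def \<delta>_def complex_eq_iff field_simps)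

section \<open>The nonlocal term as a Fourier multiplier\<close>

lemma integrable_scaled_kernel: "integrable lborel (scaled_kernel \<zeta> k \<epsilon>)"
proof -
  have "integrable lborel (\<lambda>x. \<zeta> (0 + (1 / (k * \<epsilon>)) * x))"
    by (rule lborel_integrable_real_affine[OF zeta_integrable]) (use k_pos eps_pos in auto)
  then have "integrable lborel (\<lambda>x. (1 / k * (1 / \<epsilon>)) * \<zeta> (x / k / \<epsilon>))"
    by (intro integrable_mult_right) simp
  then show ?thesis by (simp add: scaled_kernel_def[abs_def] kernel_def)
qed

text \<open>Reflection of the integration variable, then scaling by k \<epsilon>, turns the integral
  into the Fourier transform of \<open>\<zeta>\<close> at k \<epsilon> m / n, which is real by
  hypothesis.\<close>

lemma integral_scaled_kernel_chr:
  "(LINT y|lborel. complex_of_real (scaled_kernel \<zeta> k \<epsilon> (x - y)) * chr m y) = of_real (rr m) * chr m x"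
proof -
  have "(LINT y|lborel. complex_of_real (scaled_kernel \<zeta> k \<epsilon> (x - y)) * chr m y)
    = (LINT t|lborel. complex_of_real (scaled_kernel \<zeta> k \<epsilon> t) * chr m (x - t))"
    by (subst lborel_integral_real_affine[of "-1" _ x]) simp_all
  also have "\<dots> = (LINT t|lborel. complex_of_real (scaled_kernel \<zeta> k \<epsilon> t) * chr (- m) t) * chr m x"
    by (simp add: chr_diff mult_ac flip: integral_mult_right_zero)
  also have "(LINT t|lborel. complex_of_real (scaled_kernel \<zeta> k \<epsilon> t) * chr (- m) t) =
     \<bar>k * \<epsilon>\<bar> *\<^sub>R (LINT y|lborel. complex_of_real (scaled_kernel \<zeta> k \<epsilon> (0 + (k * \<epsilon>) * y)) * chr (- m) (0 + (k * \<epsilon>) * y))"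
    by (rule lborel_integral_real_affine) (use k_pos eps_pos in auto)
  also have "\<dots> = (LINT y|lborel. exp (- \<i> * complex_of_real ((k * \<epsilon> * of_int m / real n) * y)) * complex_of_real (\<zeta> y))"
  proof -
    have "chr (- m) (0 + (k * \<epsilon>) * y) = exp (- \<i> * complex_of_real ((k * \<epsilon> * of_int m / real n) * y))" for y
      by (simp add: chr_freq freq_eq s_def cis_conv_exp mult_ac)
    moreover have "complex_of_real (scaled_kernel \<zeta> k \<epsilon> (0 + (k * \<epsilon>) * y)) = complex_of_real (1 / (k * \<epsilon>)) * complex_of_real (\<zeta> y)" for y
      using k_pos eps_pos by (simp add: scaled_kernel_def kernel_def)
    ultimately show ?thesis using k_pos eps_pos
      by (simp only: mult.assoc integral_mult_right_zero) (simp add: scaleR_conv_of_real mult.commute)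
  qed
  also have "\<dots> = fourier \<zeta> (k * \<epsilon> * of_int m / real n)" by (simp add: fourier_def)
  also have "\<dots> = of_real (rr m)"
    using zeta_hat_pos[of "k * \<epsilon> * of_int m / real n"] by (auto simp: rr_def elim: Reals_cases)
  finally show ?thesis by simp
qed

text \<open>Termwise integration of the series against the kernel. The hypothesis on
  \<open>f\<close> is almost everywhere, yet the conclusion is pointwise, because a null set does
  not change the convolution integral.\<close>

lemma conv_series:
  assumes f: "f \<in> borel_measurable borel" and a: "abs_summable a" and ae: "AE x in lborel. f x = series a x"
  shows "conv (scaled_kernel \<zeta> k \<epsilon>) f = series (\<lambda>m. of_real (rr m) * a m)"
proof
  fix x
  have K: "integrable lborel (\<lambda>y. scaled_kernel \<zeta> k \<epsilon> (x - y))"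
    using lborel_integrable_real_affine[OF integrable_scaled_kernel, of "-1" x] by simp
  then have [measurable]: "(\<lambda>y. scaled_kernel \<zeta> k \<epsilon> (x - y)) \<in> borel_measurable borel" by auto
  have [measurable]: "series a \<in> borel_measurable borel" "f \<in> borel_measurable borel"
    using borel_measurable_series[OF a] f by auto
  have "conv (scaled_kernel \<zeta> k \<epsilon>) f x = (LINT y|lborel. complex_of_real (scaled_kernel \<zeta> k \<epsilon> (x - y)) * series a y)"
    unfolding conv_def by (rule integral_cong_AE) (use ae in auto)
  also have "\<dots> = (\<Sum>\<^sub>\<infinity>m. a m * (of_real (rr m) * chr m x))"
    using has_sum_integral_series[OF _ a, of "\<lambda>y. complex_of_real (scaled_kernel \<zeta> k \<epsilon> (x - y))"] K
    by (simp add: integral_scaled_kernel_chr infsumI)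
  finally show "conv (scaled_kernel \<zeta> k \<epsilon>) f x = series (\<lambda>m. of_real (rr m) * a m) x"
    by (simp add: series_def mult_ac)
qed

lemma L2_u_mult: "f \<in> L2_circle T \<Longrightarrow> (\<lambda>x. complex_of_real (u_omega \<zeta> k \<epsilon> V0 B x) * f x) \<in> L2_circle T"
  unfolding u_eq mult.assoc distrib_right
  by (intro L2_cmult L2_add L2_chr_mult)

lemma L2_v_mult: "f \<in> L2_circle T \<Longrightarrow> (\<lambda>x. complex_of_real (v_omega \<zeta> k \<epsilon> V0 B x) * f x) \<in> L2_circle T"
  unfolding v_eq mult.assoc left_diff_distrib
  by (intro L2_cmult L2_diff L2_chr_mult)

lemma coef_u_mult: "f \<in> L2_circle T \<Longrightarrow> coef (\<lambda>x. complex_of_real (u_omega \<zeta> k \<epsilon> V0 B x) * f x) m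
    = of_real (\<sigma> - \<delta>) * (coef f (m - int n) + coef f (m + int n))"
  unfolding u_eq mult.assoc distrib_right coef_cmult
  by (simp add: coef_add coef_chr_mult L2_chr_mult)

lemma coef_v_mult: "f \<in> L2_circle T \<Longrightarrow> coef (\<lambda>x. complex_of_real (v_omega \<zeta> k \<epsilon> V0 B x) * f x) m
    = - \<i> * of_real (\<sigma> + \<delta>) * (coef f (m - int n) - coef f (m + int n))"
  unfolding v_eq mult.assoc left_diff_distrib[of "chr _ _"] coef_cmult
  by (simp add: coef_diff coef_chr_mult L2_chr_mult)

lemma abs_summable_shift: "abs_summable a \<Longrightarrow> abs_summable (\<lambda>m. a (m + j))"
  by (subst summable_on_reindex_bij_betw[of "\<lambda>m. m + j" UNIV UNIV "\<lambda>m. cmod (a m)"])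
    (auto intro: bij_betwI[of _ _ _ "\<lambda>m. m - j"])

lemma abs_summable_add: "abs_summable a \<Longrightarrow> abs_summable b \<Longrightarrow> abs_summable (\<lambda>m. a m + b m)"
  by (rule summable_on_comparison_test[OF summable_on_add[where f = "\<lambda>m. cmod (a m)" and g = "\<lambda>m. cmod (b m)"]])
    (auto intro: norm_triangle_ineq)

lemma abs_summable_cmult: "abs_summable a \<Longrightarrow> abs_summable (\<lambda>m. c * a m)"
  by (simp add: norm_mult summable_on_cmult_right)

lemma abs_summable_rr_mult:
  assumes "abs_summable a"
  shows "abs_summable (\<lambda>m. of_real (rr m) * a m)"
  by (rule summable_on_comparison_test[OF assms])
    (use r in \<open>auto simp: norm_mult intro!: mult_left_le_one_le\<close>)

definition cfun :: "(real \<Rightarrow> complex) \<Rightarrow> (real \<Rightarrow> complex) \<Rightarrow> real \<Rightarrow> complex" where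
  "cfun w z = conv (scaled_kernel \<zeta> k \<epsilon>) (\<lambda>y. complex_of_real (u_omega \<zeta> k \<epsilon> V0 B y) * w y + complex_of_real (v_omega \<zeta> k \<epsilon> V0 B y) * z y)"

lemma cfun_L2_coef:
  assumes w: "w \<in> L2_circle T" "abs_summable (coef w)" and z: "z \<in> L2_circle T" "abs_summable (coef z)"
  shows "cfun w z \<in> L2_circle T" "coef (cfun w z) m = cc (coef w) (coef z) m"
proof -
  define Q where "Q = (\<lambda>y. complex_of_real (u_omega \<zeta> k \<epsilon> V0 B y) * w y + complex_of_real (v_omega \<zeta> k \<epsilon> V0 B y) * z y)"
  have Q: "Q \<in> L2_circle T" unfolding Q_def by (intro L2_add L2_u_mult L2_v_mult w z)
  have cQ: "coef Q m = of_real (\<sigma> - \<delta>) * (coef w (m - int n) + coef w (m + int n)) - \<i> * of_real (\<sigma> + \<delta>) * (coef z (m - int n) - coef z (m + int n))" for m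
    unfolding Q_def using w z by (simp add: coef_add coef_u_mult coef_v_mult L2_u_mult L2_v_mult)
  have sh: "abs_summable (\<lambda>m. a (m - int n))" if "abs_summable a" for a
    using abs_summable_shift[OF that, of "- int n"] by simp
  have cQ': "coef Q m = of_real (\<sigma> - \<delta>) * (coef w (m - int n) + coef w (m + int n)) + (- \<i> * of_real (\<sigma> + \<delta>)) * (coef z (m - int n) + (- 1) * coef z (m + int n))" for m
    unfolding cQ by simp
  have aQ: "abs_summable (coef Q)"
    unfolding cQ'[abs_def] by (intro abs_summable_add abs_summable_cmult sh abs_summable_shift w z)
  have "AE x in lborel. Q x = series (coef Q) x"
    by (rule coef_unique[OF Q L2_series[OF aQ]]) (simp add: coef_series[OF aQ])
  then have eq: "cfun w z = series (\<lambda>m. of_real (rr m) * coef Q m)"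
    unfolding cfun_def Q_def[symmetric] using Q by (intro conv_series aQ) (auto simp: L2_circle_def)
  have a: "abs_summable (\<lambda>m. of_real (rr m) * coef Q m)" by (rule abs_summable_rr_mult[OF aQ])
  show "cfun w z \<in> L2_circle T" unfolding eq by (rule L2_series[OF a])
  show "coef (cfun w z) m = cc (coef w) (coef z) m"
    unfolding eq coef_series[OF a] by (simp add: cc_def cQ)
qed

abbreviation "D \<equiv> sobolev_circle 2 T \<times> sobolev_circle 2 T"
abbreviation "JL \<equiv> JL_op T \<zeta> k \<epsilon> V0 B"

lemma JL_eq: "JL (w, z) =
    ((\<lambda>x. - complex_of_real (k\<^sup>2 / 2) * (weak_deriv T (weak_deriv T z) x + z x) + 2 * (complex_of_real (v_omega \<zeta> k \<epsilon> V0 B x) * cfun w z x)),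
     (\<lambda>x. - (- complex_of_real (k\<^sup>2 / 2) * (weak_deriv T (weak_deriv T w) x + w x) + 2 * (complex_of_real (u_omega \<zeta> k \<epsilon> V0 B x) * cfun w z x))))"
  by (simp add: JL_op_def J_op_def L_op_def Let_def cfun_def mult.assoc)

lemma shifted_JL:
  assumes w: "w \<in> sobolev_circle 2 T" and z: "z \<in> sobolev_circle 2 T"
  shows "fst (shifted JL \<mu> (w, z)) \<in> L2_circle T" "snd (shifted JL \<mu> (w, z)) \<in> L2_circle T"
    "coef (fst (shifted JL \<mu> (w, z))) m = L2c (coef w) (coef z) m - \<mu> * coef w m"
    "coef (snd (shifted JL \<mu> (w, z))) m = - L1c (coef w) (coef z) m - \<mu> * coef z m"
proof -
  note w2 = sobolev_2_weak_deriv[OF w] and z2 = sobolev_2_weak_deriv[OF z]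
  note c = cfun_L2_coef[OF w2(1) sobolev_2_series(1)[OF w] z2(1) sobolev_2_series(1)[OF z]]
  define d where "d = - complex_of_real (k\<^sup>2 / 2)"
  have f: "fst (shifted JL \<mu> (w, z)) = (\<lambda>x. (d * (weak_deriv T (weak_deriv T z) x + z x) + 2 * (complex_of_real (v_omega \<zeta> k \<epsilon> V0 B x) * cfun w z x)) - \<mu> * w x)"
    and g: "snd (shifted JL \<mu> (w, z)) = (\<lambda>x. (- 1) * (d * (weak_deriv T (weak_deriv T w) x + w x) + 2 * (complex_of_real (u_omega \<zeta> k \<epsilon> V0 B x) * cfun w z x)) - \<mu> * z x)"
    by (simp_all add: shifted_def JL_eq d_def)
  note L = w2(1,2) z2(1,2) c(1) L2_add L2_diff L2_cmult L2_u_mult L2_v_mult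
  show "fst (shifted JL \<mu> (w, z)) \<in> L2_circle T" "snd (shifted JL \<mu> (w, z)) \<in> L2_circle T"
    unfolding f g by (intro L)+
  have "coef (fst (shifted JL \<mu> (w, z))) m = d * (coef (weak_deriv T (weak_deriv T z)) m + coef z m) + 2 * coef (\<lambda>x. complex_of_real (v_omega \<zeta> k \<epsilon> V0 B x) * cfun w z x) m - \<mu> * coef w m"
    unfolding f by (simp only: coef_add coef_diff coef_cmult L)
  then show "coef (fst (shifted JL \<mu> (w, z))) m = L2c (coef w) (coef z) m - \<mu> * coef w m"
    by (simp add: coef_v_mult c z2(3) L2c_def d_def freq_eq algebra_simps)
  have "coef (snd (shifted JL \<mu> (w, z))) m = (- 1) * (d * (coef (weak_deriv T (weak_deriv T w)) m + coef w m) + 2 * coef (\<lambda>x. complex_of_real (u_omega \<zeta> k \<epsilon> V0 B x) * cfun w z x) m) - \<mu> * coef z m"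
    unfolding g by (simp only: coef_add coef_diff coef_cmult L)
  then show "coef (snd (shifted JL \<mu> (w, z))) m = - L1c (coef w) (coef z) m - \<mu> * coef z m"
    by (simp add: coef_u_mult c w2(3) L1c_def d_def freq_eq algebra_simps)
qed

end

section \<open>The resolvent\<close>

context linearized begin

text \<open>\<open>rows_bound\<close> with \<open>R = 0\<close>, applied to the difference. The
  difference is written as a sum with factor -1 so that \<open>K_lin\<close> rewrites it.\<close>

lemma rows_inj:
  assumes \<mu>: "Re \<mu> > 0" and su: "\<And>A. finite A \<Longrightarrow> (\<Sum>m\<in>A. sq X Y m) \<le> K" "\<And>A. finite A \<Longrightarrow> (\<Sum>m\<in>A. sq X' Y' m) \<le> K'"
    and eq: "\<And>m. rowX \<mu> X Y m = rowX \<mu> X' Y' m" "\<And>m. rowY \<mu> X Y m = rowY \<mu> X' Y' m"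
  shows "X m = X' m \<and> Y m = Y' m"
proof -
  define U V where "U m = X m + (- 1) * X' m" and "V m = Y m + (- 1) * Y' m" for m
  obtain C where C: "\<And>X Y R. sq X Y summable_on UNIV \<Longrightarrow>
    (\<And>A. finite A \<Longrightarrow> (\<Sum>m\<in>A. sq (rowX \<mu> X Y) (rowY \<mu> X Y) m) \<le> R) \<Longrightarrow> infsum (sq X Y) UNIV \<le> C * R"
    by (rule rows_bound[OF \<mu>]) blast
  have "(\<Sum>m\<in>A. sq U V m) \<le> 2 * K + 2 * K'" if A: "finite A" for A
  proof -
    have "(\<Sum>m\<in>A. sq U V m) \<le> (\<Sum>m\<in>A. 2 * sq X Y m + 2 * sq X' Y' m)"
    proof (rule sum_mono)
      show "sq U V m \<le> 2 * sq X Y m + 2 * sq X' Y' m" for m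
        using norm_diff_sq_le[of "X m" "X' m"] norm_diff_sq_le[of "Y m" "Y' m"] by (simp add: sq_def U_def V_def)
    qed
    also have "\<dots> = 2 * (\<Sum>m\<in>A. sq X Y m) + 2 * (\<Sum>m\<in>A. sq X' Y' m)" by (simp add: sum.distrib sum_distrib_left)
    also have "\<dots> \<le> 2 * K + 2 * K'" by (intro add_mono mult_left_mono su A) auto
    finally show ?thesis .
  qed
  then have s: "sq U V summable_on UNIV"
    by (intro nonneg_bdd_above_summable_on) (auto intro!: bdd_aboveI[of _ "2 * K + 2 * K'"])
  have "rowX \<mu> U V m = rowX \<mu> X Y m - rowX \<mu> X' Y' m" "rowY \<mu> U V m = rowY \<mu> X Y m - rowY \<mu> X' Y' m" for m
    unfolding U_def[abs_def] V_def[abs_def] rowX_def rowY_def K_lin by (simp_all add: algebra_simps)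
  then have "infsum (sq U V) UNIV \<le> C * 0"
    by (intro C[OF s]) (simp add: sq_def eq)
  then have "sq U V m \<le> 0" using finite_sum_le_infsum[OF s, of "{m}"] by simp
  then have "U m = 0 \<and> V m = 0" by (simp add: sq_def sum_power2_le_zero_iff)
  then show ?thesis by (simp add: U_def V_def)
qed

end

context gp begin

abbreviation nsq :: "(real \<Rightarrow> complex) \<Rightarrow> real" where
  "nsq f \<equiv> (LINT x:{0..T}|lborel. (cmod (f x))\<^sup>2)"

lemma bessel_pair:
  assumes "f \<in> L2_circle T" "g \<in> L2_circle T" "finite A"
  shows "(\<Sum>m\<in>A. sq (coef f) (coef g) m) \<le> (nsq f + nsq g) / T"
  using bessel[OF assms(1,3)] bessel[OF assms(2,3)] by (simp add: sq_def sum.distrib add_divide_distrib)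

lemma shifted_rows:
  assumes w: "w \<in> sobolev_circle 2 T" and z: "z \<in> sobolev_circle 2 T"
  shows "rowX \<mu> (PX (coef w) (coef z)) (PY (coef w) (coef z)) =
      PX (coef (fst (shifted JL \<mu> (w, z)))) (coef (snd (shifted JL \<mu> (w, z))))"
    "rowY \<mu> (PX (coef w) (coef z)) (PY (coef w) (coef z)) =
      PY (coef (fst (shifted JL \<mu> (w, z)))) (coef (snd (shifted JL \<mu> (w, z))))"
  by (rule ext, simp only: rows_P shifted_JL(3,4)[OF w z, abs_def])+

lemma shifted_injective:
  assumes \<mu>: "Re \<mu> > 0" and U: "U \<in> D" and W: "W \<in> D"
    and eq: "pair_eq (shifted JL \<mu> U) (shifted JL \<mu> W)"
  shows "pair_eq U W"
proof -
  obtain w z w' z' where UW: "U = (w, z)" "W = (w', z')" by (metis surj_pair)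
  have H: "w \<in> sobolev_circle 2 T" "z \<in> sobolev_circle 2 T" "w' \<in> sobolev_circle 2 T" "z' \<in> sobolev_circle 2 T"
    using U W UW by auto
  note L = H[THEN sobolev_2_weak_deriv(1)]
  have m: "f \<in> borel_measurable borel" if "f \<in> L2_circle T" for f using that by (simp add: L2_circle_def)
  have "AE x in lborel. fst (shifted JL \<mu> (w, z)) x = fst (shifted JL \<mu> (w', z')) x"
    "AE x in lborel. snd (shifted JL \<mu> (w, z)) x = snd (shifted JL \<mu> (w', z')) x"
    using eq by (auto simp: pair_eq_def UW)
  then have c: "coef (fst (shifted JL \<mu> (w, z))) = coef (fst (shifted JL \<mu> (w', z')))"
    "coef (snd (shifted JL \<mu> (w, z))) = coef (snd (shifted JL \<mu> (w', z')))"
    using H by (auto intro!: coef_cong_AE m shifted_JL)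
  have b: "(\<Sum>m\<in>A. sq (PX (coef f) (coef g)) (PY (coef f) (coef g)) m) \<le> 4 * ((nsq f + nsq g) / T)"
    if "f \<in> L2_circle T" "g \<in> L2_circle T" "finite A" for f g A
    by (rule sum_sq_P_le[OF bessel_pair]) (use that in auto)
  have "PX (coef w) (coef z) m = PX (coef w') (coef z') m \<and> PY (coef w) (coef z) m = PY (coef w') (coef z') m" for m
    by (rule rows_inj[OF \<mu> b[OF L(1,2)] b[OF L(3,4)]]) (simp_all add: shifted_rows H c)
  then have e: "PX (coef w) (coef z) = PX (coef w') (coef z')" "PY (coef w) (coef z) = PY (coef w') (coef z')"
    by auto
  have "coef w m = coef w' m" "coef z m = coef z' m" for m
    by (rule P_inject[OF e])+
  then have "AE x in lborel. w x = w' x" "AE x in lborel. z x = z' x"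
    using L by (auto intro!: coef_unique)
  then show ?thesis by (simp add: pair_eq_def UW)
qed

text \<open>Bessel bounds the coefficients of the image, and Parseval recovers the norm of the
  domain element. The factor 4 is the loss in \<open>sum_sq_P_le\<close>.\<close>

lemma shifted_bounded_below:
  assumes \<mu>: "Re \<mu> > 0"
  shows "\<exists>C. \<forall>U\<in>D. pair_norm T U \<le> C * pair_norm T (shifted JL \<mu> U)"
proof -
  obtain C where C: "C \<ge> 0" "\<And>X Y R. sq X Y summable_on UNIV \<Longrightarrow>
    (\<And>A. finite A \<Longrightarrow> (\<Sum>m\<in>A. sq (rowX \<mu> X Y) (rowY \<mu> X Y) m) \<le> R) \<Longrightarrow> infsum (sq X Y) UNIV \<le> C * R"
    by (rule rows_bound[OF \<mu>]) blast
  have "pair_norm T U \<le> sqrt (4 * C) * pair_norm T (shifted JL \<mu> U)" if "U \<in> D" for U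
  proof -
    obtain w z where U: "U = (w, z)" by (metis surj_pair)
    have H: "w \<in> sobolev_circle 2 T" "z \<in> sobolev_circle 2 T" using that U by auto
    define F G where "F = fst (shifted JL \<mu> (w, z))" and "G = snd (shifted JL \<mu> (w, z))"
    have FG: "F \<in> L2_circle T" "G \<in> L2_circle T" unfolding F_def G_def by (rule shifted_JL[OF H])+
    note L = H[THEN sobolev_2_weak_deriv(1)]
    let ?X = "PX (coef w) (coef z)" and ?Y = "PY (coef w) (coef z)"
    define R where "R = 4 * ((nsq F + nsq G) / T)"
    have b: "(\<Sum>m\<in>A. sq ?X ?Y m) \<le> 4 * ((nsq w + nsq z) / T)" if "finite A" for A
      by (rule sum_sq_P_le[OF bessel_pair[OF L]]) (use that in auto)
    then have su: "sq ?X ?Y summable_on UNIV"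
      by (intro nonneg_bdd_above_summable_on) (auto intro!: bdd_aboveI[of _ "4 * ((nsq w + nsq z) / T)"])
    have rows: "(\<Sum>m\<in>A. sq (rowX \<mu> ?X ?Y) (rowY \<mu> ?X ?Y) m) \<le> R" if "finite A" for A
      unfolding R_def shifted_rows[OF H] F_def[symmetric] G_def[symmetric]
      by (rule sum_sq_P_le[OF bessel_pair[OF FG]]) (use that in auto)
    have "infsum (sq ?X ?Y) UNIV \<le> C * R" by (rule C(2)[OF su rows])
    then have "(\<Sum>m\<in>A. sq ?X ?Y m) \<le> C * R" if "finite A" for A
      using finite_sum_le_infsum[OF su that] by simp
    then have fin: "(\<Sum>m\<in>A. sq (coef w) (coef z) m) \<le> C * R" if "finite A" for A
      using sum_sq_le_P that by blast
    have "((\<lambda>m. (cmod (coef w m))\<^sup>2 + (cmod (coef z m))\<^sup>2) has_sum (nsq w / T + nsq z / T)) UNIV"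
      by (intro has_sum_add parseval_of_AE_series L sobolev_2_series H)
    then have "nsq w / T + nsq z / T \<le> C * R"
      by (rule has_sum_le_finite_sums) (use fin in \<open>auto simp: sq_def\<close>)
    then have "(nsq w + nsq z) / T \<le> (4 * C * (nsq F + nsq G)) / T"
      by (simp add: R_def add_divide_distrib algebra_simps)
    then have "nsq w + nsq z \<le> 4 * C * (nsq F + nsq G)"
      using T_pos by (simp add: divide_le_cancel)
    then have "sqrt (nsq w + nsq z) \<le> sqrt (4 * C * (nsq F + nsq G))" by (rule real_sqrt_le_mono)
    then show ?thesis by (simp add: pair_norm_def U F_def G_def real_sqrt_mult)
  qed
  then show ?thesis by blast
qed

text \<open>Elliptic regularity: each row is solved for its only unbounded term, and what remains is
  square summable.\<close>

lemma dX_X_bound: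
  assumes XY: "\<And>A. finite A \<Longrightarrow> (\<Sum>m\<in>A. sq X Y m) \<le> K"
    and FG: "\<And>A. finite A \<Longrightarrow> (\<Sum>m\<in>A. sq (rowX \<mu> X Y) (rowY \<mu> X Y) m) \<le> R" and A: "finite A"
  shows "(\<Sum>m\<in>A. sq (\<lambda>m. of_real (dX m) * X m) (\<lambda>m. of_real (dY m) * Y m) m)
    \<le> 4 * R + 4 * (cmod \<mu>)\<^sup>2 * K + 2 * (1536 * (\<sigma> + \<delta>) ^ 4 * K)"
proof -
  have i: "\<i> * (\<i> * z) = - z" for z by (simp flip: mult.assoc)
  have "(\<Sum>m\<in>A. sq (\<lambda>m. of_real (dX m) * X m) (\<lambda>m. of_real (dY m) * Y m) m) \<le>
    (\<Sum>m\<in>A. 4 * sq (rowX \<mu> X Y) (rowY \<mu> X Y) m + 4 * (cmod \<mu>)\<^sup>2 * sq X Y m + 2 * sq (KX X Y) (KY X Y) m)"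
  proof (rule sum_mono)
    fix m
    have "of_real (dX m) * X m = (\<i> * rowX \<mu> X Y m + \<i> * \<mu> * X m) - KX X Y m"
      by (simp add: rowX_def algebra_simps i)
    then have 1: "(cmod (of_real (dX m) * X m))\<^sup>2 \<le> 2 * (2 * (cmod (rowX \<mu> X Y m))\<^sup>2 + 2 * ((cmod \<mu>)\<^sup>2 * (cmod (X m))\<^sup>2)) + 2 * (cmod (KX X Y m))\<^sup>2"
      using norm_diff_sq_le[of "\<i> * rowX \<mu> X Y m + \<i> * \<mu> * X m" "KX X Y m"] norm_add_sq_le[of "\<i> * rowX \<mu> X Y m" "\<i> * \<mu> * X m"]
      by (simp add: norm_mult power_mult_distrib)
    have "of_real (dY m) * Y m = (- \<i> * rowY \<mu> X Y m - \<i> * \<mu> * Y m) - KY X Y m"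
      by (simp add: rowY_def algebra_simps i)
    then have 2: "(cmod (of_real (dY m) * Y m))\<^sup>2 \<le> 2 * (2 * (cmod (rowY \<mu> X Y m))\<^sup>2 + 2 * ((cmod \<mu>)\<^sup>2 * (cmod (Y m))\<^sup>2)) + 2 * (cmod (KY X Y m))\<^sup>2"
      using norm_diff_sq_le[of "- \<i> * rowY \<mu> X Y m - \<i> * \<mu> * Y m" "KY X Y m"] norm_diff_sq_le[of "- \<i> * rowY \<mu> X Y m" "\<i> * \<mu> * Y m"]
      by (simp add: norm_mult power_mult_distrib)
    show "sq (\<lambda>m. of_real (dX m) * X m) (\<lambda>m. of_real (dY m) * Y m) m \<le>
      4 * sq (rowX \<mu> X Y) (rowY \<mu> X Y) m + 4 * (cmod \<mu>)\<^sup>2 * sq X Y m + 2 * sq (KX X Y) (KY X Y) m"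
      unfolding sq_def using 1 2 by (simp add: algebra_simps)
  qed
  also have "\<dots> = 4 * (\<Sum>m\<in>A. sq (rowX \<mu> X Y) (rowY \<mu> X Y) m) + 4 * (cmod \<mu>)\<^sup>2 * (\<Sum>m\<in>A. sq X Y m) + 2 * (\<Sum>m\<in>A. sq (KX X Y) (KY X Y) m)"
    by (simp only: sum.distrib sum_distrib_left)
  also have "\<dots> \<le> 4 * R + 4 * (cmod \<mu>)\<^sup>2 * K + 2 * (1536 * (\<sigma> + \<delta>) ^ 4 * K)"
    by (intro add_mono mult_left_mono FG XY A sum_norm_K_sq_le) auto
  finally show ?thesis .
qed

text \<open>Multiplying by \<open>dX\<close> and \<open>dY\<close> in co-rotating coefficients is
  multiplying by the symbol of - k^2/2 (d^2/dx^2 + 1) in the original ones. Undoing the factor k^2/2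
  and the constant shift leaves the weight \<open>(freq m)\<^sup>2\<close>.\<close>

lemma coef_decay:
  assumes ab: "\<And>A. finite A \<Longrightarrow> (\<Sum>m\<in>A. sq a b m) \<le> K"
    and dXY: "\<And>A. finite A \<Longrightarrow> (\<Sum>m\<in>A. sq (\<lambda>m. of_real (dX m) * PX a b m) (\<lambda>m. of_real (dY m) * PY a b m) m) \<le> R"
  obtains K' where "\<And>A. finite A \<Longrightarrow> (\<Sum>m\<in>A. sq (\<lambda>m. of_real ((freq m)\<^sup>2) * a m) (\<lambda>m. of_real ((freq m)\<^sup>2) * b m) m) \<le> K'"
proof -
  define a' b' where "a' m = of_real (k\<^sup>2 / 2 * ((s m)\<^sup>2 - 1)) * a m" and "b' m = of_real (k\<^sup>2 / 2 * ((s m)\<^sup>2 - 1)) * b m" for m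
  have P: "PX a' b' = (\<lambda>m. of_real (dX m) * PX a b m)" "PY a' b' = (\<lambda>m. of_real (dY m) * PY a b m)"
    by (auto simp only: PX_def PY_def a'_def b'_def dX_shift dY_shift distrib_left right_diff_distrib mult.left_commute)
  have a'b': "(\<Sum>m\<in>A. sq a' b' m) \<le> R" if "finite A" for A
    by (rule sum_sq_le_P[OF _ that]) (use dXY in \<open>simp add: P\<close>)
  have "(\<Sum>m\<in>A. sq (\<lambda>m. of_real ((freq m)\<^sup>2) * a m) (\<lambda>m. of_real ((freq m)\<^sup>2) * b m) m) \<le> 2 * (2 / k\<^sup>2)\<^sup>2 * R + 2 * K" if A: "finite A" for A
  proof -
    have "(\<Sum>m\<in>A. sq (\<lambda>m. of_real ((freq m)\<^sup>2) * a m) (\<lambda>m. of_real ((freq m)\<^sup>2) * b m) m) \<le> (\<Sum>m\<in>A. 2 * (2 / k\<^sup>2)\<^sup>2 * sq a' b' m + 2 * sq a b m)"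
    proof (rule sum_mono)
      fix m
      have e: "of_real ((freq m)\<^sup>2) * x = of_real (2 / k\<^sup>2) * (of_real (k\<^sup>2 / 2 * ((s m)\<^sup>2 - 1)) * x) + x" for x :: complex
      proof -
        have "(freq m)\<^sup>2 = 2 / k\<^sup>2 * (k\<^sup>2 / 2 * ((s m)\<^sup>2 - 1)) + 1" using k_pos by (simp add: freq_eq diff_divide_distrib)
        then show ?thesis by (metis (no_types, lifting) distrib_right mult.assoc mult_1 of_real_1 of_real_add of_real_mult)
      qed
      have 1: "(cmod (of_real ((freq m)\<^sup>2) * a m))\<^sup>2 \<le> 2 * ((2 / k\<^sup>2)\<^sup>2 * (cmod (a' m))\<^sup>2) + 2 * (cmod (a m))\<^sup>2"
        unfolding e[of "a m"] a'_def[symmetric] by (rule order_trans[OF norm_add_sq_le]) (simp add: norm_mult norm_divide norm_power power_divide power_mult_distrib)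
      have 2: "(cmod (of_real ((freq m)\<^sup>2) * b m))\<^sup>2 \<le> 2 * ((2 / k\<^sup>2)\<^sup>2 * (cmod (b' m))\<^sup>2) + 2 * (cmod (b m))\<^sup>2"
        unfolding e[of "b m"] b'_def[symmetric] by (rule order_trans[OF norm_add_sq_le]) (simp add: norm_mult norm_divide norm_power power_divide power_mult_distrib)
      show "sq (\<lambda>m. of_real ((freq m)\<^sup>2) * a m) (\<lambda>m. of_real ((freq m)\<^sup>2) * b m) m \<le> 2 * (2 / k\<^sup>2)\<^sup>2 * sq a' b' m + 2 * sq a b m"
        unfolding sq_def using 1 2 by (simp add: distrib_left)
    qed
    also have "\<dots> = 2 * (2 / k\<^sup>2)\<^sup>2 * (\<Sum>m\<in>A. sq a' b' m) + 2 * (\<Sum>m\<in>A. sq a b m)"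
      by (simp only: sum.distrib sum_distrib_left)
    also have "\<dots> \<le> 2 * (2 / k\<^sup>2)\<^sup>2 * R + 2 * K"
      by (intro add_mono mult_left_mono ab a'b' A) auto
    finally show ?thesis .
  qed
  then show thesis by (rule that)
qed

lemma decay_summable:
  assumes "\<And>A. finite A \<Longrightarrow> (\<Sum>m\<in>A. (cmod (of_real ((freq m)\<^sup>2) * a m))\<^sup>2) \<le> K"
  shows "abs_summable a" "abs_summable (\<lambda>m. \<i> * of_real (freq m) * a m)"
proof -
  have e: "cmod (of_real ((freq m)\<^sup>2) * a m) = (freq m)\<^sup>2 * cmod (a m)" for m
    by (simp add: norm_mult norm_power)
  show "abs_summable a"
  proof (rule abs_summable_quadratic_decay)
    fix m
    have "((freq m)\<^sup>2 * cmod (a m))\<^sup>2 \<le> K" using assms[of "{m}"] by (simp add: e del: of_real_power)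
    then show "(freq m)\<^sup>2 * cmod (a m) \<le> sqrt K" by (rule real_le_rsqrt)
  qed
  show "abs_summable (\<lambda>m. \<i> * of_real (freq m) * a m)"
    by (rule abs_summable_freq_mult[where K = K]) (use assms in \<open>simp add: e del: of_real_power\<close>)
qed

lemma shifted_surjective:
  assumes \<mu>: "Re \<mu> > 0" and F: "F \<in> L2_circle T" and G: "G \<in> L2_circle T"
  shows "\<exists>U\<in>D. pair_eq (shifted JL \<mu> U) (F, G)"
proof -
  let ?f = "coef F" and ?g = "coef G"
  define R where "R = 4 * ((nsq F + nsq G) / T)"
  have FG: "(\<Sum>m\<in>A. sq (PX ?f ?g) (PY ?f ?g) m) \<le> R" if "finite A" for A
    unfolding R_def by (rule sum_sq_P_le[OF bessel_pair[OF F G]]) (use that in auto)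
  obtain X Y K where XY: "\<And>m. rowX \<mu> X Y m = PX ?f ?g m" "\<And>m. rowY \<mu> X Y m = PY ?f ?g m"
    "\<And>A. finite A \<Longrightarrow> (\<Sum>m\<in>A. sq X Y m) \<le> K"
    by (rule solve_rows[OF \<mu> FG]) blast+
  \<comment> \<open>The inverse of the co-rotating change of variables.\<close>
  define a b where "a m = (X (m - int n) + Y (m + int n)) / 2" and "b m = (X (m - int n) - Y (m + int n)) / (2 * \<i>)" for m
  have P: "PX a b = X" "PY a b = Y"
    by (auto simp: PX_def PY_def a_def b_def field_simps)
  have ab: "(\<Sum>m\<in>A. sq a b m) \<le> K" if "finite A" for A
    by (rule sum_sq_le_P[OF _ that]) (simp add: P XY(3))
  have "(\<Sum>m\<in>A. sq (rowX \<mu> X Y) (rowY \<mu> X Y) m) \<le> R" if "finite A" for A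
    using FG[OF that] by (simp add: sq_def XY(1,2))
  from dX_X_bound[OF XY(3) this] obtain K' where K':
    "\<And>A. finite A \<Longrightarrow> (\<Sum>m\<in>A. sq (\<lambda>m. of_real ((freq m)\<^sup>2) * a m) (\<lambda>m. of_real ((freq m)\<^sup>2) * b m) m) \<le> K'"
    using coef_decay[OF ab] unfolding P by blast
  have da: "(\<Sum>m\<in>A. (cmod (of_real ((freq m)\<^sup>2) * a m))\<^sup>2) \<le> K'" and db: "(\<Sum>m\<in>A. (cmod (of_real ((freq m)\<^sup>2) * b m))\<^sup>2) \<le> K'"
    if "finite A" for A
    by (rule order_trans[OF sum_mono K'[OF that]], simp add: sq_def)+
  note sa = decay_summable[OF da] and sb = decay_summable[OF db]
  define w z where "w = series a" and "z = series b"
  have cw: "coef w = a" and cz: "coef z = b" unfolding w_def z_def using coef_series sa(1) sb(1) by auto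
  have wL: "w \<in> L2_circle T" "z \<in> L2_circle T" unfolding w_def z_def using L2_series[OF sa(1)] L2_series[OF sb(1)] by auto
  have c: "cfun w z \<in> L2_circle T" "coef (cfun w z) m = cc a b m" for m
    using cfun_L2_coef[OF wL(1) _ wL(2)] sa(1) sb(1) by (simp_all add: cw cz)
  have rows: "?f m = L2c a b m - \<mu> * a m" "?g m = - L1c a b m - \<mu> * b m" for m
  proof -
    have "PX ?f ?g = PX (\<lambda>m. L2c a b m - \<mu> * a m) (\<lambda>m. - L1c a b m - \<mu> * b m)"
      "PY ?f ?g = PY (\<lambda>m. L2c a b m - \<mu> * a m) (\<lambda>m. - L1c a b m - \<mu> * b m)"
      using XY(1,2) rows_P[of \<mu> a b] by (auto simp: P)
    from P_inject[OF this] show "?f m = L2c a b m - \<mu> * a m" "?g m = - L1c a b m - \<mu> * b m" by auto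
  qed
  \<comment> \<open>The equation solved for the second derivatives: \<open>hw\<close> and
    \<open>hz\<close> are what these must be. They are visibly square integrable, so the second
    derivatives exist as explicit functions and not just as coefficient sequences.\<close>
  define \<kappa> where "\<kappa> = complex_of_real (2 / k\<^sup>2)"
  define hw where "hw x = \<kappa> * ((2 * (complex_of_real (u_omega \<zeta> k \<epsilon> V0 B x) * cfun w z x) + G x) + \<mu> * z x) - w x" for x
  define hz where "hz x = \<kappa> * ((2 * (complex_of_real (v_omega \<zeta> k \<epsilon> V0 B x) * cfun w z x) - F x) - \<mu> * w x) - z x" for x
  note L = wL c(1) F G L2_add L2_diff L2_cmult L2_u_mult L2_v_mult
  have \<kappa>: "\<kappa> * (of_real (k\<^sup>2 / 2 * t) * x) = of_real t * x" for t x
    using k_pos by (simp add: \<kappa>_def)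
  have hL: "hw \<in> L2_circle T" "hz \<in> L2_circle T"
    unfolding hw_def[abs_def] hz_def[abs_def] by (intro L)+
  have "coef hw m = \<kappa> * ((2 * coef (\<lambda>x. complex_of_real (u_omega \<zeta> k \<epsilon> V0 B x) * cfun w z x) m + coef G m) + \<mu> * coef z m) - coef w m" for m
    unfolding hw_def[abs_def] by (simp only: coef_add coef_diff coef_cmult L)
  also have "\<dots> m = - (of_real (freq m))\<^sup>2 * a m" for m
  proof -
    have "coef G m + \<mu> * coef z m = - L1c a b m" by (simp add: rows cz)
    then have "2 * coef (\<lambda>x. complex_of_real (u_omega \<zeta> k \<epsilon> V0 B x) * cfun w z x) m + coef G m + \<mu> * coef z m
      = - (of_real (k\<^sup>2 / 2 * ((s m)\<^sup>2 - 1)) * a m)"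
      by (simp add: coef_u_mult c L1c_def algebra_simps)
    then show ?thesis by (simp only: cw mult_minus_right \<kappa>) (simp add: freq_eq algebra_simps)
  qed
  finally have chw: "coef hw m = - (of_real (freq m))\<^sup>2 * a m" for m .
  have "coef hz m = \<kappa> * ((2 * coef (\<lambda>x. complex_of_real (v_omega \<zeta> k \<epsilon> V0 B x) * cfun w z x) m - coef F m) - \<mu> * coef w m) - coef z m" for m
    unfolding hz_def[abs_def] by (simp only: coef_add coef_diff coef_cmult L)
  also have "\<dots> m = - (of_real (freq m))\<^sup>2 * b m" for m
  proof -
    have "coef F m + \<mu> * coef w m = L2c a b m" by (simp add: rows cw)
    moreover have "2 * coef (\<lambda>x. complex_of_real (v_omega \<zeta> k \<epsilon> V0 B x) * cfun w z x) m - L2c a b m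
      = - (of_real (k\<^sup>2 / 2 * ((s m)\<^sup>2 - 1)) * b m)"
      by (simp only: coef_v_mult[OF c(1)] c(2) L2c_def) simp
    ultimately have "2 * coef (\<lambda>x. complex_of_real (v_omega \<zeta> k \<epsilon> V0 B x) * cfun w z x) m - coef F m - \<mu> * coef w m
      = - (of_real (k\<^sup>2 / 2 * ((s m)\<^sup>2 - 1)) * b m)"
      by (simp only: diff_diff_eq)
    then show ?thesis by (simp only: cz mult_minus_right \<kappa>) (simp add: freq_eq algebra_simps)
  qed
  finally have chz: "coef hz m = - (of_real (freq m))\<^sup>2 * b m" for m .
  have H: "w \<in> sobolev_circle 2 T" "z \<in> sobolev_circle 2 T"
    unfolding w_def z_def
    using series_in_sobolev_2[OF sa hL(1) chw] series_in_sobolev_2[OF sb hL(2) chz] by auto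
  have "AE x in lborel. fst (shifted JL \<mu> (w, z)) x = F x" "AE x in lborel. snd (shifted JL \<mu> (w, z)) x = G x"
    using shifted_JL[OF H, of \<mu>] F G rows by (auto intro!: coef_unique simp: cw cz)
  then have "pair_eq (shifted JL \<mu> (w, z)) (F, G)" by (simp add: pair_eq_def)
  then show ?thesis using H by blast
qed

theorem spectrally_stable: "spectrally_stable \<zeta> k \<epsilon> n V0 B"
proof -
  have "\<mu> \<in> resolvent_set T D JL" if "Re \<mu> > 0" for \<mu>
    unfolding resolvent_set_def
    using shifted_injective[OF that] shifted_surjective[OF that] shifted_bounded_below[OF that] by blast
  then show ?thesis
    unfolding spectrally_stable_def Let_def spectrum_def T_def[symmetric] by force
qed

end

text \<open>Substituting \<epsilon> x for x and taking the real part of the exponential. Positivity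
  of the Fourier transform thus makes \<open>beta\<close> positive, so that the amplitude is
  positive for \<open>V0 < 0\<close>.\<close>

lemma beta_eq_fourier:
  assumes "integrable lborel \<zeta>" "\<epsilon> > 0"
  shows "beta \<zeta> k \<epsilon> = Re (fourier \<zeta> (2 * k * \<epsilon>))"
proof -
  have i: "integrable lborel (\<lambda>x. exp (- \<i> * complex_of_real (2 * k * \<epsilon> * x)) * complex_of_real (\<zeta> x))"
  proof (rule Bochner_Integration.integrable_bound[OF assms(1)])
    have [measurable]: "\<zeta> \<in> borel_measurable borel" using assms(1) by auto
    have [measurable]: "(\<lambda>x. exp (- \<i> * complex_of_real (2 * k * \<epsilon> * x))) \<in> borel_measurable borel"
      by (intro borel_measurable_continuous_onI continuous_intros)
    show "(\<lambda>x. exp (- \<i> * complex_of_real (2 * k * \<epsilon> * x)) * complex_of_real (\<zeta> x)) \<in> borel_measurable lborel"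
      by measurable
  qed (simp add: norm_mult)
  have "beta \<zeta> k \<epsilon> = \<bar>\<epsilon>\<bar> *\<^sub>R (LINT x|lborel. kernel \<zeta> \<epsilon> (0 + \<epsilon> * x) * cos (2 * k * (0 + \<epsilon> * x)))"
    unfolding beta_def by (rule lborel_integral_real_affine) (use assms in auto)
  also have "\<dots> = (LINT x|lborel. Re (exp (- \<i> * complex_of_real (2 * k * \<epsilon> * x)) * complex_of_real (\<zeta> x)))"
    unfolding real_scaleR_def integral_mult_right_zero[symmetric]
    by (rule Bochner_Integration.integral_cong) (use assms(2) in \<open>auto simp: kernel_def Re_exp mult_ac\<close>)
  also have "\<dots> = Re (fourier \<zeta> (2 * k * \<epsilon>))"
    unfolding fourier_def using integral_Re[OF i] by simp
  finally show ?thesis .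
qed

theorem theorem2:
  fixes \<zeta> :: "real \<Rightarrow> real" and \<delta> k \<epsilon> :: real and n :: nat
  assumes zeta_nonneg: "\<And>x. \<zeta> x \<ge> 0"
    and zeta_even: "\<And>x. \<zeta> (- x) = \<zeta> x"
    and zeta_integrable: "integrable lborel \<zeta>"
    and zeta_L1_norm: "(LINT x|lborel. \<bar>\<zeta> x\<bar>) = 1"
    and zeta_hat_pos: "\<And>s. fourier \<zeta> s \<in> \<real> \<and> Re (fourier \<zeta> s) > 0"
    and delta_pos: "\<delta> > 0"
    and zeta_hat_decay: "\<And>s. Re (fourier \<zeta> s) \<le> (1 + \<bar>s\<bar>) powr (- 1 / 2 - \<delta>)"
    and k_pos: "k > 0"
    and eps_pos: "\<epsilon> > 0"
    and n_pos: "n \<ge> 1"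
  shows "\<exists>Bstar>0. \<forall>B>Bstar. \<exists>vstar>0. \<forall>V0. - vstar < V0 \<and> V0 < 0 \<longrightarrow>
           spectrally_stable \<zeta> k \<epsilon> n V0 B"
proof -
  define r where "r m = Re (fourier \<zeta> (k * \<epsilon> * of_int m / real n))" for m :: int
  \<comment> \<open>The minimum runs over a finite set of frequencies, so it is attained and
    inherits positivity. The threshold 6 k^2 / r0 for \<open>B\<close> is \<open>B_large\<close> at
    the worst of them.\<close>
  define r0 where "r0 = Min (r ` {- (3 * int n)..3 * int n})"
  have "r0 \<in> r ` {- (3 * int n)..3 * int n}" unfolding r0_def by (rule Min_in) auto
  then have r0: "r0 > 0" using zeta_hat_pos by (auto simp: r_def)
  have r0_le: "r0 \<le> r m" if "\<bar>m\<bar> \<le> 3 * int n" for m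
    unfolding r0_def by (rule Min_le) (use that in \<open>auto intro!: imageI simp: abs_le_iff\<close>)
  define \<beta> where "\<beta> = beta \<zeta> k \<epsilon>"
  have \<beta>: "\<beta> > 0" unfolding \<beta>_def beta_eq_fourier[OF zeta_integrable eps_pos] using zeta_hat_pos by blast
  \<comment> \<open>Chosen so that A < k^2 / (6 n^2), which is what 96 n^2 \<delta>^2 \<le> k^2
    requires once \<delta>^2 \<le> A / 16.\<close>
  define vstar where "vstar = \<beta> * k\<^sup>2 / (6 * (real n)\<^sup>2)"
  have v: "vstar > 0" using \<beta> k_pos n_pos by (simp add: vstar_def)
  have "spectrally_stable \<zeta> k \<epsilon> n V0 B" if B: "B > 6 * k\<^sup>2 / r0" and V0: "- vstar < V0" "V0 < 0" for B V0
  proof -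
    define A where "A = amplitude \<zeta> k \<epsilon> 1 V0"
    have A_eq: "A = - V0 / \<beta>" by (simp add: A_def amplitude_def \<beta>_def)
    have A0: "A \<ge> 0" using V0 \<beta> by (simp add: A_eq divide_nonpos_pos)
    have "A \<le> vstar / \<beta>" unfolding A_eq using V0 \<beta> by (intro divide_right_mono) auto
    then have A1: "6 * (real n)\<^sup>2 * A \<le> k\<^sup>2" using \<beta> n_pos by (simp add: vstar_def field_simps)
    have "6 * k\<^sup>2 / r0 > 0" using r0 k_pos by simp
    then have B0: "B > 0" using B by linarith
    have "gp \<zeta> k \<epsilon> n V0 B"
    proof
      show "0 \<le> amplitude \<zeta> k \<epsilon> 1 V0" using A0 by (simp add: A_def)
      show "6 * k\<^sup>2 \<le> B * Re (fourier \<zeta> (k * \<epsilon> * of_int m / real n))" if m: "\<bar>m\<bar> \<le> 3 * int n" for m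
      proof -
        have "6 * k\<^sup>2 \<le> B * r0" using B r0 by (simp add: field_simps)
        also have "\<dots> \<le> B * r m" using r0_le[OF m] B0 by (intro mult_left_mono) auto
        finally show ?thesis by (simp add: r_def)
      qed
      \<comment> \<open>Subadditivity of the square root bounds \<open>\<delta>\<close> by sqrt A /
        4 without reference to \<open>B\<close>.\<close>
      have "sqrt (B + A) \<le> sqrt B + sqrt A" using B0 A0 by (intro sqrt_add_le_add_sqrt) auto
      moreover have "sqrt B \<le> sqrt (B + A)" using A0 by simp
      ultimately have "((sqrt (B + A) - sqrt B) / 4)\<^sup>2 \<le> (sqrt A / 4)\<^sup>2" by (intro power_mono) auto
      also have "\<dots> = A / 16" using A0 by (simp add: power_divide)
      finally have "96 * (real n)\<^sup>2 * ((sqrt (B + A) - sqrt B) / 4)\<^sup>2 \<le> 96 * (real n)\<^sup>2 * (A / 16)"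
        by (intro mult_left_mono) auto
      then show "96 * (real n)\<^sup>2 * ((sqrt (B + amplitude \<zeta> k \<epsilon> 1 V0) - sqrt B) / 4)\<^sup>2 \<le> k\<^sup>2"
        using A1 unfolding A_def by linarith
    qed (use assms B0 in auto)
    then show ?thesis by (rule gp.spectrally_stable)
  qed
  moreover have "6 * k\<^sup>2 / r0 > 0" using r0 k_pos by simp
  ultimately show ?thesis using v by blast
qed

end
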